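(* Let $d\ge1$. The subdivision tree $S(T_{d+1}^* )$ of the $(d+1)$-greedy tree is the only optimal tree in $\mathcal{S}(\mathcal{T})_{n,d+1}$. In other words, for every tree $T$ of order $n$ with maximum degree $d+1$, $$M(S(T_{d+1}^* ),x)\le M(S(T),x)\quad\text{for all }x>0,$$ with equality if and only if $T=T_{d+1}^*$ (up to isomorphism).
   Context: $\mathcal{T}_{n,d+1}$ is the set of trees of order $n$ with maximum degree $d+1$. The subdivision tree $S(T)$ of a tree $T$ is obtained by inserting a new vertex into every edge of $T$. For a tree $T$, $m(T,k)$ is the number of matchings with exactly $k$ edges ($m(T,0)=1$) and $M(T,x)=\sum_{k\ge0}m(T,k)x^k$. $\mathcal{S}(\mathcal{T})_{n,d+1}=\{S(T):T\in\mathcal{T}_{n,d+1}\}$, and $S(\tilde T)$ is optimal if $M(S(T),x)\ge M(S(\tilde T),x)$ for all $T\in\mathcal{T}_{n,d+1}$ and all $x>0$. A rooted $d$-ary tree is a rooted tree in which every vertex has $0$ or $d$ children; the complete $d$-ary tree $C_h$ is the rooted $d$-ary tree all of whose leaves are at distance $h-1$ from the root. For a vertex $u$ of a rooted tree, $T(u)$ is the subtree of $u$ and its descendants. The $(d+1)$-greedy tree $T_{d+1}^*$ (of order $n$) is a rooted tree with root $v_0$ and maximum degree $d+1$ such that: (1) $\deg(v_0)=d+1$; (2) the heights of any two pendent vertices differ by at most $1$; (3) for every vertex $v$, at most one of the subtrees $T(u)$, $u$ a child of $v$, is not a complete $d$-ary tree.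
   Formalization: Conditions (1)-(3) do not determine the greedy tree (d=2, n=10: three branches C_2, or C_2, C_2 and a pendent 3-vertex path), so it is also required that the heights of any two vertices of degree less than d+1 differ by at most 1. *)

theory Defs
  imports Complex_Main
begin

text \<open>Graphs are pairs of a vertex set and a set of edges, an edge being a two-element set of vertices.\<close>

type_synonym 'a ugraph = "'a set \<times> 'a set set"

abbreviation gverts :: "'a ugraph \<Rightarrow> 'a set" where "gverts \<equiv> fst"
abbreviation gedges :: "'a ugraph \<Rightarrow> 'a set set" where "gedges \<equiv> snd"

definition finite_simple_graph :: "'a ugraph \<Rightarrow> bool" where
  "finite_simple_graph G \<longleftrightarrow> finite (gverts G) \<and>
     (\<forall>e\<in>gedges G. \<exists>u\<in>gverts G. \<exists>v\<in>gverts G. u \<noteq> v \<and> e = {u, v})"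

definition graph_path :: "'a ugraph \<Rightarrow> 'a list \<Rightarrow> bool" where
  "graph_path G p \<longleftrightarrow> p \<noteq> [] \<and> distinct p \<and> set p \<subseteq> gverts G \<and>
     successively (\<lambda>u v. {u, v} \<in> gedges G) p"

definition path_between :: "'a ugraph \<Rightarrow> 'a \<Rightarrow> 'a list \<Rightarrow> 'a \<Rightarrow> bool" where
  "path_between G u p v \<longleftrightarrow> graph_path G p \<and> hd p = u \<and> last p = v"

definition graph_cycle :: "'a ugraph \<Rightarrow> 'a list \<Rightarrow> bool" where
  "graph_cycle G p \<longleftrightarrow> graph_path G p \<and> length p \<ge> 3 \<and> {last p, hd p} \<in> gedges G"

definition connected_graph :: "'a ugraph \<Rightarrow> bool" where
  "connected_graph G \<longleftrightarrow> gverts G \<noteq> {} \<and>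
     (\<forall>u\<in>gverts G. \<forall>v\<in>gverts G. \<exists>p. path_between G u p v)"

definition tree_graph :: "'a ugraph \<Rightarrow> bool" where
  "tree_graph G \<longleftrightarrow> finite_simple_graph G \<and> connected_graph G \<and> (\<nexists>p. graph_cycle G p)"

definition vertex_degree :: "'a ugraph \<Rightarrow> 'a \<Rightarrow> nat" where
  "vertex_degree G v = card {e \<in> gedges G. v \<in> e}"

definition max_degree :: "'a ugraph \<Rightarrow> nat" where
  "max_degree G = Max (vertex_degree G ` gverts G)"

definition graph_dist :: "'a ugraph \<Rightarrow> 'a \<Rightarrow> 'a \<Rightarrow> nat" where
  "graph_dist G u v = (LEAST k. \<exists>p. path_between G u p v \<and> length p = Suc k)"

definition graph_isomorphic :: "'a ugraph \<Rightarrow> 'b ugraph \<Rightarrow> bool" where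
  "graph_isomorphic G H \<longleftrightarrow>
     (\<exists>f. bij_betw f (gverts G) (gverts H) \<and> (\<lambda>e. f ` e) ` gedges G = gedges H)"

text \<open>\<open>tree_class n k\<close> is the set of trees of order \<open>n\<close> with maximum degree (exactly) \<open>k\<close>.\<close>

definition tree_class :: "nat \<Rightarrow> nat \<Rightarrow> 'a ugraph set" where
  "tree_class n k = {T. tree_graph T \<and> card (gverts T) = n \<and> max_degree T = k}"

text \<open>In the subdivision, \<open>Inr e\<close> is the new vertex inserted into the edge \<open>e\<close>.\<close>

definition subdivision_graph :: "'a ugraph \<Rightarrow> ('a + 'a set) ugraph" where
  "subdivision_graph G =
     (Inl ` gverts G \<union> Inr ` gedges G,
      {{Inl v, Inr e} | v e. e \<in> gedges G \<and> v \<in> e})"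

definition matchings :: "'a ugraph \<Rightarrow> nat \<Rightarrow> 'a set set set" where
  "matchings G k = {F. F \<subseteq> gedges G \<and> card F = k \<and> pairwise disjnt F}"

text \<open>Matchings have at most \<open>card (gedges G)\<close> edges, so the sum over all \<open>k\<close> can be cut off there.\<close>

definition matching_gf :: "'a ugraph \<Rightarrow> real \<Rightarrow> real" where
  "matching_gf G x = (\<Sum>k\<le>card (gedges G). real (card (matchings G k)) * x ^ k)"

definition subdivision_class :: "nat \<Rightarrow> nat \<Rightarrow> ('a + 'a set) ugraph set" where
  "subdivision_class n k = subdivision_graph ` tree_class n k"

definition optimal_subdivision :: "nat \<Rightarrow> nat \<Rightarrow> ('a + 'a set) ugraph \<Rightarrow> bool" where
  "optimal_subdivision n k G \<longleftrightarrow> G \<in> subdivision_class n k \<and>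
     (\<forall>T\<in>(tree_class n k :: 'a ugraph set). \<forall>x>0. matching_gf (subdivision_graph T) x \<ge> matching_gf G x)"

text \<open>A rooted tree is a tree \<open>T\<close> together with a root \<open>r\<close>. The descendants of \<open>u\<close> (\<open>u\<close> included)
  are the vertices whose path from the root, which is unique, passes through \<open>u\<close>.\<close>

definition descendants :: "'a ugraph \<Rightarrow> 'a \<Rightarrow> 'a \<Rightarrow> 'a set" where
  "descendants T r u = {w. \<exists>p. path_between T r p w \<and> u \<in> set p}"

definition children :: "'a ugraph \<Rightarrow> 'a \<Rightarrow> 'a \<Rightarrow> 'a set" where
  "children T r u = {w \<in> descendants T r u. {u, w} \<in> gedges T}"

definition subtree_at :: "'a ugraph \<Rightarrow> 'a \<Rightarrow> 'a \<Rightarrow> 'a ugraph" where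
  "subtree_at T r u = (descendants T r u, {e \<in> gedges T. e \<subseteq> descendants T r u})"

definition rooted_tree :: "'a ugraph \<Rightarrow> 'a \<Rightarrow> bool" where
  "rooted_tree T r \<longleftrightarrow> tree_graph T \<and> r \<in> gverts T"

definition rooted_dary_tree :: "nat \<Rightarrow> 'a ugraph \<Rightarrow> 'a \<Rightarrow> bool" where
  "rooted_dary_tree d T r \<longleftrightarrow> rooted_tree T r \<and>
     (\<forall>v\<in>gverts T. card (children T r v) = 0 \<or> card (children T r v) = d)"

text \<open>A leaf of a rooted d-ary tree is a vertex without children, so that the one-vertex tree is the
  complete tree with \<open>h = 1\<close>, and for \<open>d = 1\<close> the root of a longer path is not a leaf.\<close>

definition complete_dary_tree :: "nat \<Rightarrow> nat \<Rightarrow> 'a ugraph \<Rightarrow> 'a \<Rightarrow> bool" where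
  "complete_dary_tree d h T r \<longleftrightarrow> h \<ge> 1 \<and> rooted_dary_tree d T r \<and>
     (\<forall>v\<in>gverts T. children T r v = {} \<longrightarrow> graph_dist T r v = h - 1)"

text \<open>The last conjunct of \<open>greedy_tree\<close> makes precise that levels are filled greedily: only vertices in the last two levels
  may have degree less than \<open>d + 1\<close>. Without it the tree need not be unique: for \<open>d = 2\<close> and
  \<open>n = 10\<close>, a root with two children carrying two leaves each and a pendent path with three vertices
  attached as the third branch satisfies all the other conditions, and so does the tree whose
  root and three neighbours all have degree 3.\<close>

definition greedy_tree :: "nat \<Rightarrow> nat \<Rightarrow> 'a ugraph \<Rightarrow> 'a \<Rightarrow> bool" where
  "greedy_tree d n T v0 \<longleftrightarrow>
     rooted_tree T v0 \<and> card (gverts T) = n \<and> max_degree T = d + 1 \<and>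
     vertex_degree T v0 = d + 1 \<and>
     (\<forall>u\<in>gverts T. \<forall>v\<in>gverts T. vertex_degree T u = 1 \<and> vertex_degree T v = 1 \<longrightarrow>
        graph_dist T v0 u \<le> graph_dist T v0 v + 1) \<and>
     (\<forall>v\<in>gverts T. card {u \<in> children T v0 v.
        \<not> (\<exists>h. complete_dary_tree d h (subtree_at T v0 u) u)} \<le> 1) \<and>
     (\<forall>u\<in>gverts T. \<forall>v\<in>gverts T. vertex_degree T u < d + 1 \<and> vertex_degree T v < d + 1 \<longrightarrow>
        graph_dist T v0 u \<le> graph_dist T v0 v + 1)"

end

theory Submission
  imports Defs "HOL-Library.Multiset"
begin

text \<open>Regard a tree as an electrical network with conductance \<open>x\<close> on each edge and conductance 1 from each
  vertex to the ground. The matching generating function of the subdivision is then, up to a factor invariant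
  under exchanging branches, bilinear in the total conductances of the branches at the two ends of a path. In a
  minimal tree exchanges cannot help, so strict concavity forces every branch at one end to be at least as
  conductive as every branch at the other. Root a minimal tree at a vertex of maximal conductance and compare
  its branches with the complete \<open>d\<close>-ary trees, whose conductances \<open>c\<^sub>0 < c\<^sub>1 < \<dots>\<close> increase: the
  children of any vertex all lie in one band \<open>[c\<^sub>h, c\<^sub>h\<^sub>+\<^sub>1]\<close>, at most one of them strictly inside, and those at the ends
  of the band are complete. This is the greedy tree, which is determined by its order.\<close>

section \<open>Padded rooted trees\<close>

text \<open>The exchange argument runs at one fixed \<open>x\<close>, but its outcome,
  \<open>greedy_code\<close>, does not mention \<open>x\<close>; hence a single tree is minimal for
  every \<open>x\<close>, and equality at one \<open>x\<close> already forces isomorphism.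
  Minimality of the greedy tree is not computed: a minimum exists because there are finitely many
  codes of a given order, every minimiser is greedy, and a greedy code is determined by its order.
  Exchanges may lower the maximum degree, so minimality is among trees of degree at most
  \<open>d + 1\<close>; a minimiser with at least \<open>d + 2\<close> vertices turns out to contain
  a vertex of degree exactly \<open>d + 1\<close>. Two facts carry the band structure. Two branches
  strictly inside one band, at the ends of a path, would lead to two such branches one band lower,
  and so on down to the band from 0 to 1, whose interior contains no conductance. And the map v -> 1
  + d par(v), which takes each \<open>cval h\<close> to the next, strictly raises the conductance of
  every full branch; this rules out valleys along paths, so that below the chosen root domination
  always points the same way.\<close>

text \<open>A branch of a rooted tree is padded with empty branches so that every vertex has exactly \<open>d\<close>
  children, and the root of the whole tree \<open>d + 1\<close>; the degree bound then becomes \<open>full_root\<close>, and any two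
  branches can be exchanged.\<close>

datatype pt = Emp | Node "pt multiset"

primrec order :: "pt \<Rightarrow> nat" where
  "order Emp = 0"
| "order (Node X) = Suc (\<Sum>n\<in>#image_mset order X. n)"

primrec full :: "nat \<Rightarrow> pt \<Rightarrow> bool" where
  "full d Emp = True"
| "full d (Node X) = (size X = d \<and> (\<forall>b\<in>#image_mset (full d) X. b))"

definition full_root :: "nat \<Rightarrow> pt \<Rightarrow> bool" where
  "full_root d t \<longleftrightarrow> (\<exists>X. t = Node X \<and> size X = Suc d \<and> (\<forall>s\<in>#X. full d s))"

primrec ctree :: "nat \<Rightarrow> nat \<Rightarrow> pt" where
  "ctree d 0 = Emp"
| "ctree d (Suc h) = Node (replicate_mset d (ctree d h))"

section \<open>Bounds on sums over multisets\<close>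

lemma mset_eq_replicate: "(\<And>s. s \<in># X \<Longrightarrow> s = c) \<Longrightarrow> X = replicate_mset (size X) c"
  by (induction X) auto

lemma sum_mset_le_size:
  fixes g :: "'b \<Rightarrow> 'c::linordered_semidom"
  assumes "\<And>s. s \<in># X \<Longrightarrow> g s \<le> c"
  shows "(\<Sum>s\<in>#X. g s) \<le> of_nat (size X) * c"
  using assms by (induction X) (auto simp: distrib_right intro!: add_mono)

lemma sum_mset_less_size:
  fixes g :: "'b \<Rightarrow> 'c::linordered_semidom"
  assumes "\<And>s. s \<in># X \<Longrightarrow> g s \<le> c" "s \<in># X" "g s < c"
  shows "(\<Sum>s\<in>#X. g s) < of_nat (size X) * c"
proof -
  obtain Y where "X = add_mset s Y" using assms(2) by (metis insert_DiffM)
  with sum_mset_le_size[of Y g c] assms show ?thesis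
    by (auto simp: distrib_right intro!: add_less_le_mono)
qed

lemma sum_mset_ge_size:
  fixes g :: "'b \<Rightarrow> 'c::linordered_semidom"
  assumes "\<And>s. s \<in># X \<Longrightarrow> c \<le> g s"
  shows "of_nat (size X) * c \<le> (\<Sum>s\<in>#X. g s)"
  using assms by (induction X) (auto simp: distrib_right intro!: add_mono)

lemma sum_mset_greater_size:
  fixes g :: "'b \<Rightarrow> 'c::linordered_semidom"
  assumes "\<And>s. s \<in># X \<Longrightarrow> c \<le> g s" "s \<in># X" "c < g s"
  shows "of_nat (size X) * c < (\<Sum>s\<in>#X. g s)"
proof -
  obtain Y where "X = add_mset s Y" using assms(2) by (metis insert_DiffM)
  with sum_mset_ge_size[of Y c g] assms show ?thesis
    by (auto simp: distrib_right intro!: add_less_le_mono)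
qed


section \<open>Conductances\<close>

locale network =
  fixes x :: real and d :: nat
  assumes x_pos: "x > 0" and d_pos: "d > 0"
begin

text \<open>Consider the rooted tree \<open>t\<close> as an electrical network in which every edge has conductance \<open>x\<close> and every
  vertex is grounded with conductance 1. Then \<open>val t\<close> is the conductance from the root to the ground and
  \<open>par (val t)\<close> that of the branch \<open>t\<close> together with the edge to its parent. In terms of matchings,
  \<open>gf t\<close> is the generating function of the subdivision of \<open>t\<close>, \<open>weight t\<close> the one after attaching
  the vertex that subdivides the edge to the parent, and \<open>val t\<close> the ratio of \<open>gf t\<close> to the
  generating function without the root.\<close>

definition par :: "real \<Rightarrow> real" where
  "par v = x * v / (v + x)"

primrec val :: "pt \<Rightarrow> real" where
  "val Emp = 0"
| "val (Node X) = 1 + (\<Sum>v\<in>#image_mset val X. par v)"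

primrec weight :: "pt \<Rightarrow> real" where
  "weight Emp = 1"
| "weight (Node X) = (val (Node X) + x) * (\<Prod>w\<in>#image_mset weight X. w)"

primrec gf :: "pt \<Rightarrow> real" where
  "gf Emp = 1"
| "gf (Node X) = val (Node X) * (\<Prod>s\<in>#X. weight s)"

abbreviation csum :: "pt multiset \<Rightarrow> real" where
  "csum X \<equiv> (\<Sum>s\<in>#X. par (val s))"

abbreviation wprod :: "pt multiset \<Rightarrow> real" where
  "wprod X \<equiv> (\<Prod>s\<in>#X. weight s)"

lemma val_Node: "val (Node X) = 1 + csum X"
  by (simp add: image_mset.compositionality o_def)

lemma weight_Node: "weight (Node X) = (1 + csum X + x) * wprod X"
  by (simp add: image_mset.compositionality o_def)

lemma gf_Node: "gf (Node X) = (1 + csum X) * wprod X"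
  by (simp add: image_mset.compositionality o_def)

lemma par_0 [simp]: "par 0 = 0"
  by (simp add: par_def)

lemma par_strict_mono:
  assumes "0 \<le> u" "u < v"
  shows "par u < par v"
proof -
  have "0 < x * (x * (v - u))" using assms x_pos by simp
  then have "x * u * (v + x) < x * v * (u + x)" by (simp add: algebra_simps)
  then show ?thesis using assms x_pos by (simp add: par_def divide_simps)
qed

lemma par_mono:
  assumes "0 \<le> u" "u \<le> v"
  shows "par u \<le> par v"
  using par_strict_mono[of u v] assms by (cases "u = v") auto

lemma par_nonneg: "0 \<le> u \<Longrightarrow> 0 \<le> par u"
  using par_mono[of 0 u] by simp

lemma val_nonneg [simp]: "0 \<le> val t"
proof (induction t)
  case (Node X)
  have "0 \<le> csum X" using Node sum_mset_ge_size[of X 0 "\<lambda>s. par (val s)"] par_nonneg by simp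
  then show ?case by (simp only: val_Node)
qed simp

lemma csum_nonneg: "0 \<le> csum X"
  using sum_mset_ge_size[of X 0 "\<lambda>s. par (val s)"] par_nonneg by simp

lemma val_Node_ge1: "1 \<le> val (Node X)"
  using csum_nonneg val_Node by simp

lemma weight_pos: "0 < weight t"
proof (induction t)
  case (Node X)
  have "0 < wprod X" using Node by (induction X) auto
  then show ?case using csum_nonneg[of X] x_pos unfolding weight_Node by simp
qed simp

lemma wprod_pos: "0 < wprod X"
  by (induction X) (auto simp: weight_pos)

lemma val_pos_Node: assumes "0 < val t" obtains X where "t = Node X"
  using assms by (cases t) auto

section \<open>Conductances of complete trees and the bands between them\<close>

primrec cval :: "nat \<Rightarrow> real" where
  "cval 0 = 0"
| "cval (Suc h) = 1 + d * par (cval h)"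

abbreviation "\<C> \<equiv> ctree d"

lemma val_ctree: "val (\<C> h) = cval h"
  by (induction h) (auto simp: val_Node)

lemma cval_nonneg: "0 \<le> cval h"
  by (metis val_ctree val_nonneg)

lemma cval_Suc_less: "cval h < cval (Suc h)"
proof (induction h)
  case (Suc h)
  then show ?case using par_strict_mono[OF cval_nonneg Suc] d_pos by simp
qed simp

lemma cval_strict_mono: "strict_mono cval"
  unfolding strict_mono_Suc_iff using cval_Suc_less by blast

lemma cval_le_iff: "cval h \<le> cval k \<longleftrightarrow> h \<le> k"
  using cval_strict_mono by (simp add: strict_mono_less_eq)

lemma cval_eq_iff: "cval h = cval k \<longleftrightarrow> h = k"
  using cval_strict_mono by (simp add: strict_mono_eq)

lemma val_Node_le:
  assumes "\<And>s. s \<in># X \<Longrightarrow> val s \<le> v"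
  shows "val (Node X) \<le> 1 + real (size X) * par v"
  using sum_mset_le_size[of X "\<lambda>s. par (val s)" "par v"] assms par_mono val_Node by simp

lemma val_Node_ge:
  assumes "\<And>s. s \<in># X \<Longrightarrow> v \<le> val s" "0 \<le> v"
  shows "1 + real (size X) * par v \<le> val (Node X)"
  using sum_mset_ge_size[of X "par v" "\<lambda>s. par (val s)"] assms par_mono val_Node by simp

lemma val_Node_less:
  assumes "\<And>s. s \<in># X \<Longrightarrow> val s \<le> v" "s \<in># X" "val s < v"
  shows "val (Node X) < 1 + real (size X) * par v"
  using sum_mset_less_size[of X "\<lambda>s. par (val s)" "par v" s] assms par_mono par_strict_mono val_Node
  by simp

lemma val_Node_greater:
  assumes "\<And>s. s \<in># X \<Longrightarrow> v \<le> val s" "0 \<le> v" "s \<in># X" "v < val s"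
  shows "1 + real (size X) * par v < val (Node X)"
  using sum_mset_greater_size[of X "par v" "\<lambda>s. par (val s)" s] assms par_mono par_strict_mono val_Node
  by simp

lemma full_Node: "full d (Node X) \<longleftrightarrow> size X = d \<and> (\<forall>s\<in>#X. full d s)"
  by simp

text \<open>As \<open>cval\<close> increases, one index can serve all children at once. The vertex
  itself costs one more index, and a second one makes the bound strict again.\<close>

lemma val_bounded: "full d t \<Longrightarrow> \<exists>k. val t < cval k"
proof (induction t)
  case Emp
  show ?case using cval_Suc_less[of 0] by (intro exI[of _ "Suc 0"]) simp
next
  case (Node X)
  have "\<exists>k. \<forall>s\<in>#Y. val s < cval k" if "\<forall>s\<in>#Y. \<exists>k. val s < cval k" for Y
    using that
  proof (induction Y)
    case (add s Y)
    then obtain k l where k: "\<forall>s\<in>#Y. val s < cval k" and l: "val s < cval l" by auto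
    have "cval k \<le> cval (max k l)" "cval l \<le> cval (max k l)" using cval_le_iff by auto
    with k l show ?case by (intro exI[of _ "max k l"]) force
  qed simp
  moreover have "\<forall>s\<in>#X. \<exists>k. val s < cval k" using Node by (simp only: full_Node) blast
  ultimately obtain k where "\<forall>s\<in>#X. val s < cval k" by blast
  then have "val (Node X) \<le> cval (Suc k)"
    using val_Node_le[of X "cval k"] Node.prems by (simp add: less_imp_le del: val.simps)
  then show ?case using cval_Suc_less[of "Suc k"] by (intro exI[of _ "Suc (Suc k)"]) linarith
qed

lemma val_band:
  assumes "full d t"
  obtains h where "cval h \<le> val t" "val t < cval (Suc h)"
proof -
  obtain k where k: "val t < cval k" using val_bounded assms by blast
  define m where "m = (LEAST k. val t < cval k)"
  have m: "val t < cval m" unfolding m_def using k by (rule LeastI)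
  have "m \<noteq> 0" using m val_nonneg[of t] by (metis cval.simps(1) not_less)
  then obtain h where h: "m = Suc h" using not0_implies_Suc by blast
  have "\<not> val t < cval h" using not_less_Least[of h "\<lambda>k. val t < cval k"] h m_def by simp
  with m h that show ?thesis by force
qed

text \<open>The map v -> 1 + d par(v) is increasing and takes \<open>cval h\<close> to
  \<open>cval (Suc h)\<close>. A point between these two, the upper one excluded, is therefore sent
  to the upper one or beyond, hence above itself.\<close>

lemma val_less_step: "full d t \<Longrightarrow> val t < 1 + d * par (val t)"
proof -
  assume "full d t"
  then obtain h where h: "cval h \<le> val t" "val t < cval (Suc h)" by (rule val_band)
  then have "d * par (cval h) \<le> d * par (val t)" using par_mono[OF cval_nonneg] by (simp add: mult_left_mono)
  with h show ?thesis by simp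
qed

text \<open>Children of conductance at most \<open>cval h\<close> would add up to at most
  \<open>cval (Suc h)\<close>. With the mirror image below, a vertex strictly inside one band has a
  child above the lower end and a child below the upper end of the band beneath, though not
  necessarily the same child.\<close>

lemma val_greater_cval_Suc:
  assumes "size X = d" "cval (Suc h) < val (Node X)"
  shows "\<exists>s\<in>#X. cval h < val s"
  using val_Node_le[of X "cval h"] assms by (auto simp del: val.simps simp: not_less[symmetric])

lemma val_less_cval_Suc:
  assumes "size X = d" "val (Node X) < cval (Suc h)"
  shows "\<exists>s\<in>#X. val s < cval h"
  using val_Node_ge[of X "cval h"] assms cval_nonneg by (auto simp del: val.simps simp: not_less[symmetric])

end

section \<open>Exchanging branches in a minimal tree\<close>

context network begin

definition opt :: "pt \<Rightarrow> bool" where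
  "opt t \<longleftrightarrow> full_root d t \<and> (\<forall>t'. full_root d t' \<and> order t' = order t \<longrightarrow> gf t \<le> gf t')"

definition dominates :: "pt multiset \<Rightarrow> pt multiset \<Rightarrow> bool" where
  "dominates X Y \<longleftrightarrow> (\<forall>a\<in>#X. \<forall>b\<in>#Y. val b \<le> val a)"

text \<open>In \<open>Node (add_mset (chain Ks Z) X)\<close> a path with
  \<open>length Ks + 2\<close> vertices starts at the root: \<open>X\<close> and \<open>Z\<close>
  are the branches off the path at its two ends, and the members of \<open>Ks\<close> those at its
  inner vertices.\<close>

primrec chain :: "pt multiset list \<Rightarrow> pt multiset \<Rightarrow> pt" where
  "chain [] Z = Node Z"
| "chain (K # Ks) Z = Node (add_mset (chain Ks Z) K)"

section \<open>Moving the root across an edge\<close>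

lemma full_root_Node: "full_root d (Node X) \<longleftrightarrow> size X = Suc d \<and> (\<forall>s\<in>#X. full d s)"
  by (auto simp: full_root_def)

lemma order_Node: "order (Node X) = Suc (\<Sum>s\<in>#X. order s)"
  by simp

lemma par_mult: "0 \<le> v \<Longrightarrow> par v * (v + x) = x * v"
  using x_pos by (simp add: par_def)

text \<open>The form is symmetric in \<open>X\<close> and \<open>Y\<close>, which is what rerooting
  needs. The three summands count the matchings that leave the new vertex on the edge unmatched,
  match it with the end carrying \<open>Y\<close>, or match it with the end carrying
  \<open>X\<close>.\<close>

lemma gf_edge:
  "gf (Node (add_mset (Node Y) X)) =
     ((1 + csum X) * (1 + csum Y) + x * (1 + csum X) + x * (1 + csum Y)) * (wprod X * wprod Y)"
proof -
  have "par (1 + csum Y) * (1 + csum Y + x) = x * (1 + csum Y)"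
    using par_mult csum_nonneg[of Y] by simp
  moreover have "gf (Node (add_mset (Node Y) X)) =
     ((1 + csum X) * (1 + csum Y + x) + par (1 + csum Y) * (1 + csum Y + x)) * (wprod X * wprod Y)"
    by (simp add: gf_Node weight_Node val_Node algebra_simps del: gf.simps weight.simps val.simps)
  ultimately show ?thesis by (simp add: algebra_simps)
qed

lemma gf_reroot: "gf (Node (add_mset (Node Y) X)) = gf (Node (add_mset (Node X) Y))"
  unfolding gf_edge by (simp add: algebra_simps)

lemma full_reroot:
  "full_root d (Node (add_mset (Node Y) X)) \<Longrightarrow> full_root d (Node (add_mset (Node X) Y))"
  by (simp add: full_root_Node)

lemma order_reroot: "order (Node (add_mset (Node Y) X)) = order (Node (add_mset (Node X) Y))"
  by simp

lemma opt_reroot: "opt (Node (add_mset (Node Y) X)) \<Longrightarrow> opt (Node (add_mset (Node X) Y))"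
  unfolding opt_def using full_reroot gf_reroot order_reroot by metis

text \<open>\<open>par (val (chain Ks Z))\<close> is a fractional linear function of
  \<open>csum Z\<close>; multiplication by \<open>weight\<close> clears the denominator. Both affine
  forms are carried together because every further vertex of the path mixes them, and
  \<open>0 \<le> s\<close> keeps the leading coefficient \<open>q\<close> positive.\<close>

lemma chain_bilinear:
  "\<exists>p q r s. 0 < q \<and> 0 \<le> s \<and> (\<forall>Z.
     weight (chain Ks Z) = wprod Z * (p + q * csum Z) \<and>
     par (val (chain Ks Z)) * weight (chain Ks Z) = wprod Z * (r + s * csum Z))"
proof (induction Ks)
  case Nil
  have "par (val (Node Z)) * weight (Node Z) = wprod Z * (x + x * csum Z)" for Z
  proof -
    have "par (val (Node Z)) * weight (Node Z) = wprod Z * (par (1 + csum Z) * (1 + csum Z + x))"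
      unfolding weight_Node val_Node by (simp only: mult_ac)
    also have "\<dots> = wprod Z * (x + x * csum Z)"
      using par_mult[of "1 + csum Z"] csum_nonneg[of Z] by (simp add: algebra_simps)
    finally show ?thesis .
  qed
  moreover have "weight (Node Z) = wprod Z * (1 + x + 1 * csum Z)" for Z
    by (simp add: weight_Node algebra_simps del: weight.simps)
  ultimately show ?case using x_pos
    by (intro exI[of _ "1 + x"] exI[of _ 1] exI[of _ x]) (simp del: weight.simps val.simps)
next
  case (Cons K Ks)
  then obtain p q r s where q: "0 < q" "0 \<le> s"
    and w: "\<And>Z. weight (chain Ks Z) = wprod Z * (p + q * csum Z)"
    and v: "\<And>Z. par (val (chain Ks Z)) * weight (chain Ks Z) = wprod Z * (r + s * csum Z)"
    by blast
  define k where "k = csum K"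
  define m where "m = wprod K"
  have k: "0 \<le> k" "0 < m" using csum_nonneg wprod_pos by (auto simp: k_def m_def)
  have 1: "weight (chain (K # Ks) Z) =
    wprod Z * (m * ((1 + k + x) * p + r) + m * ((1 + k + x) * q + s) * csum Z)" for Z
  proof -
    have "weight (chain (K # Ks) Z) =
      m * ((1 + k + x) * weight (chain Ks Z) + par (val (chain Ks Z)) * weight (chain Ks Z))"
      by (simp add: weight_Node k_def m_def algebra_simps del: weight.simps val.simps)
    then show ?thesis unfolding v unfolding w by (simp add: algebra_simps)
  qed
  have 2: "par (val (chain (K # Ks) Z)) * weight (chain (K # Ks) Z) =
    wprod Z * (x * m * ((1 + k) * p + r) + x * m * ((1 + k) * q + s) * csum Z)" for Z
  proof -
    define u where "u = val (chain (K # Ks) Z)"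
    have u: "u = 1 + k + par (val (chain Ks Z))"
      by (simp add: u_def val_Node k_def del: val.simps)
    have u0: "0 \<le> u" by (simp add: u_def del: val.simps chain.simps)
    have "weight (chain (K # Ks) Z) = (u + x) * (m * weight (chain Ks Z))"
      by (simp add: weight_Node u k_def m_def algebra_simps del: weight.simps val.simps)
    then have "par u * weight (chain (K # Ks) Z) = (x * u) * (m * weight (chain Ks Z))"
      using par_mult[OF u0] by (metis mult.assoc)
    also have "\<dots> = x * m * ((1 + k) * weight (chain Ks Z) + par (val (chain Ks Z)) * weight (chain Ks Z))"
      by (simp add: u algebra_simps)
    also have "\<dots> = wprod Z * (x * m * ((1 + k) * p + r) + x * m * ((1 + k) * q + s) * csum Z)"
      unfolding v unfolding w by (simp add: algebra_simps)
    finally show ?thesis unfolding u_def .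
  qed
  have "0 < m * ((1 + k + x) * q + s)" "0 \<le> x * m * ((1 + k) * q + s)"
    using k q x_pos by (auto intro!: mult_pos_pos mult_nonneg_nonneg add_pos_nonneg add_nonneg_nonneg)
  with 1 2 show ?case by blast
qed

text \<open>An exchange between \<open>X\<close> and \<open>Z\<close> only permutes the factors of
  \<open>wprod X * wprod Z\<close> and preserves \<open>csum X + csum Z\<close>. The product
  \<open>csum X * csum Z\<close> enters with the coefficient \<open>q > 0\<close>, which is the
  source of the strict concavity.\<close>

lemma gf_chain_bilinear:
  "\<exists>p q r s. 0 < q \<and> (\<forall>X Z.
     gf (Node (add_mset (chain Ks Z) X)) =
       wprod X * wprod Z * ((1 + csum X) * (p + q * csum Z) + (r + s * csum Z)))"
proof -
  obtain p q r s where q: "0 < q" "0 \<le> s"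
    and w: "\<And>Z. weight (chain Ks Z) = wprod Z * (p + q * csum Z)"
    and v: "\<And>Z. par (val (chain Ks Z)) * weight (chain Ks Z) = wprod Z * (r + s * csum Z)"
    using chain_bilinear by blast
  have "gf (Node (add_mset (chain Ks Z) X)) =
       wprod X * wprod Z * ((1 + csum X) * (p + q * csum Z) + (r + s * csum Z))" for X Z
  proof -
    have "gf (Node (add_mset (chain Ks Z) X)) = wprod X * ((1 + csum X) * weight (chain Ks Z)
       + par (val (chain Ks Z)) * weight (chain Ks Z))"
      by (simp add: gf_Node algebra_simps del: gf.simps weight.simps val.simps)
    then show ?thesis unfolding v unfolding w by (simp add: algebra_simps)
  qed
  with q show ?thesis by blast
qed

lemma order_chain: "order (chain Ks Z) =
    Suc (\<Sum>s\<in>#Z. order s) + (\<Sum>K\<leftarrow>Ks. Suc (\<Sum>s\<in>#K. order s))"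
  by (induction Ks) auto

lemma full_chain: "full d (chain Ks Z) \<longleftrightarrow>
    size Z = d \<and> (\<forall>s\<in>#Z. full d s) \<and> (\<forall>K\<in>set Ks. Suc (size K) = d \<and> (\<forall>s\<in>#K. full d s))"
  by (induction Ks) auto

text \<open>With the branches at both ends of a path exchanged but their total conductance kept, the
  generating function is a strictly concave quadratic function of the conductance at one end. At a
  minimum it is therefore impossible to move conductance in either direction.\<close>

lemma opt_chain_dichotomy:
  assumes "opt (Node (add_mset (chain Ks Z) X))"
  shows "dominates X Z \<or> dominates Z X"
proof (rule ccontr)
  assume "\<not> ?thesis"
  then obtain a b a' b' where a: "a \<in># X" "b \<in># Z" "val a < val b"
    and a': "a' \<in># X" "b' \<in># Z" "val b' < val a'"
    unfolding dominates_def by (meson not_le)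
  obtain p q r s where q: "0 < q" and gf: "\<And>X Z. gf (Node (add_mset (chain Ks Z) X)) =
       wprod X * wprod Z * ((1 + csum X) * (p + q * csum Z) + (r + s * csum Z))"
    using gf_chain_bilinear by metis
  define \<alpha> where "\<alpha> = csum X"
  define \<beta> where "\<beta> = csum Z"
  \<comment> \<open>Moving an amount \<delta> of conductance from \<open>Z\<close> to
    \<open>X\<close> changes the bracket by \<open>\<delta> * L - q * \<delta>\<^sup>2\<close>;
    \<open>L\<close> collects the terms linear in \<delta>.\<close>
  define L where "L = p + q * \<beta> - (1 + \<alpha>) * q - s"
  have swap: "0 \<le> \<delta> * L - q * \<delta>\<^sup>2"
    if ab: "a \<in># X" "b \<in># Z" "\<delta> = par (val b) - par (val a)" for a b \<delta>
  proof -
    obtain X' where X': "X = add_mset a X'" using ab(1) by (metis insert_DiffM)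
    obtain Z' where Z': "Z = add_mset b Z'" using ab(2) by (metis insert_DiffM)
    let ?t = "Node (add_mset (chain Ks (add_mset a Z')) (add_mset b X'))"
    have "full_root d ?t" using assms X' Z' unfolding opt_def full_root_Node
      by (simp add: full_chain)
    moreover have "order ?t = order (Node (add_mset (chain Ks Z) X))"
      unfolding order_Node by (simp add: order_chain X' Z')
    ultimately have "gf (Node (add_mset (chain Ks Z) X)) \<le> gf ?t"
      using assms by (auto simp: opt_def)
    moreover have "csum (add_mset b X') = \<alpha> + \<delta>" "csum (add_mset a Z') = \<beta> - \<delta>"
      using X' Z' ab by (simp_all add: \<alpha>_def \<beta>_def)
    moreover have "wprod (add_mset b X') * wprod (add_mset a Z') = wprod X * wprod Z"
      using X' Z' by (simp add: mult_ac)
    ultimately have "wprod X * wprod Z * ((1 + \<alpha>) * (p + q * \<beta>) + (r + s * \<beta>)) \<le>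
      wprod X * wprod Z * ((1 + (\<alpha> + \<delta>)) * (p + q * (\<beta> - \<delta>)) + (r + s * (\<beta> - \<delta>)))"
      unfolding gf \<alpha>_def[symmetric] \<beta>_def[symmetric] by metis
    then have "(1 + \<alpha>) * (p + q * \<beta>) + (r + s * \<beta>) \<le>
        (1 + (\<alpha> + \<delta>)) * (p + q * (\<beta> - \<delta>)) + (r + s * (\<beta> - \<delta>))"
      using wprod_pos by simp
    then show ?thesis by (simp add: L_def algebra_simps power2_eq_square)
  qed
  define \<delta> where "\<delta> = par (val b) - par (val a)"
  define \<delta>' where "\<delta>' = par (val b') - par (val a')"
  have \<delta>: "0 < \<delta>" "\<delta>' < 0"
    using a a' par_strict_mono[OF val_nonneg] by (auto simp: \<delta>_def \<delta>'_def)
  \<comment> \<open>Cancelling the positive factor \<delta> shows that \<open>L\<close> is at least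
    \<open>q * \<delta>\<close>, cancelling the negative factor \<delta>' that it is at most
    \<open>q * \<delta>'\<close>.\<close>
  have "0 \<le> \<delta> * (L - q * \<delta>)" "0 \<le> (- \<delta>') * (- L + q * \<delta>')"
    using swap[OF a(1,2) \<delta>_def] swap[OF a'(1,2) \<delta>'_def] by (simp_all add: algebra_simps power2_eq_square)
  then have "0 \<le> L - q * \<delta>" "0 \<le> - L + q * \<delta>'" using \<delta> by (simp_all add: zero_le_mult_iff mult_le_0_iff)
  then have "q * \<delta> \<le> q * \<delta>'" by linarith
  with q have "\<delta> \<le> \<delta>'" by simp
  with \<delta> show False by simp
qed

lemma opt_edge_sizes:
  assumes "opt (Node (add_mset (Node Y) X))"
  shows "size X = d" "size Y = d" "\<forall>s\<in>#X. full d s" "\<forall>s\<in>#Y. full d s"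
  using assms by (auto simp: opt_def full_root_Node)

text \<open>If instead \<open>Y\<close> dominates \<open>X\<close>, let \<open>m\<close> be the
  least conductance in \<open>Y\<close>. Both multisets have size \<open>d\<close>, so
  \<open>val (Node X) \<le> 1 + d * par m \<le> val (Node Y)\<close>, and \<open>le\<close> forces
  every branch on either side to have conductance \<open>m\<close>.\<close>

lemma opt_edge_dominates:
  assumes opt: "opt (Node (add_mset (Node Y) X))" and le: "val (Node Y) \<le> val (Node X)"
  shows "dominates X Y"
proof -
  note sz = opt_edge_sizes[OF opt]
  consider "dominates X Y" | "dominates Y X"
    using opt_chain_dichotomy[of "[]"] opt by auto
  then show ?thesis
  proof cases
    case 2
    show ?thesis unfolding dominates_def
    proof (intro ballI)
      fix a b assume ab: "a \<in># X" "b \<in># Y"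
      show "val b \<le> val a"
      proof (rule ccontr)
        assume "\<not> val b \<le> val a"
        then have less: "val a < val b" by simp
        define m where "m = Min (val ` set_mset Y)"
        have m: "m \<in> val ` set_mset Y" "\<And>y. y \<in># Y \<Longrightarrow> m \<le> val y"
          using ab by (auto simp: m_def intro!: Min_in)
        have X: "\<And>z. z \<in># X \<Longrightarrow> val z \<le> m" using 2 m(1) unfolding dominates_def by auto
        have m0: "0 \<le> m" using m(1) by auto
        have "val a < m \<or> m < val b" using less by linarith
        then have "val (Node X) < val (Node Y)"
        proof
          assume "val a < m"
          then have "val (Node X) < 1 + d * par m" using val_Node_less[of X m a] X ab sz by simp
          also have "\<dots> \<le> val (Node Y)" using val_Node_ge[of Y m] m m0 sz by simp
          finally show ?thesis .
        next
          assume "m < val b"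
          then have "1 + d * par m < val (Node Y)" using val_Node_greater[of Y m b] m m0 ab sz by simp
          moreover have "val (Node X) \<le> 1 + d * par m" using val_Node_le[of X m] X sz by simp
          ultimately show ?thesis by linarith
        qed
        with le show False by simp
      qed
    qed
  qed
qed

text \<open>No path \<open>u0, u1, u2\<close> has a weak local minimum of the conductance at \<open>u1\<close>, so the
  conductance never rises along a path that starts at a vertex of maximal conductance.\<close>

lemma opt_no_valley:
  assumes opt: "opt (Node (add_mset (Node Z) (add_mset (Node X) W)))"
    and "val (Node (add_mset (Node Z) W)) \<le> val (Node X)"
  shows "val (Node Z) < val (Node (add_mset (Node X) W))"
proof (rule ccontr)
  assume "\<not> ?thesis"
  then have Z: "val (Node (add_mset (Node X) W)) \<le> val (Node Z)" by simp
  have o1: "opt (Node (add_mset (Node (add_mset (Node X) W)) Z))" using opt_reroot[OF opt] .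
  have "opt (Node (add_mset (Node X) (add_mset (Node Z) W)))"
    using opt by (simp add: add_mset_commute)
  from opt_reroot[OF this] have o2: "opt (Node (add_mset (Node (add_mset (Node Z) W)) X))" .
  have "dominates Z (add_mset (Node X) W)" using opt_edge_dominates[OF o1 Z] .
  then have 1: "\<forall>z\<in>#Z. val (Node X) \<le> val z" by (auto simp: dominates_def)
  have "dominates X (add_mset (Node Z) W)" using opt_edge_dominates[OF o2 assms(2)] .
  then have 2: "\<forall>z\<in>#X. val (Node Z) \<le> val z" by (auto simp: dominates_def)
  have full: "full d (Node Z)" "full d (Node X)" "size Z = d" "size X = d"
    using opt by (auto simp: opt_def full_root_Node)
  \<comment> \<open>Every branch in \<open>Z\<close> is at least as conductive as
    \<open>Node X\<close>, and every branch in \<open>X\<close> at least as conductive as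
    \<open>Node Z\<close>. By \<open>val_less_step\<close> each of the two vertices would then be
    strictly more conductive than the other.\<close>
  have "val (Node X) < 1 + d * par (val (Node X))" using val_less_step full by blast
  also have "\<dots> \<le> val (Node Z)" using val_Node_ge[of Z "val (Node X)"] 1 full by (simp del: val.simps)
  also have "\<dots> < 1 + d * par (val (Node Z))" using val_less_step full by blast
  also have "\<dots> \<le> val (Node X)" using val_Node_ge[of X "val (Node Z)"] 2 full by (simp del: val.simps)
  finally show False by simp
qed

text \<open>By the dichotomy, two such branches contain two smaller ones in the band below.\<close>

lemma opt_band_unique:
  assumes "opt (Node (add_mset (chain Ks Z) X))"
    "cval h < val (Node X)" "val (Node X) < cval (Suc h)"
    "cval h < val (Node Z)" "val (Node Z) < cval (Suc h)"
  shows False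
  using assms
proof (induction h arbitrary: X Ks Z)
  case 0
  \<comment> \<open>The lowest band runs from 0 to 1, and the grounding alone gives every vertex
    conductance at least 1.\<close>
  then show ?case using val_Node_ge1[of X] by (simp del: val.simps)
next
  case (Suc h)
  have sz: "size X = d" "size Z = d"
    using Suc.prems(1) by (auto simp: opt_def full_root_Node full_chain)
  obtain x1 x2 where x: "x1 \<in># X" "cval h < val x1" "x2 \<in># X" "val x2 < cval (Suc h)"
    using val_greater_cval_Suc[OF sz(1) Suc.prems(2)] val_less_cval_Suc[OF sz(1) Suc.prems(3)] by blast
  obtain z1 z2 where z: "z1 \<in># Z" "cval h < val z1" "z2 \<in># Z" "val z2 < cval (Suc h)"
    using val_greater_cval_Suc[OF sz(2) Suc.prems(4)] val_less_cval_Suc[OF sz(2) Suc.prems(5)] by blast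
  \<comment> \<open>Domination compares the child above the lower end on one side with the child
    below the upper end on the other, which confines both to the band:
    \<open>cval h < val z1 \<le> val x2 < cval (Suc h)\<close>, or the same with \<open>x1\<close>
    and \<open>z2\<close>.\<close>
  have "\<exists>a\<in>#X. \<exists>b\<in>#Z. cval h < val a \<and> val a < cval (Suc h) \<and> cval h < val b \<and> val b < cval (Suc h)"
    using opt_chain_dichotomy[OF Suc.prems(1)]
  proof
    assume "dominates X Z"
    then have "val z1 \<le> val x2" using x z by (auto simp: dominates_def)
    with x z show ?thesis by (intro bexI[of _ x2] bexI[of _ z1]) auto
  next
    assume "dominates Z X"
    then have "val x1 \<le> val z2" using x z by (auto simp: dominates_def)
    with x z show ?thesis by (intro bexI[of _ x1] bexI[of _ z2]) auto
  qed
  then obtain a b where ab: "a \<in># X" "b \<in># Z" "cval h < val a" "val a < cval (Suc h)"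
      "cval h < val b" "val b < cval (Suc h)" by blast
  obtain A where A: "a = Node A" using ab cval_nonneg by (metis le_less_trans val_pos_Node)
  obtain B where B: "b = Node B" using ab cval_nonneg by (metis le_less_trans val_pos_Node)
  obtain X' where X': "X = add_mset (Node A) X'" using ab A by (metis insert_DiffM)
  obtain Z' where Z': "Z = add_mset (Node B) Z'" using ab B by (metis insert_DiffM)
  \<comment> \<open>Both ends of the path move outward by one vertex, to \<open>A\<close> and
    \<open>B\<close>; the remaining siblings \<open>X'\<close> and \<open>Z'\<close> become side
    branches of the longer path.\<close>
  have "chain (Ks @ [Z']) B = chain Ks Z" by (induction Ks) (auto simp: Z')
  then have "opt (Node (add_mset (Node A) (add_mset (chain (Ks @ [Z']) B) X')))"
    using Suc.prems(1) by (simp add: X' add_mset_commute)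
  from opt_reroot[OF this]
  have "opt (Node (add_mset (chain (X' # Ks @ [Z']) B) A))"
    by (simp add: add_mset_commute)
  then show ?case using Suc.IH ab unfolding A B by blast
qed

end

section \<open>Minimal trees are greedy\<close>

text \<open>The depths of the padding: a vertex at depth \<open>k\<close> with a missing child contributes \<open>k + 1\<close>.\<close>

primrec edep :: "pt \<Rightarrow> nat set" where
  "edep Emp = {0}"
| "edep (Node X) = Suc ` (\<Union>D\<in>set_mset (image_mset edep X). D)"

lemma edep_ctree: "d > 0 \<Longrightarrow> edep (ctree d h) = {h}"
  by (induction h) auto

primrec one_incomplete :: "nat \<Rightarrow> pt \<Rightarrow> bool" where
  "one_incomplete d Emp = True"
| "one_incomplete d (Node X) = (size {#s \<in># X. \<forall>h. s \<noteq> ctree d h#} \<le> 1 \<and>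
     (\<forall>b\<in>#image_mset (one_incomplete d) X. b))"

text \<open>The label-free form of \<open>greedy_tree\<close>: \<open>Emp \<notin># X\<close> says
  that the root has \<open>d + 1\<close> neighbours, and the padding depths are, up to a shift by 1,
  those of the vertices of degree below \<open>d + 1\<close>.\<close>

definition greedy_code :: "nat \<Rightarrow> pt \<Rightarrow> bool" where
  "greedy_code d t \<longleftrightarrow> full_root d t \<and> (\<exists>X. t = Node X \<and> Emp \<notin># X) \<and>
     (\<exists>h. edep t \<subseteq> {h, Suc h}) \<and> one_incomplete d t"

context network begin

text \<open>The branches \<open>X\<close> lie on the far side of an edge leading up from a vertex with child branches \<open>Y\<close>.\<close>

definition downward :: "pt multiset \<Rightarrow> pt multiset \<Rightarrow> bool" where
  "downward X Y \<longleftrightarrow> opt (Node (add_mset (Node X) Y)) \<and> val (Node Y) \<le> val (Node X)"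

text \<open>\<open>opt_no_valley\<close> for the parent, the vertex and its child: the conductance
  does not rise across the upper edge, so it falls across the lower one. The inequality thus passes
  down the tree edge by edge.\<close>

lemma downward_child:
  assumes "downward X (add_mset (Node Z) W)"
  shows "downward (add_mset (Node X) W) Z"
proof -
  have opt: "opt (Node (add_mset (Node Z) (add_mset (Node X) W)))"
    and le: "val (Node (add_mset (Node Z) W)) \<le> val (Node X)"
    using assms by (simp_all add: downward_def add_mset_commute del: val.simps)
  show ?thesis unfolding downward_def
    using opt_reroot[OF opt] opt_no_valley[OF opt le] by (simp del: val.simps)
qed

text \<open>Otherwise \<open>h = Suc k\<close>, and some child \<open>a\<close> of
  \<open>Node Y\<close> exceeds \<open>cval k\<close>. By domination
  \<open>val a \<le> val b < cval (Suc k)\<close>, so \<open>a\<close> and \<open>b\<close> lie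
  strictly inside the same band at the two ends of a path, against
  \<open>opt_band_unique\<close>.\<close>

lemma opt_siblings:
  assumes opt: "opt (Node (add_mset (Node Y) X))" and le: "val (Node Y) \<le> val (Node X)"
    and b: "b \<in># X" and h: "cval h < val (Node Y)"
  shows "cval h \<le> val b"
proof (rule ccontr)
  assume n: "\<not> ?thesis"
  then obtain k where k: "h = Suc k" by (cases h) auto
  note sz = opt_edge_sizes[OF opt]
  obtain a where a: "a \<in># Y" "cval k < val a"
    using val_greater_cval_Suc[OF sz(2)] h k by blast
  have ab: "val a \<le> val b"
    using opt_edge_dominates[OF opt le] a b by (auto simp: dominates_def)
  obtain A where A: "a = Node A" using a cval_nonneg by (metis le_less_trans val_pos_Node)
  obtain B where B: "b = Node B" using a ab cval_nonneg by (metis le_less_trans less_le_trans val_pos_Node)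
  obtain Y' where Y': "Y = add_mset (Node A) Y'" using a A by (metis insert_DiffM)
  obtain X' where X': "X = add_mset (Node B) X'" using b B by (metis insert_DiffM)
  have "opt (Node (add_mset (Node A) (add_mset (Node X) Y')))"
    using opt_reroot[OF opt] by (simp add: Y' add_mset_commute)
  from opt_reroot[OF this] have "opt (Node (add_mset (chain [Y', X'] B) A))"
    by (simp add: X' add_mset_commute)
  from opt_band_unique[OF this, of k] show False
    using a ab n unfolding A B k by (simp del: val.simps cval.simps)
qed

lemma opt_band_unique_siblings:
  assumes opt: "opt (Node (add_mset a (add_mset b V)))"
    and "cval h < val a" "val a < cval (Suc h)" "cval h < val b" "val b < cval (Suc h)"
  shows False
proof -
  obtain A where A: "a = Node A" using assms cval_nonneg by (metis le_less_trans val_pos_Node)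
  obtain B where B: "b = Node B" using assms cval_nonneg by (metis le_less_trans val_pos_Node)
  have "opt (Node (add_mset (chain [V] B) A))"
    using opt_reroot opt unfolding A B by simp
  from opt_band_unique[OF this, of h] show False using assms unfolding A B by blast
qed

text \<open>The band of a least conductive branch serves for all: a branch above its upper end
  would, by \<open>sib\<close>, lift the least one to that end.\<close>

lemma common_band:
  assumes "X \<noteq> {#}" "\<forall>s\<in>#X. full d s"
    and sib: "\<And>a b h. a \<in># X \<Longrightarrow> b \<in># X \<Longrightarrow> cval h < val a \<Longrightarrow> cval h \<le> val b"
  obtains k where "\<forall>s\<in>#X. cval k \<le> val s \<and> val s \<le> cval (Suc k)"
proof -
  have "Min (val ` set_mset X) \<in> val ` set_mset X" using assms by (intro Min_in) auto
  then obtain a where a: "a \<in># X" "val a = Min (val ` set_mset X)" by auto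
  have min: "\<And>s. s \<in># X \<Longrightarrow> val a \<le> val s" using a(2) by simp
  obtain k where k: "cval k \<le> val a" "val a < cval (Suc k)" using val_band assms a by metis
  have "val s \<le> cval (Suc k)" if "s \<in># X" for s
    using sib[OF that a(1), of "Suc k"] k by linarith
  then show thesis using that min k by (meson order_trans)
qed

lemma downward_siblings:
  assumes dn: "downward X Y" and ab: "a \<in># Y" "b \<in># Y" and h: "cval h < val a"
  shows "cval h \<le> val b"
proof (cases "a = b")
  case False
  obtain Z where Z: "a = Node Z" using h cval_nonneg by (metis le_less_trans val_pos_Node)
  obtain W where W: "Y = add_mset (Node Z) W" using ab Z by (metis insert_DiffM)
  have d1: "downward (add_mset (Node X) W) Z" using downward_child dn W by simp
  then have "opt (Node (add_mset (Node Z) (add_mset (Node X) W)))"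
    using opt_reroot by (simp add: downward_def)
  then show ?thesis using opt_siblings[of Z "add_mset (Node X) W" b h] d1 ab False h Z W
    by (auto simp: downward_def simp del: val.simps)
qed (use h in simp)

text \<open>A conductance \<open>cval h\<close> belongs to two bands, and the depths have to fit
  both; the last conjunct makes this possible, since at an end of a band the tree is complete and
  all its padding has depth \<open>h\<close>.\<close>

definition structured :: "pt \<Rightarrow> bool" where
  "structured t \<longleftrightarrow> (\<forall>h. cval h \<le> val t \<and> val t \<le> cval (Suc h) \<longrightarrow> edep t \<subseteq> {h, Suc h}) \<and>
     one_incomplete d t \<and> (\<forall>h. val t = cval h \<longrightarrow> t = \<C> h)"

lemma structured_Emp: "structured Emp"
  using cval_le_iff[of _ 0] cval_eq_iff[of 0] unfolding structured_def by auto

text \<open>A child at an end of the band is complete, so an incomplete child lies strictly inside,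
  where \<open>uniq\<close> leaves room for one only.\<close>

lemma band_Node:
  assumes band: "\<forall>s\<in>#Y. cval k \<le> val s \<and> val s \<le> cval (Suc k)"
    and str: "\<forall>s\<in>#Y. structured s"
    and uniq: "\<And>a b V. Y = add_mset a (add_mset b V) \<Longrightarrow> cval k < val a \<Longrightarrow> val a < cval (Suc k)
       \<Longrightarrow> cval k < val b \<Longrightarrow> val b < cval (Suc k) \<Longrightarrow> False"
  shows "edep (Node Y) \<subseteq> {Suc k, Suc (Suc k)}" "one_incomplete d (Node Y)"
proof -
  show "edep (Node Y) \<subseteq> {Suc k, Suc (Suc k)}"
    using band str unfolding structured_def by fastforce
  let ?I = "{#s \<in># Y. \<forall>h. s \<noteq> \<C> h#}"
  have I: "cval k < val s \<and> val s < cval (Suc k)" if "s \<in># ?I" for s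
  proof -
    have "s \<in># Y" "s \<noteq> \<C> k" "s \<noteq> \<C> (Suc k)"
      using that by (simp_all del: ctree.simps)
    then have "val s \<noteq> cval k" "val s \<noteq> cval (Suc k)" using str unfolding structured_def by blast+
    with band \<open>s \<in># Y\<close> show ?thesis by (metis order.not_eq_order_implies_strict)
  qed
  have "size ?I \<le> 1"
  proof (rule ccontr)
    assume "\<not> ?thesis"
    then have "2 \<le> size ?I" by simp
    then obtain a J where J: "?I = add_mset a J" "J \<noteq> {#}"
      by (metis (no_types) One_nat_def Suc_1 Suc_le_eq leD lessI multiset_cases size_add_mset size_empty zero_less_numeral)
    then obtain b J' where J': "?I = add_mset a (add_mset b J')" by (cases J) auto
    have "add_mset a (add_mset b J') \<subseteq># Y" using J' by (metis multiset_filter_subset)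
    then obtain V where V: "Y = add_mset a (add_mset b J') + V" by (metis subset_mset.add_diff_inverse)
    show False using uniq[of a b "J' + V"] I V J' by simp
  qed
  then show "one_incomplete d (Node Y)" using str by (simp add: structured_def)
qed

text \<open>Children within the band from \<open>cval k\<close> to \<open>cval (Suc k)\<close> put
  the vertex into the next band. It reaches an end of that band only if all \<open>d\<close>
  children are at the corresponding end of theirs; they are then copies of one complete
  tree.\<close>

lemma downward_structured: "downward X Y \<Longrightarrow> t = Node Y \<Longrightarrow> structured t"
proof (induction t arbitrary: X Y)
  case (Node Y')
  then have Y': "Y' = Y" and dn: "downward X Y" by auto
  have str: "\<forall>s\<in>#Y. structured s"
  proof
    fix s assume s: "s \<in># Y"
    show "structured s"
    proof (cases s)
      case (Node Z)
      obtain W where "Y = add_mset (Node Z) W" using s Node by (metis insert_DiffM)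
      then show ?thesis using Node.IH[of s] Y' dn downward_child s Node by blast
    qed (simp add: structured_Emp)
  qed
  have opt: "opt (Node (add_mset (Node X) Y))" using dn by (simp add: downward_def)
  note sz = opt_edge_sizes[OF opt_reroot[OF opt]]
  have "Y \<noteq> {#}" using sz d_pos by auto
  then obtain k where k: "\<forall>s\<in>#Y. cval k \<le> val s \<and> val s \<le> cval (Suc k)"
    using common_band[of Y] downward_siblings[OF dn] sz by metis
  have uniq: "False" if "Y = add_mset a (add_mset b V)" "cval k < val a" "val a < cval (Suc k)"
       "cval k < val b" "val b < cval (Suc k)" for a b V
    using opt_band_unique_siblings[of a b "add_mset (Node X) V" k] opt that
    by (simp add: add_mset_commute)
  have 1: "edep (Node Y) \<subseteq> {Suc k, Suc (Suc k)}" "one_incomplete d (Node Y)"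
    by (rule band_Node[OF k str], erule (4) uniq)+
  have lo: "cval (Suc k) \<le> val (Node Y)" and hi: "val (Node Y) \<le> cval (Suc (Suc k))"
    using val_Node_ge[of Y "cval k"] val_Node_le[of Y "cval (Suc k)"] k sz cval_nonneg by auto
  have low: "Node Y = \<C> (Suc k)" if "val (Node Y) = cval (Suc k)"
  proof -
    have "val s = cval k" if "s \<in># Y" for s
    proof (rule ccontr)
      assume "val s \<noteq> cval k"
      then have "cval k < val s" using k that by force
      then have "cval (Suc k) < val (Node Y)"
        using val_Node_greater[of Y "cval k" s] k that sz cval_nonneg by simp
      with \<open>val (Node Y) = cval (Suc k)\<close> show False by simp
    qed
    then have "\<forall>s\<in>#Y. s = \<C> k" using str by (simp add: structured_def)
    then have "Y = replicate_mset d (\<C> k)" using sz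
      by (metis mset_eq_replicate)
    then show ?thesis by simp
  qed
  have high: "Node Y = \<C> (Suc (Suc k))" if "val (Node Y) = cval (Suc (Suc k))"
  proof -
    have "val s = cval (Suc k)" if "s \<in># Y" for s
    proof (rule ccontr)
      assume "val s \<noteq> cval (Suc k)"
      then have "val s < cval (Suc k)" using k that by force
      then have "val (Node Y) < cval (Suc (Suc k))"
        using val_Node_less[of Y "cval (Suc k)" s] k that sz by simp
      with \<open>val (Node Y) = cval (Suc (Suc k))\<close> show False by simp
    qed
    then have "\<forall>s\<in>#Y. s = \<C> (Suc k)" using str unfolding structured_def by blast
    then have "Y = replicate_mset d (\<C> (Suc k))" using sz
      by (metis mset_eq_replicate)
    then show ?thesis by simp
  qed
  have "edep (Node Y) \<subseteq> {h, Suc h}" if h: "cval h \<le> val (Node Y)" "val (Node Y) \<le> cval (Suc h)" for h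
  proof -
    have "cval h \<le> cval (Suc (Suc k))" "cval (Suc k) \<le> cval (Suc h)" using h lo hi by linarith+
    \<comment> \<open>A neighbouring band meets that of the vertex in a common end only, and there
      the tree is complete with a single padding depth.\<close>
    then consider "h = Suc k" | "h = k" | "h = Suc (Suc k)" unfolding cval_le_iff by linarith
    then show ?thesis
    proof cases
      case 2
      then have "val (Node Y) = cval (Suc k)" using h lo by auto
      then show ?thesis using low edep_ctree[OF d_pos, of "Suc k"] 2 by (metis insertCI singletonD subsetI)
    next
      case 3
      then have "val (Node Y) = cval (Suc (Suc k))" using h hi by auto
      then show ?thesis using high edep_ctree[OF d_pos, of "Suc (Suc k)"] 3 by (metis insertCI singletonD subsetI)
    qed (use 1 in simp)
  qed
  moreover have "Node Y = \<C> h" if h: "val (Node Y) = cval h" for h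
  proof -
    have "h = Suc k \<or> h = Suc (Suc k)" using lo hi unfolding h cval_le_iff by linarith
    then show ?thesis using low high h by metis
  qed
  ultimately show ?case using 1 unfolding structured_def Y' by blast
qed simp

lemma opt_greedy_code:
  assumes opt: "opt (Node X)"
    and root: "\<And>Z W. X = add_mset (Node Z) W \<Longrightarrow> val (Node Z) \<le> val (Node W)"
    and large: "d + 2 \<le> order (Node X)"
  shows "greedy_code d (Node X)"
proof -
  have full: "full_root d (Node X)" using opt by (simp add: opt_def)
  then have sz: "size X = Suc d" "\<forall>s\<in>#X. full d s" by (auto simp: full_root_Node)
  have str: "\<forall>s\<in>#X. structured s"
  proof
    fix s assume s: "s \<in># X"
    show "structured s"
    proof (cases s)
      case (Node Z)
      obtain W where W: "X = add_mset (Node Z) W" using s Node by (metis insert_DiffM)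
      have "downward W Z" using opt_reroot opt root[OF W] W unfolding downward_def by simp
      then show ?thesis using downward_structured Node by blast
    qed (simp add: structured_Emp)
  qed
  have sib: "cval h \<le> val b" if ab: "a \<in># X" "b \<in># X" and h: "cval h < val a" for a b h
  proof (cases "a = b")
    case False
    obtain Z where Z: "a = Node Z" using h cval_nonneg by (metis le_less_trans val_pos_Node)
    obtain W where W: "X = add_mset (Node Z) W" using ab Z by (metis insert_DiffM)
    then show ?thesis using opt_siblings[of Z W b h] opt root[OF W] ab False h Z by auto
  qed (use h in simp)
  have "X \<noteq> {#}" using sz by auto
  then obtain k where k: "\<forall>s\<in>#X. cval k \<le> val s \<and> val s \<le> cval (Suc k)"
    using common_band[of X] sib sz by metis
  have uniq: "False" if "X = add_mset a (add_mset b V)" "cval k < val a" "val a < cval (Suc k)"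
       "cval k < val b" "val b < cval (Suc k)" for a b V
    using opt_band_unique_siblings[of a b V k] opt that by simp
  have 1: "edep (Node X) \<subseteq> {Suc k, Suc (Suc k)}" "one_incomplete d (Node X)"
    by (rule band_Node[OF k str], erule (4) uniq)+
  \<comment> \<open>An empty branch at the root forces all branches into the band from 0 to 1; each
    then has at most one vertex, and the whole tree at most \<open>d + 1\<close>.\<close>
  have "Emp \<notin># X"
  proof
    assume E: "Emp \<in># X"
    then have "cval k \<le> 0" using k by force
    then have k0: "k = 0" using cval_le_iff[of k 0] by simp
    have "order s \<le> 1" if "s \<in># X" for s
    proof (cases s)
      case (Node Z)
      then have "val s = cval (Suc 0)" using k k0 that val_Node_ge1[of Z] by force
      then have "s = \<C> (Suc 0)" using str that unfolding structured_def by blast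
      then show ?thesis by simp
    qed simp
    then have "(\<Sum>s\<in>#X. order s) < Suc d"
      using sum_mset_less_size[of X order 1 Emp] E sz by simp
    with large show False by (simp add: order_Node)
  qed
  then show ?thesis unfolding greedy_code_def using full 1 by blast
qed

text \<open>The hypothesis compares the total conductances at the two ends of an edge, the
  conclusion the two sides without that edge. With \<open>a\<close> and \<open>b\<close> for the
  sides, the hypothesis is \<open>b - par b \<le> a - par a\<close>, and v - par(v) = v^2/(v + x) is
  strictly increasing.\<close>

lemma val_reroot_le:
  assumes "val (Node (add_mset (Node W) Z)) \<le> val (Node (add_mset (Node Z) W))"
  shows "val (Node Z) \<le> val (Node W)"
proof (rule ccontr)
  define a where "a = val (Node W)"
  define b where "b = val (Node Z)"
  assume "\<not> ?thesis"
  then have less: "a < b" by (simp add: a_def b_def)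
  have a: "1 \<le> a" unfolding a_def by (rule val_Node_ge1)
  have "b + par a \<le> a + par b" using assms by (simp add: a_def b_def val_Node del: val.simps)
  moreover have "a - par a = a * a / (a + x)" "b - par b = b * b / (b + x)"
    using a less x_pos by (simp_all add: par_def field_simps)
  moreover have "a * a / (a + x) < b * b / (b + x)"
  proof -
    have "0 < (b - a) * (a * b + x * (a + b))" using a less x_pos by (auto intro!: mult_pos_pos add_pos_pos)
    then have "a * a * (b + x) < b * b * (a + x)" by (simp add: algebra_simps)
    then show ?thesis using a less x_pos by (simp add: divide_simps)
  qed
  ultimately show False by linarith
qed

end

section \<open>Uniqueness of the greedy tree\<close>

lemma order_le_sum: "s \<in># X \<Longrightarrow> order s \<le> (\<Sum>s\<in>#X. order s)"
  by (metis image_mset_add_mset insert_DiffM le_add1 sum_mset.add_mset)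

lemma finite_full_order: "finite {t. full d t \<and> order t \<le> n}"
proof (induction n)
  case 0
  have "order t = 0 \<longleftrightarrow> t = Emp" for t by (cases t) auto
  then show ?case by (auto intro: finite_subset[of _ "{Emp}"])
next
  case (Suc n)
  let ?F = "{t. full d t \<and> order t \<le> n}"
  have "{t. full d t \<and> order t \<le> Suc n} \<subseteq>
      insert Emp (Node ` {X. set_mset X \<subseteq> ?F \<and> size X = d})"
  proof
    fix t assume t: "t \<in> {t. full d t \<and> order t \<le> Suc n}"
    show "t \<in> insert Emp (Node ` {X. set_mset X \<subseteq> ?F \<and> size X = d})"
    proof (cases t)
      case (Node X)
      have "set_mset X \<subseteq> ?F" using order_le_sum[of _ X] t Node by fastforce
      then show ?thesis using t Node by auto
    qed simp
  qed
  moreover have "finite {X. set_mset X \<subseteq> ?F \<and> size X = d}"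
    using finite_multisets_of_size[OF Suc, of d] by (simp add: multisets_of_size_def)
  ultimately show ?case by (meson finite.insertI finite_imageI finite_subset)
qed

lemma finite_full_root_order: "finite {t. full_root d t \<and> order t = n}"
proof -
  let ?F = "{t. full d t \<and> order t \<le> n}"
  have "{t. full_root d t \<and> order t = n} \<subseteq> Node ` {X. set_mset X \<subseteq> ?F \<and> size X = Suc d}"
  proof
    fix t assume t: "t \<in> {t. full_root d t \<and> order t = n}"
    then obtain X where X: "t = Node X" "size X = Suc d" "\<forall>s\<in>#X. full d s"
      by (auto simp: full_root_def)
    have "set_mset X \<subseteq> ?F" using order_le_sum[of _ X] t X by fastforce
    then show "t \<in> Node ` {X. set_mset X \<subseteq> ?F \<and> size X = Suc d}" using X by auto
  qed
  moreover have "finite {X. set_mset X \<subseteq> ?F \<and> size X = Suc d}"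
    using finite_multisets_of_size[OF finite_full_order] by (simp add: multisets_of_size_def)
  ultimately show ?thesis by (meson finite_imageI finite_subset)
qed

section \<open>Codes whose padding lies at two consecutive depths\<close>

definition in_band :: "nat \<Rightarrow> nat \<Rightarrow> pt \<Rightarrow> bool" where
  "in_band d h t \<longleftrightarrow> full d t \<and> edep t \<subseteq> {h, Suc h} \<and> one_incomplete d t"

lemma edep_nonempty: "d > 0 \<Longrightarrow> full d t \<Longrightarrow> edep t \<noteq> {}"
proof (induction t)
  case (Node X)
  then have "X \<noteq> {#}" by auto
  then obtain s where "s \<in># X" by blast
  with Node show ?case by auto
qed simp

lemma edep_eq_0: "d > 0 \<Longrightarrow> full d s \<Longrightarrow> edep s \<subseteq> {0} \<Longrightarrow> s = Emp"
  using edep_nonempty[of d s] by (cases s) auto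

lemma full_ctree: "full d (ctree d h)"
  by (induction h) auto

lemma one_incomplete_ctree: "one_incomplete d (ctree d h)"
proof (induction h)
  case (Suc h)
  have *: "{#s \<in># replicate_mset d (ctree d h). \<forall>h. s \<noteq> ctree d h#} = {#}"
    unfolding filter_mset_eq_mempty_iff by auto
  show ?case using Suc by (simp add: *)
qed simp

lemma in_band_ctree: "d > 0 \<Longrightarrow> in_band d h (ctree d h)" "d > 0 \<Longrightarrow> in_band d h (ctree d (Suc h))"
  using full_ctree[of d "Suc h"] full_ctree[of d h] one_incomplete_ctree[of d "Suc h"] one_incomplete_ctree[of d h]
  by (auto simp: in_band_def edep_ctree simp del: ctree.simps)

lemma order_ctree_Suc: "order (ctree d (Suc h)) = Suc (d * order (ctree d h))"
  by simp

lemma order_ctree_less: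
  assumes "d > 0"
  shows "order (ctree d h) < order (ctree d (Suc h))"
proof (induction h)
  case (Suc h)
  then have "d * order (ctree d h) < d * order (ctree d (Suc h))" using assms by (simp only: mult_less_cancel1)
  then show ?case unfolding order_ctree_Suc[of d "Suc h"] unfolding order_ctree_Suc[of d h] by simp
qed simp

lemma order_ctree_mono: "d > 0 \<Longrightarrow> h \<le> k \<Longrightarrow> order (ctree d h) \<le> order (ctree d k)"
  using lift_Suc_mono_le[of "\<lambda>h. order (ctree d h)"] order_ctree_less less_imp_le by blast

lemma order_ctree_strict_mono: "d > 0 \<Longrightarrow> h < k \<Longrightarrow> order (ctree d h) < order (ctree d k)"
  using lift_Suc_mono_less[of "\<lambda>h. order (ctree d h)"] order_ctree_less by blast

lemma edep_children:
  assumes "edep (Node X) \<subseteq> {Suc h, Suc (Suc h)}" "s \<in># X"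
  shows "edep s \<subseteq> {h, Suc h}"
  using assms by auto

text \<open>Padding depths take over the role of the conductances, so that uniqueness does not
  involve \<open>x\<close>. With padding at depths \<open>h\<close> and \<open>Suc h\<close> only,
  all levels of \<open>ctree d h\<close> are filled and none beyond those of
  \<open>ctree d (Suc h)\<close> is reached.\<close>

lemma order_band:
  assumes "d > 0" "full d t" "edep t \<subseteq> {h, Suc h}"
  shows "order (ctree d h) \<le> order t" "order t \<le> order (ctree d (Suc h))"
proof -
  have "order (ctree d h) \<le> order t \<and> order t \<le> order (ctree d (Suc h))"
    using assms(2,3)
  proof (induction h arbitrary: t)
    case 0
    show ?case
    proof (cases t)
      case (Node X)
      have "s = Emp" if "s \<in># X" for s
      proof -
        have "edep s \<subseteq> {0}" "full d s" using 0 that Node by auto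
        then show ?thesis using edep_eq_0 assms(1) by blast
      qed
      then have "X = replicate_mset (size X) Emp" by (metis mset_eq_replicate)
      then have "t = ctree d (Suc 0)" using 0 Node by simp
      then show ?thesis by simp
    qed simp
  next
    case (Suc h)
    obtain X where X: "t = Node X" using Suc.prems by (cases t) auto
    have sz: "size X = d" using Suc.prems X by simp
    have s: "order (ctree d h) \<le> order s \<and> order s \<le> order (ctree d (Suc h))" if "s \<in># X" for s
      using Suc.IH[of s] edep_children[of X h s] Suc.prems that X by (auto simp del: ctree.simps)
    have "(\<Sum>s\<in>#X. order s) \<le> d * order (ctree d (Suc h))" "d * order (ctree d h) \<le> (\<Sum>s\<in>#X. order s)"
      using sum_mset_le_size[of X order "order (ctree d (Suc h))"]
        sum_mset_ge_size[of X "order (ctree d h)" order] s sz by (simp_all del: ctree.simps)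
    then show ?case using order_ctree_Suc[of d h] order_ctree_Suc[of d "Suc h"] X by (simp del: ctree.simps)
  qed
  then show "order (ctree d h) \<le> order t" "order t \<le> order (ctree d (Suc h))" by auto
qed

text \<open>\<open>y\<close> is the incomplete child if there is one and an arbitrary child
  otherwise. The other children are complete, and their only padding depth must be \<open>h\<close>
  or \<open>Suc h\<close>.\<close>

lemma band_children_decomp:
  assumes d: "d > 0" and sz: "size X = Suc k" and edep: "\<forall>s\<in>#X. edep s \<subseteq> {h, Suc h}"
    and inc: "size {#s \<in># X. \<forall>h. s \<noteq> ctree d h#} \<le> 1"
  obtains y i j where "X = add_mset y (replicate_mset i (ctree d h) + replicate_mset j (ctree d (Suc h)))"
    "i + j = k"
proof -
  let ?P = "\<lambda>s. \<forall>h. s \<noteq> ctree d h"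
  obtain y Y where Y: "X = add_mset y Y" "filter_mset ?P Y = {#}"
  proof (cases "filter_mset ?P X = {#}")
    case True
    obtain y Y where "X = add_mset y Y" using sz by (cases X) auto
    with True that[of y Y] show ?thesis by (auto split: if_splits)
  next
    case False
    then obtain y where y: "y \<in># filter_mset ?P X" by blast
    then have "?P y" "y \<in># X" by simp_all
    then obtain Y where Y: "X = add_mset y Y" by (metis insert_DiffM)
    then have "filter_mset ?P X = add_mset y (filter_mset ?P Y)" using \<open>?P y\<close> by simp
    then have "filter_mset ?P Y = {#}" using inc by simp
    with Y that show ?thesis by blast
  qed
  have "\<exists>i j. Y = replicate_mset i (ctree d h) + replicate_mset j (ctree d (Suc h)) \<and> i + j = size Y"
    if "\<forall>s\<in>#Y. s = ctree d h \<or> s = ctree d (Suc h)" for Y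
    using that
  proof (induction Y)
    case (add s Y)
    then obtain i j where *: "Y = replicate_mset i (ctree d h) + replicate_mset j (ctree d (Suc h))" "i + j = size Y"
      by auto
    from add.prems have "s = ctree d h \<or> s = ctree d (Suc h)" by simp
    then show ?case
    proof
      assume "s = ctree d h"
      then show ?thesis using * by (intro exI[of _ "Suc i"] exI[of _ j]) (simp del: ctree.simps)
    next
      assume "s = ctree d (Suc h)"
      then show ?thesis using * by (intro exI[of _ i] exI[of _ "Suc j"]) (simp del: ctree.simps)
    qed
  qed simp
  moreover have "\<forall>s\<in>#Y. s = ctree d h \<or> s = ctree d (Suc h)"
  proof
    fix s assume s: "s \<in># Y"
    then obtain m where m: "s = ctree d m" using Y(2) by (auto simp: filter_mset_eq_mempty_iff)
    have "edep s \<subseteq> {h, Suc h}" using edep s Y by simp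
    then have "m = h \<or> m = Suc h" using edep_ctree[OF d, of m] m by simp
    with m show "s = ctree d h \<or> s = ctree d (Suc h)" by blast
  qed
  ultimately obtain i j where "Y = replicate_mset i (ctree d h) + replicate_mset j (ctree d (Suc h))" "i + j = size Y"
    by blast
  moreover have "size Y = k" using Y(1) sz by simp
  ultimately show thesis using that[of y i j] Y(1) by blast
qed

text \<open>If the numbers of large complete children differ by \<open>m\<close>, then the orders of
  \<open>y\<close> and \<open>y'\<close> differ by \<open>m * \<Delta>\<close>, while both lie in an
  interval of length \<Delta>. So \<open>m\<close> is 0, and induction gives \<open>y = y'\<close>;
  or \<open>m\<close> is 1, the two orders are extreme, \<open>y\<close> and \<open>y'\<close> are
  themselves complete, and the two multisets agree after all.\<close>

lemma band_children_unique:
  assumes d: "d > 0"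
    and IH: "\<And>t t'. in_band d h t \<Longrightarrow> in_band d h t' \<Longrightarrow> order t = order t' \<Longrightarrow> t = t'"
    and X: "size X = Suc k" "\<forall>s\<in>#X. in_band d h s" "size {#s \<in># X. \<forall>h. s \<noteq> ctree d h#} \<le> 1"
    and X': "size X' = Suc k" "\<forall>s\<in>#X'. in_band d h s" "size {#s \<in># X'. \<forall>h. s \<noteq> ctree d h#} \<le> 1"
    and eq: "(\<Sum>s\<in>#X. order s) = (\<Sum>s\<in>#X'. order s)"
  shows "X = X'"
proof -
  let ?C = "ctree d h" let ?D = "ctree d (Suc h)"
  obtain y i j where y: "X = add_mset y (replicate_mset i ?C + replicate_mset j ?D)" "i + j = k"
    using band_children_decomp[OF d X(1) _ X(3), of h] X(2) by (auto simp: in_band_def simp del: ctree.simps)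
  obtain y' i' j' where y': "X' = add_mset y' (replicate_mset i' ?C + replicate_mset j' ?D)" "i' + j' = k"
    using band_children_decomp[OF d X'(1) _ X'(3), of h] X'(2) by (auto simp: in_band_def simp del: ctree.simps)
  define s where "s = order ?C"
  define \<Delta> where "\<Delta> = order ?D - s"
  have D: "order ?D = s + \<Delta>" "\<Delta> > 0" using order_ctree_less[OF d, of h] by (auto simp: \<Delta>_def s_def simp del: ctree.simps)
  have wlog: "add_mset y (replicate_mset i ?C + replicate_mset j ?D) =
      add_mset y' (replicate_mset i' ?C + replicate_mset j' ?D)"
    if b: "in_band d h y" "in_band d h y'"
      and e: "order y + i * order ?C + j * order ?D = order y' + i' * order ?C + j' * order ?D"
      and ij: "i + j = i' + j'" and jj: "j \<le> j'" for y i j y' i' j'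
  proof -
    have yb: "s \<le> order y" "order y \<le> s + \<Delta>" "s \<le> order y'" "order y' \<le> s + \<Delta>"
      using order_band[OF d, of y h] order_band[OF d, of y' h] b D(1)
      unfolding in_band_def s_def by auto
    obtain m where m: "j' = j + m" using jj le_Suc_ex by blast
    then have i: "i = i' + m" using ij by simp
    have "order y + i * s + j * (s + \<Delta>) = order y' + i' * s + j' * (s + \<Delta>)"
      using e unfolding D(1) s_def[symmetric] .
    then have r: "order y = order y' + m * \<Delta>" unfolding m i by (simp add: algebra_simps)
    have "m * \<Delta> \<le> 1 * \<Delta>" using r yb by linarith
    then have "m \<le> 1" using D(2) by (simp only: mult_le_cancel2)
    then consider "m = 0" | "m = 1" by linarith
    then show ?thesis
    proof cases
      case 1
      then show ?thesis using IH[OF b] r m i by simp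
    next
      case 2
      then have "order y' = s" "order y = s + \<Delta>" using r yb by simp_all
      then have "y' = ?C" "y = ?D"
        using IH[OF b(2) in_band_ctree(1)[OF d]] IH[OF b(1) in_band_ctree(2)[OF d]] D(1) s_def by metis+
      then show ?thesis using m i 2 by (simp add: ac_simps del: ctree.simps)
    qed
  qed
  have b: "in_band d h y" "in_band d h y'" using X(2) X'(2) y y' by auto
  have e: "order y + i * order ?C + j * order ?D = order y' + i' * order ?C + j' * order ?D"
    using eq unfolding y y' by (simp del: ctree.simps)
  show ?thesis using wlog[OF b e] wlog[OF b(2,1) e[symmetric]] y y' by (metis nle_le)
qed

lemma band_unique:
  assumes d: "d > 0"
  shows "in_band d h t \<Longrightarrow> in_band d h t' \<Longrightarrow> order t = order t' \<Longrightarrow> t = t'"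
proof (induction h arbitrary: t t')
  case 0
  have "t = Emp \<or> t = ctree d (Suc 0)" if t: "in_band d 0 t" for t
  proof (cases t)
    case (Node X)
    have "s = Emp" if "s \<in># X" for s
    proof -
      have "edep s \<subseteq> {0}" "full d s" using t that Node by (auto simp: in_band_def)
      then show ?thesis using edep_eq_0 d by blast
    qed
    then have "X = replicate_mset (size X) Emp" by (metis mset_eq_replicate)
    then show ?thesis using t Node by (simp add: in_band_def)
  qed simp
  from this[OF 0(1)] this[OF 0(2)] 0(3) show ?case by auto
next
  case (Suc h)
  obtain X where X: "t = Node X" using Suc.prems by (cases t) (auto simp: in_band_def)
  obtain X' where X': "t' = Node X'" using Suc.prems by (cases t') (auto simp: in_band_def)
  obtain k where k: "d = Suc k" using d by (cases d) auto
  have "X = X'"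
  proof (rule band_children_unique[OF d Suc.IH])
    show "size X = Suc k" "size X' = Suc k" using Suc.prems X X' k by (auto simp: in_band_def)
    show "\<forall>s\<in>#X. in_band d h s" using Suc.prems(1) X edep_children[of X h] by (auto simp: in_band_def simp del: edep.simps)
    show "\<forall>s\<in>#X'. in_band d h s" using Suc.prems(2) X' edep_children[of X' h] by (auto simp: in_band_def simp del: edep.simps)
    show "size {#s \<in># X. \<forall>h. s \<noteq> ctree d h#} \<le> 1" "size {#s \<in># X'. \<forall>h. s \<noteq> ctree d h#} \<le> 1"
      using Suc.prems X X' by (auto simp: in_band_def)
    show "(\<Sum>s\<in>#X. order s) = (\<Sum>s\<in>#X'. order s)" using Suc.prems(3) X X' by simp
  qed
  then show ?case using X X' by simp
qed

lemma greedy_code_children: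
  assumes d: "d > 0" and g: "greedy_code d t"
  obtains X h where "t = Node X" "size X = Suc d" "\<forall>s\<in>#X. in_band d h s"
    "size {#s \<in># X. \<forall>h. s \<noteq> ctree d h#} \<le> 1"
proof -
  obtain X where X: "t = Node X" "size X = Suc d" "\<forall>s\<in>#X. full d s" "Emp \<notin># X"
    using g by (auto simp: greedy_code_def full_root_def)
  obtain H where H: "edep (Node X) \<subseteq> {H, Suc H}" using g X by (auto simp: greedy_code_def)
  obtain s where s: "s \<in># X" using X(2) by (metis size_eq_Suc_imp_elem)
  then obtain Y where Y: "s = Node Y" using X by (cases s) auto
  obtain k where k: "k \<in> edep s" using edep_nonempty[OF d] X s by blast
  \<comment> \<open>A nonempty branch has its padding at depth at least 1, which is depth at least 2
    in the whole tree. So \<open>H\<close> is a successor, and the branches inherit the depths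
    \<open>h\<close> and \<open>Suc h\<close>.\<close>
  have "k > 0" using k Y by auto
  moreover have "Suc k \<in> {H, Suc H}" using k s H by auto
  ultimately obtain h where h: "H = Suc h" by (cases H) auto
  have "one_incomplete d (Node X)" using g X by (simp add: greedy_code_def)
  moreover from this have "\<forall>s\<in>#X. in_band d h s" using X H h edep_children[of X h] by (auto simp: in_band_def simp del: edep.simps)
  ultimately show ?thesis using that X by simp
qed

text \<open>For \<open>h < h'\<close> the order of \<open>ctree d (Suc h)\<close> bounds the
  branches of one tree from above and those of the other from below. Equal totals then force
  equality throughout, and both trees consist of \<open>d + 1\<close> copies of
  \<open>ctree d (Suc h)\<close>.\<close>

lemma greedy_code_unique:
  assumes d: "d > 0" and g: "greedy_code d t" "greedy_code d t'" and eq: "order t = order t'"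
  shows "t = t'"
proof -
  have less: False if t: "size X = Suc d" "\<forall>s\<in>#X. in_band d h s" and t': "size X' = Suc d" "\<forall>s\<in>#X'. in_band d h' s"
    and e: "(\<Sum>s\<in>#X. order s) = (\<Sum>s\<in>#X'. order s)" and h: "h < h'" and ne: "X \<noteq> X'" for X X' h h'
  proof -
    let ?c = "order (ctree d (Suc h))" let ?D = "ctree d (Suc h)"
    have hh: "?c \<le> order (ctree d h')" using order_ctree_mono[OF d] h by (simp del: ctree.simps)
    have 1: "order s \<le> ?c" if "s \<in># X" for s using order_band(2)[OF d, of s h] t that by (auto simp: in_band_def)
    have 2: "?c \<le> order s" if "s \<in># X'" for s using order_band(1)[OF d, of s h'] t' that hh by (force simp: in_band_def simp del: ctree.simps)
    have u: "(\<Sum>s\<in>#X. order s) \<le> Suc d * ?c" "Suc d * ?c \<le> (\<Sum>s\<in>#X'. order s)"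
      using sum_mset_le_size[of X order ?c] 1 sum_mset_ge_size[of X' ?c order] 2 t t' by (simp_all del: ctree.simps mult_Suc)
    have "order s = ?c" if "s \<in># X" for s
      using sum_mset_less_size[of X order ?c s] 1 that t u e by (force simp del: ctree.simps mult_Suc)
    then have "\<forall>s\<in>#X. s = ?D" using band_unique[OF d] t in_band_ctree(2)[OF d] by blast
    then have X: "X = replicate_mset (Suc d) ?D" using t(1) by (metis mset_eq_replicate)
    have 3: "order s = ?c" if "s \<in># X'" for s
      using sum_mset_greater_size[of X' ?c order s] 2 that t' u e by (force simp del: ctree.simps mult_Suc)
    obtain s where s: "s \<in># X'" using t'(1) by (metis size_eq_Suc_imp_elem)
    have "order (ctree d h') \<le> ?c" using 3[OF s] order_band(1)[OF d, of s h'] t' s by (auto simp: in_band_def simp del: ctree.simps)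
    then have "h' = Suc h" using order_ctree_strict_mono[OF d, of "Suc h" h'] h by (metis Suc_lessI not_less)
    then have "\<forall>s\<in>#X'. s = ?D" using band_unique[OF d] t' in_band_ctree(1)[OF d] 3 by blast
    then have "X' = replicate_mset (Suc d) ?D" using t'(1) by (metis mset_eq_replicate)
    with X ne show False by simp
  qed
  obtain X h where X: "t = Node X" "size X = Suc d" "\<forall>s\<in>#X. in_band d h s" "size {#s \<in># X. \<forall>h. s \<noteq> ctree d h#} \<le> 1"
    using greedy_code_children[OF d g(1)] .
  obtain X' h' where X': "t' = Node X'" "size X' = Suc d" "\<forall>s\<in>#X'. in_band d h' s" "size {#s \<in># X'. \<forall>h. s \<noteq> ctree d h#} \<le> 1"
    using greedy_code_children[OF d g(2)] .
  have e: "(\<Sum>s\<in>#X. order s) = (\<Sum>s\<in>#X'. order s)" using eq X X' by simp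
  have "X = X'"
  proof (rule ccontr)
    assume ne: "X \<noteq> X'"
    consider "h < h'" | "h' < h" | "h = h'" by linarith
    then show False
    proof cases
      case 1 then show False using less[OF X(2,3) X'(2,3) e] ne by simp
    next
      case 2 then show False using less[OF X'(2,3) X(2,3) e[symmetric]] ne by simp
    next
      case 3
      have "X = X'" by (rule band_children_unique[OF d band_unique[OF d]]) (use X X' 3 e in auto)
      with ne show False ..
    qed
  qed
  then show ?thesis using X X' by simp
qed

section \<open>Labelled rooted trees\<close>

text \<open>A recursive presentation of rooted tree graphs, so that paths, degrees and matchings
  become accessible to structural induction. The order of the kids is arbitrary and is forgotten by
  \<open>code\<close>.\<close>

datatype 'a lt = LNode (lab: 'a) (kids: "'a lt list")

primrec labels :: "'a lt \<Rightarrow> 'a set" where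
  "labels (LNode a ts) = insert a (\<Union>(set (map labels ts)))"

primrec ledges :: "'a lt \<Rightarrow> 'a set set" where
  "ledges (LNode a ts) = (\<lambda>s. {a, lab s}) ` set ts \<union> \<Union>(set (map ledges ts))"

primrec preorder :: "'a lt \<Rightarrow> 'a list" where
  "preorder (LNode a ts) = a # concat (map preorder ts)"

definition distinct_labels :: "'a lt \<Rightarrow> bool" where
  "distinct_labels t \<longleftrightarrow> distinct (preorder t)"

definition graph_of :: "'a lt \<Rightarrow> 'a ugraph" where
  "graph_of t = (labels t, ledges t)"

text \<open>The number is the depth of the inner root; \<open>graph_dist_subtree\<close> identifies
  it with the distance from the outer root.\<close>

inductive subtree :: "'a lt \<Rightarrow> nat \<Rightarrow> 'a lt \<Rightarrow> bool" where
  subtree_self: "subtree t 0 t"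
| subtree_kid: "s \<in> set ts \<Longrightarrow> subtree s k u \<Longrightarrow> subtree (LNode a ts) (Suc k) u"

section \<open>Vertices and edges of labelled trees\<close>

lemma gverts_graph_of [simp]: "gverts (graph_of t) = labels t"
  and gedges_graph_of [simp]: "gedges (graph_of t) = ledges t"
  by (simp_all add: graph_of_def)

lemma set_preorder: "set (preorder t) = labels t"
  by (induction t) auto

lemma finite_labels [simp]: "finite (labels t)"
  by (metis List.finite_set set_preorder)

lemma lab_in_labels [simp]: "lab t \<in> labels t"
  by (cases t) auto

lemma preorder_not_Nil [simp]: "preorder t \<noteq> []"
  by (cases t) auto

lemma labels_nonempty [simp]: "labels t \<noteq> {}"
  using lab_in_labels by blast

lemma finite_ledges [simp]: "finite (ledges t)"
  by (induction t) auto

lemma ledges_subset: "e \<in> ledges t \<Longrightarrow> e \<subseteq> labels t"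
  by (induction t) force

lemma ledges_nonempty: "e \<in> ledges t \<Longrightarrow> e \<noteq> {}"
  by (induction t) auto

text \<open>Splits a tree into its first branch and the rest, two trees without a common label, so
  that inductions can remove one branch at a time.\<close>

lemma distinct_labels_Cons:
  "distinct_labels (LNode a (s # ts)) \<longleftrightarrow>
     distinct_labels s \<and> distinct_labels (LNode a ts) \<and> labels s \<inter> labels (LNode a ts) = {}"
  by (auto simp: distinct_labels_def set_preorder)

lemma distinct_labels_Nil [simp]: "distinct_labels (LNode a [])"
  by (simp add: distinct_labels_def)

lemma distinct_labels_kid: "distinct_labels (LNode a ts) \<Longrightarrow> s \<in> set ts \<Longrightarrow> distinct_labels s"
  by (induction ts) (auto simp: distinct_labels_Cons)

lemma distinct_labels_root: "distinct_labels (LNode a ts) \<Longrightarrow> s \<in> set ts \<Longrightarrow> a \<notin> labels s"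
  by (induction ts) (auto simp: distinct_labels_Cons)

lemma distinct_labels_disjoint:
  "distinct_labels (LNode a ts) \<Longrightarrow> s \<in> set ts \<Longrightarrow> s' \<in> set ts \<Longrightarrow> v \<in> labels s \<Longrightarrow> v \<in> labels s'
    \<Longrightarrow> s = s'"
  by (induction ts) (auto simp: distinct_labels_Cons)

lemma distinct_labels_labs: "distinct_labels (LNode a ts) \<Longrightarrow> distinct (map lab ts)"
proof (induction ts)
  case (Cons s ts)
  then have "lab s \<noteq> lab s'" if "s' \<in> set ts" for s'
    using that lab_in_labels[of s] lab_in_labels[of s'] unfolding distinct_labels_Cons by fastforce
  with Cons show ?case by (auto simp: distinct_labels_Cons)
qed simp

lemma distinct_kids: "distinct_labels (LNode a ts) \<Longrightarrow> distinct ts"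
  using distinct_labels_labs[of a ts] by (simp add: distinct_map)

lemma inj_on_lab: "distinct_labels (LNode a ts) \<Longrightarrow> inj_on lab (set ts)"
  using distinct_labels_labs[of a ts] by (simp add: distinct_map)

lemma labels_kid: "s \<in> set ts \<Longrightarrow> v \<in> labels s \<Longrightarrow> v \<in> labels (LNode a ts)"
  by auto

lemma ledges_doubleton:
  "distinct_labels t \<Longrightarrow> e \<in> ledges t \<Longrightarrow> \<exists>u\<in>labels t. \<exists>v\<in>labels t. u \<noteq> v \<and> e = {u, v}"
proof (induction t)
  case (LNode a ts)
  then consider s where "s \<in> set ts" "e = {a, lab s}" | s where "s \<in> set ts" "e \<in> ledges s" by auto
  then show ?case
  proof cases
    case 1
    then have "a \<noteq> lab s" using distinct_labels_root[OF LNode.prems(1) 1(1)] lab_in_labels[of s] by metis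
    moreover have "lab s \<in> labels (LNode a ts)" using labels_kid[OF 1(1) lab_in_labels] .
    ultimately show ?thesis using 1(2) lab_in_labels[of "LNode a ts"] by auto
  next
    case 2
    then obtain u v where "u \<in> labels s" "v \<in> labels s" "u \<noteq> v" "e = {u, v}"
      using LNode.IH[OF 2(1) distinct_labels_kid[OF LNode.prems(1) 2(1)] 2(2)] by auto
    with 2 show ?thesis by (intro bexI[of _ u] bexI[of _ v]) auto
  qed
qed

lemma ledge_from_root:
  assumes "distinct_labels (LNode a ts)" "{a, v} \<in> ledges (LNode a ts)"
  shows "\<exists>s\<in>set ts. v = lab s"
proof -
  have "{a, v} \<notin> ledges s" if "s \<in> set ts" for s
    using ledges_subset distinct_labels_root[OF assms(1) that] by blast
  with assms(2) show ?thesis by (auto simp: doubleton_eq_iff)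
qed

section \<open>Paths that start at the root\<close>

lemma ledge_within_kid:
  assumes "distinct_labels (LNode a ts)" "{u, v} \<in> ledges (LNode a ts)" "u \<noteq> a" "v \<noteq> a"
    "s \<in> set ts" "u \<in> labels s"
  shows "{u, v} \<in> ledges s"
proof -
  have "\<exists>s'\<in>set ts. {u, v} \<in> ledges s'" using assms by (auto simp: doubleton_eq_iff)
  then obtain s' where s': "s' \<in> set ts" "{u, v} \<in> ledges s'" by blast
  then have "u \<in> labels s'" using ledges_subset by blast
  then show ?thesis using distinct_labels_disjoint[OF assms(1) s'(1) assms(5)] s' assms(6) by blast
qed

text \<open>Branches are linked only through the root: an edge avoiding it lies within one branch,
  so a walk avoiding it never leaves the branch in which it starts.\<close>

lemma walk_within_kid:
  assumes "distinct_labels (LNode a ts)" "s \<in> set ts" "q \<noteq> []" "hd q \<in> labels s" "a \<notin> set q"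
    "successively (\<lambda>u v. {u, v} \<in> ledges (LNode a ts)) q"
  shows "set q \<subseteq> labels s \<and> successively (\<lambda>u v. {u, v} \<in> ledges s) q"
  using assms(3-6)
proof (induction q rule: induct_list012)
  case (3 u v q)
  have e: "{u, v} \<in> ledges s"
    by (rule ledge_within_kid[OF assms(1) _ _ _ assms(2)]) (use 3 in \<open>auto simp del: ledges.simps\<close>)
  then have "v \<in> labels s" using ledges_subset by blast
  with 3 e show ?case by (simp del: ledges.simps)
qed auto

lemma graph_path_kid:
  assumes "distinct_labels (LNode a ts)" "s \<in> set ts" "graph_path (graph_of s) q"
  shows "graph_path (graph_of (LNode a ts)) q"
proof -
  have "successively (\<lambda>u v. {u, v} \<in> ledges (LNode a ts)) q"
    using assms(2,3) by (auto simp: graph_path_def intro: successively_mono[of "\<lambda>u v. {u, v} \<in> ledges s"])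
  then show ?thesis using assms(2,3) labels_kid[OF assms(2)] unfolding graph_path_def by auto
qed

lemma path_from_root:
  assumes d: "distinct_labels (LNode a ts)"
  shows "path_between (graph_of (LNode a ts)) a p w \<longleftrightarrow>
    (p = [a] \<and> w = a) \<or> (\<exists>s\<in>set ts. \<exists>q. p = a # q \<and> path_between (graph_of s) (lab s) q w)"
    (is "?L \<longleftrightarrow> ?R")
proof
  assume L: ?L
  then obtain q where p: "p = a # q" by (cases p) (auto simp: path_between_def graph_path_def)
  show ?R
  proof (cases "q = []")
    case True
    then show ?thesis using L p by (auto simp: path_between_def)
  next
    case False
    have *: "distinct (a # q)" "successively (\<lambda>u v. {u, v} \<in> ledges (LNode a ts)) (a # q)" "last q = w"
      using L p False by (auto simp: path_between_def graph_path_def)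
    have "{a, hd q} \<in> ledges (LNode a ts)" using *(2) False by (auto simp: successively_Cons)
    then obtain s where s: "s \<in> set ts" "hd q = lab s" using ledge_from_root[OF d] by blast
    have "set q \<subseteq> labels s \<and> successively (\<lambda>u v. {u, v} \<in> ledges s) q"
      using walk_within_kid[OF d s(1) False] * s False by (auto simp: successively_Cons)
    then have "path_between (graph_of s) (lab s) q w" using * s False
      by (auto simp: path_between_def graph_path_def)
    with s p show ?thesis by blast
  qed
next
  assume ?R
  then show ?L
  proof
    assume "\<exists>s\<in>set ts. \<exists>q. p = a # q \<and> path_between (graph_of s) (lab s) q w"
    then obtain s q where s: "s \<in> set ts" "p = a # q" "path_between (graph_of s) (lab s) q w" by blast
    have q: "graph_path (graph_of s) q" "q \<noteq> []" "set q \<subseteq> labels s" "hd q = lab s" "last q = w"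
      using s(3) by (auto simp: path_between_def graph_path_def)
    have "graph_path (graph_of (LNode a ts)) q" using graph_path_kid[OF d s(1) q(1)] .
    moreover have "a \<notin> set q" using q distinct_labels_root[OF d s(1)] by blast
    moreover have "{a, hd q} \<in> ledges (LNode a ts)" using s q by auto
    ultimately show ?L using q s(2)
      by (auto simp: path_between_def graph_path_def successively_Cons)
  qed (auto simp: path_between_def graph_path_def)
qed

lemma path_root_unique:
  "distinct_labels t \<Longrightarrow> path_between (graph_of t) (lab t) p w \<Longrightarrow>
    path_between (graph_of t) (lab t) p' w \<Longrightarrow> p = p'"
proof (induction t arbitrary: p p')
  case (LNode a ts)
  note d = LNode.prems(1)
  have in_labels: "w \<in> labels s" if "path_between (graph_of s) (lab s) q w" for s q
    using that by (auto simp: path_between_def graph_path_def)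
  have P: "(p = [a] \<and> w = a) \<or> (\<exists>s\<in>set ts. \<exists>q. p = a # q \<and> path_between (graph_of s) (lab s) q w)"
    "(p' = [a] \<and> w = a) \<or> (\<exists>s\<in>set ts. \<exists>q. p' = a # q \<and> path_between (graph_of s) (lab s) q w)"
    using LNode.prems(2,3) unfolding lt.sel path_from_root[OF d] by blast+
  show ?case
  proof (cases "w = a")
    case True
    then have "\<not> path_between (graph_of s) (lab s) q w" if "s \<in> set ts" for s q
      using in_labels distinct_labels_root[OF d that] by blast
    with P show ?thesis by blast
  next
    case False
    then obtain s q s' q' where s: "s \<in> set ts" "p = a # q" "path_between (graph_of s) (lab s) q w"
      and s': "s' \<in> set ts" "p' = a # q'" "path_between (graph_of s') (lab s') q' w"
      using P by blast
    have "s' = s" using distinct_labels_disjoint[OF d s'(1) s(1)] in_labels s s' by blast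
    then show ?thesis using LNode.IH[OF s(1) distinct_labels_kid[OF d s(1)]] s s' by blast
  qed
qed

lemma path_root_exists: "distinct_labels t \<Longrightarrow> w \<in> labels t \<Longrightarrow> \<exists>p. path_between (graph_of t) (lab t) p w"
proof (induction t)
  case (LNode a ts)
  show ?case
  proof (cases "w = a")
    case True
    then show ?thesis using path_from_root[OF LNode.prems(1)] by auto
  next
    case False
    then obtain s where s: "s \<in> set ts" "w \<in> labels s" using LNode by auto
    then obtain q where "path_between (graph_of s) (lab s) q w"
      using LNode.IH[OF s(1) distinct_labels_kid[OF LNode.prems(1) s(1)] s(2)] by blast
    then show ?thesis using path_from_root[OF LNode.prems(1), of "a # q" w] s by auto
  qed
qed

section \<open>Subtrees, distances, children and degrees\<close>

lemma subtree_distinct: "subtree t k u \<Longrightarrow> distinct_labels t \<Longrightarrow> distinct_labels u"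
  by (induction rule: subtree.induct) (auto dest: distinct_labels_kid)

lemma subtree_labels: "subtree t k u \<Longrightarrow> labels u \<subseteq> labels t"
  by (induction rule: subtree.induct) auto

lemma subtree_path:
  "subtree t k u \<Longrightarrow> distinct_labels t \<Longrightarrow>
    \<exists>p. path_between (graph_of t) (lab t) p (lab u) \<and> length p = Suc k"
proof (induction rule: subtree.induct)
  case (subtree_self t)
  then show ?case by (intro exI[of _ "[lab t]"]) (auto simp: path_between_def graph_path_def)
next
  case (subtree_kid s ts k u a)
  then obtain q where "path_between (graph_of s) (lab s) q (lab u)" "length q = Suc k"
    using subtree_kid.IH[OF distinct_labels_kid[OF subtree_kid.prems subtree_kid.hyps(1)]] by blast
  then show ?case using path_from_root[OF subtree_kid.prems, of "a # q" "lab u"] subtree_kid.hyps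
    by (intro exI[of _ "a # q"]) auto
qed

lemma graph_dist_subtree:
  assumes "distinct_labels t" "subtree t k u"
  shows "graph_dist (graph_of t) (lab t) (lab u) = k"
proof -
  obtain p where p: "path_between (graph_of t) (lab t) p (lab u)" "length p = Suc k"
    using subtree_path assms by blast
  show ?thesis unfolding graph_dist_def
  proof (rule Least_equality)
    show "\<exists>p. path_between (graph_of t) (lab t) p (lab u) \<and> length p = Suc k" using p by blast
    fix l assume "\<exists>p. path_between (graph_of t) (lab t) p (lab u) \<and> length p = Suc l"
    then show "k \<le> l" using p path_root_unique[OF assms(1)] by fastforce
  qed
qed

lemma descendants_subtree:
  "subtree t k u \<Longrightarrow> distinct_labels t \<Longrightarrow> descendants (graph_of t) (lab t) (lab u) = labels u"
proof (induction rule: subtree.induct)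
  case (subtree_self t)
  have "lab t \<in> set p \<and> w \<in> labels t" if "path_between (graph_of t) (lab t) p w" for p w
    using that hd_in_set[of p] by (auto simp: path_between_def graph_path_def)
  then show ?case using path_root_exists[OF subtree_self] unfolding descendants_def by blast
next
  case (subtree_kid s ts k u a)
  note d = subtree_kid.prems
  have u: "lab u \<in> labels s" using subtree_labels[OF subtree_kid.hyps(2)] by (rule subsetD) simp
  have ua: "lab u \<noteq> a" using distinct_labels_root[OF d subtree_kid.hyps(1)] u by blast
  have sub: "set q \<subseteq> labels s'" if "path_between (graph_of s') (lab s') q w" for s' q w
    using that by (auto simp: path_between_def graph_path_def)
  have "descendants (graph_of (LNode a ts)) a (lab u) = descendants (graph_of s) (lab s) (lab u)"
  proof (intro set_eqI iffI)
    fix w assume "w \<in> descendants (graph_of (LNode a ts)) a (lab u)"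
    then obtain p where p: "path_between (graph_of (LNode a ts)) a p w" "lab u \<in> set p"
      by (auto simp: descendants_def)
    then obtain s' q where s': "s' \<in> set ts" "p = a # q" "path_between (graph_of s') (lab s') q w"
      unfolding path_from_root[OF d] using ua by auto
    then have "lab u \<in> set q" using p ua by simp
    moreover from this have "lab u \<in> labels s'" using sub[OF s'(3)] by blast
    then have "s' = s" using distinct_labels_disjoint[OF d s'(1) subtree_kid.hyps(1)] u by blast
    ultimately show "w \<in> descendants (graph_of s) (lab s) (lab u)" using s' by (auto simp: descendants_def)
  next
    fix w assume "w \<in> descendants (graph_of s) (lab s) (lab u)"
    then obtain q where q: "path_between (graph_of s) (lab s) q w" "lab u \<in> set q"
      by (auto simp: descendants_def)
    then have "path_between (graph_of (LNode a ts)) a (a # q) w"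
      unfolding path_from_root[OF d] using subtree_kid.hyps by blast
    moreover have "lab u \<in> set (a # q)" using q by simp
    ultimately show "w \<in> descendants (graph_of (LNode a ts)) a (lab u)"
      unfolding descendants_def by blast
  qed
  then show ?case using subtree_kid.IH distinct_labels_kid[OF d subtree_kid.hyps(1)] by simp
qed

lemma induced_edges_subtree:
  "subtree t k u \<Longrightarrow> distinct_labels t \<Longrightarrow> {e \<in> ledges t. e \<subseteq> labels u} = ledges u"
proof (induction rule: subtree.induct)
  case (subtree_self t)
  then show ?case using ledges_subset by blast
next
  case (subtree_kid s ts k u a)
  note d = subtree_kid.prems
  have "{e \<in> ledges (LNode a ts). e \<subseteq> labels u} = {e \<in> ledges s. e \<subseteq> labels u}"
  proof (intro set_eqI iffI)
    fix e assume e: "e \<in> {e \<in> ledges (LNode a ts). e \<subseteq> labels u}"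
    then obtain v w where vw: "e = {v, w}" using ledges_doubleton[OF d] by blast
    have "e \<subseteq> labels s" using e subtree_labels[OF subtree_kid.hyps(2)] by blast
    then have "{v, w} \<in> ledges s" using e vw ledge_within_kid[OF d _ _ _ subtree_kid.hyps(1)]
        distinct_labels_root[OF d subtree_kid.hyps(1)] by blast
    then show "e \<in> {e \<in> ledges s. e \<subseteq> labels u}" using e vw by blast
  qed (use subtree_kid.hyps in auto)
  then show ?case using subtree_kid.IH distinct_labels_kid[OF d subtree_kid.hyps(1)] by simp
qed

lemma subtree_at_subtree:
  assumes "distinct_labels t" "subtree t k u"
  shows "subtree_at (graph_of t) (lab t) (lab u) = graph_of u"
  using descendants_subtree[OF assms(2,1)] induced_edges_subtree[OF assms(2,1)]
  by (simp add: subtree_at_def graph_of_def[of u])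

lemma children_subtree:
  assumes "distinct_labels t" "subtree t k u"
  shows "children (graph_of t) (lab t) (lab u) = lab ` set (kids u)"
proof -
  obtain b us where u: "u = LNode b us" by (cases u)
  have "children (graph_of t) (lab t) (lab u) = {w \<in> labels u. {lab u, w} \<in> {e \<in> ledges t. e \<subseteq> labels u}}"
    using descendants_subtree[OF assms(2,1)] by (auto simp: children_def)
  also have "\<dots> = {w \<in> labels u. {lab u, w} \<in> ledges u}" using induced_edges_subtree[OF assms(2,1)] by simp
  also have "\<dots> = lab ` set us"
  proof (intro set_eqI iffI)
    fix w assume "w \<in> {w \<in> labels u. {lab u, w} \<in> ledges u}"
    then show "w \<in> lab ` set us" using ledge_from_root[of b us w] subtree_distinct[OF assms(2,1)] u by auto
  next
    fix w assume "w \<in> lab ` set us"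
    then obtain s where s: "s \<in> set us" "w = lab s" by blast
    then have "w \<in> labels u" "{lab u, w} \<in> ledges u" using labels_kid[OF s(1) lab_in_labels] u by auto
    then show "w \<in> {w \<in> labels u. {lab u, w} \<in> ledges u}" by simp
  qed
  finally show ?thesis using u by simp
qed

lemma card_children_subtree:
  assumes "distinct_labels t" "subtree t k u"
  shows "card (children (graph_of t) (lab t) (lab u)) = length (kids u)"
proof -
  have "distinct (map lab (kids u))"
    using subtree_distinct[OF assms(2,1)] distinct_labels_labs by (cases u) auto
  then show ?thesis using children_subtree[OF assms] distinct_card by fastforce
qed

text \<open>Every vertex except the root has an edge to its parent. In the induction this edge is
  new exactly when the vertex is the root of the kid.\<close>

lemma vertex_degree_subtree:
  "subtree t k u \<Longrightarrow> distinct_labels t \<Longrightarrow>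
    vertex_degree (graph_of t) (lab u) = length (kids u) + (if k = 0 then 0 else 1)"
proof (induction rule: subtree.induct)
  case (subtree_self t)
  obtain a ts where t: "t = LNode a ts" by (cases t)
  have "{e \<in> ledges t. lab t \<in> e} = (\<lambda>s. {a, lab s}) ` set ts"
    using ledges_subset distinct_labels_root subtree_self unfolding t by fastforce
  moreover have "inj_on (\<lambda>s. {a, lab s}) (set ts)"
    using inj_on_lab subtree_self unfolding t inj_on_def by (metis doubleton_eq_iff)
  moreover have "card (set ts) = length ts" using distinct_card[OF distinct_kids[of a ts]] subtree_self t by simp
  ultimately show ?case using t by (simp add: vertex_degree_def card_image)
next
  case (subtree_kid s ts k u a)
  note d = subtree_kid.prems and s = subtree_kid.hyps(1)
  have u: "lab u \<in> labels s" using subtree_labels[OF subtree_kid.hyps(2)] by (rule subsetD) simp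
  have ua: "lab u \<in> labels s" "lab u \<noteq> a" using distinct_labels_root[OF d s] u by blast+
  have edges: "{e \<in> ledges (LNode a ts). lab u \<in> e} =
      {e \<in> ledges s. lab u \<in> e} \<union> (if lab u = lab s then {{a, lab s}} else {})"
  proof (intro set_eqI iffI)
    fix e assume e: "e \<in> {e \<in> ledges (LNode a ts). lab u \<in> e}"
    then consider s' where "s' \<in> set ts" "e = {a, lab s'}" | s' where "s' \<in> set ts" "e \<in> ledges s'" by auto
    then show "e \<in> {e \<in> ledges s. lab u \<in> e} \<union> (if lab u = lab s then {{a, lab s}} else {})"
    proof cases
      case 1
      then have "lab u = lab s'" using e ua by auto
      then have "s' = s" using distinct_labels_disjoint[OF d 1(1) s, of "lab u"] ua(1) lab_in_labels[of s'] by simp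
      with 1 \<open>lab u = lab s'\<close> show ?thesis by simp
    next
      case 2
      then have "lab u \<in> labels s'" using e ledges_subset by blast
      then have "s' = s" using distinct_labels_disjoint[OF d 2(1) s] ua by blast
      with 2 e show ?thesis by simp
    qed
  qed (use s in \<open>auto split: if_splits\<close>)
  have new: "{a, lab s} \<notin> ledges s" using ledges_subset distinct_labels_root[OF d s] by blast
  have root: "lab u = lab s \<longleftrightarrow> k = 0"
  proof
    assume "k = 0"
    then show "lab u = lab s" using subtree_kid.hyps(2) by (auto elim: subtree.cases)
  next
    assume "lab u = lab s"
    then show "k = 0"
      using graph_dist_subtree[OF distinct_labels_kid[OF d s] subtree_kid.hyps(2)]
        graph_dist_subtree[OF distinct_labels_kid[OF d s] subtree_self] by simp
  qed
  have "vertex_degree (graph_of (LNode a ts)) (lab u) =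
      vertex_degree (graph_of s) (lab u) + (if lab u = lab s then 1 else 0)"
    unfolding vertex_degree_def gedges_graph_of edges using new by (auto simp: card_insert_if)
  then show ?case using subtree_kid.IH distinct_labels_kid[OF d s] root by simp
qed

lemma subtree_of_label: "v \<in> labels t \<Longrightarrow> \<exists>k u. subtree t k u \<and> lab u = v"
proof (induction t)
  case (LNode a ts)
  show ?case
  proof (cases "v = a")
    case True
    then show ?thesis using subtree_self[of "LNode a ts"] by force
  next
    case False
    then obtain s where s: "s \<in> set ts" "v \<in> labels s" using LNode.prems by auto
    then show ?thesis using LNode.IH[OF s] subtree_kid[OF s(1)] by blast
  qed
qed

section \<open>Trees as graphs\<close>

lemma path_between_rev: "path_between G u p v \<Longrightarrow> path_between G v (rev p) u"
  by (auto simp: path_between_def graph_path_def hd_rev last_rev insert_commute)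

lemma graph_cycle_rotate:
  assumes "graph_cycle G (xs @ ys)"
  shows "graph_cycle G (ys @ xs)"
proof (cases "xs = [] \<or> ys = []")
  case False
  then show ?thesis using assms
    by (auto simp: graph_cycle_def graph_path_def successively_append_iff)
qed (use assms in auto)

text \<open>A cycle avoiding the root stays in one branch. Otherwise it is rotated to start at the
  root; the rest stays in one branch, so both neighbours of the root on the cycle are the root of
  that branch, although a cycle has at least three vertices.\<close>

lemma acyclic_graph_of: "distinct_labels t \<Longrightarrow> \<not> graph_cycle (graph_of t) p"
proof (induction t arbitrary: p)
  case (LNode a ts)
  note d = LNode.prems
  show ?case
  proof
    assume cyc: "graph_cycle (graph_of (LNode a ts)) p"
    show False
    proof (cases "a \<in> set p")
      case False
      have p: "p \<noteq> []" "set p \<subseteq> labels (LNode a ts)" "{last p, hd p} \<in> ledges (LNode a ts)"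
        "successively (\<lambda>u v. {u, v} \<in> ledges (LNode a ts)) p" "distinct p" "length p \<ge> 3"
        using cyc by (auto simp: graph_cycle_def graph_path_def simp del: labels.simps ledges.simps)
      have "hd p \<in> labels (LNode a ts)" "hd p \<noteq> a" using p False hd_in_set[OF p(1)] by blast+
      then obtain s where s: "s \<in> set ts" "hd p \<in> labels s" by auto
      have w: "set p \<subseteq> labels s" "successively (\<lambda>u v. {u, v} \<in> ledges s) p"
        using walk_within_kid[OF d s(1) p(1) s(2) False p(4)] by auto
      have "{hd p, last p} \<in> ledges s"
        by (rule ledge_within_kid[OF d _ _ _ s(1) s(2)])
          (use p False hd_in_set[OF p(1)] last_in_set[OF p(1)] in \<open>auto simp: insert_commute simp del: ledges.simps\<close>)
      then have "graph_cycle (graph_of s) p"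
        using w p by (auto simp: graph_cycle_def graph_path_def insert_commute)
      then show False using LNode.IH[OF s(1) distinct_labels_kid[OF d s(1)]] by blast
    next
      case True
      then obtain xs ys where "p = xs @ a # ys" by (meson split_list)
      then have "graph_cycle (graph_of (LNode a ts)) ((a # ys) @ xs)"
        using graph_cycle_rotate cyc by metis
      then obtain q where q: "graph_cycle (graph_of (LNode a ts)) (a # q)" by auto
      have q': "q \<noteq> []" "a \<notin> set q" "distinct q" "length q \<ge> 2" "{a, hd q} \<in> ledges (LNode a ts)"
          "{a, last q} \<in> ledges (LNode a ts)" "successively (\<lambda>u v. {u, v} \<in> ledges (LNode a ts)) q"
        using q by (cases q; auto simp: graph_cycle_def graph_path_def insert_commute simp del: ledges.simps)+
      obtain s where s: "s \<in> set ts" "hd q = lab s" using ledge_from_root[OF d q'(5)] by blast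
      obtain s' where s': "s' \<in> set ts" "last q = lab s'" using ledge_from_root[OF d q'(6)] by blast
      have "set q \<subseteq> labels s" using walk_within_kid[OF d s(1) q'(1) _ q'(2,7)] s(2) by auto
      then have "lab s' \<in> labels s" using s'(2) last_in_set[OF q'(1)] by auto
      then have "s' = s" using distinct_labels_disjoint[OF d s'(1) s(1) lab_in_labels] by blast
      then have "hd q = last q" using s s' by simp
      then show False using q'(1,3,4) by (cases q rule: rev_cases) (auto simp: hd_append split: if_splits)
    qed
  qed
qed

lemma connected_graph_of: "distinct_labels t \<Longrightarrow> connected_graph (graph_of t)"
proof -
  have "distinct_labels t \<Longrightarrow> u \<in> labels t \<Longrightarrow> v \<in> labels t \<Longrightarrow> \<exists>p. path_between (graph_of t) u p v" for u v
  proof (induction t)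
    case (LNode a ts)
    note d = LNode.prems(1)
    consider "u = a" | "v = a"
      | s where "s \<in> set ts" "u \<in> labels s" "v \<in> labels s"
      | s s' where "s \<in> set ts" "s' \<in> set ts" "s \<noteq> s'" "u \<in> labels s" "v \<in> labels s'"
      using LNode.prems by auto
    then show ?case
    proof cases
      case 1
      then show ?thesis using path_root_exists[OF d LNode.prems(3)] by simp
    next
      case 2
      obtain p where "path_between (graph_of (LNode a ts)) a p u"
        using path_root_exists[OF d LNode.prems(2)] by auto
      then show ?thesis using path_between_rev 2 by (intro exI[of _ "rev p"]) simp
    next
      case 3
      then obtain p where "path_between (graph_of s) u p v"
        using LNode.IH[OF 3(1) distinct_labels_kid[OF d 3(1)]] by auto
      then have "path_between (graph_of (LNode a ts)) u p v"
        using graph_path_kid[OF d 3(1)] by (simp add: path_between_def)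
      then show ?thesis by blast
    next
      case 4
      obtain p q where p: "path_between (graph_of s) (lab s) p u" and q: "path_between (graph_of s') (lab s') q v"
        using path_root_exists distinct_labels_kid[OF d] 4 by metis
      have gp: "path_between (graph_of (LNode a ts)) a (a # p) u" "path_between (graph_of (LNode a ts)) a (a # q) v"
        using p q 4 unfolding path_from_root[OF d] by blast+
      have sub: "set p \<subseteq> labels s" "set q \<subseteq> labels s'" "p \<noteq> []" "q \<noteq> []"
        using p q by (auto simp: path_between_def graph_path_def)
      then have "set p \<inter> set q = {}" using distinct_labels_disjoint[OF d 4(1,2)] 4(3) by blast
      then have "path_between (graph_of (LNode a ts)) u (rev p @ a # q) v"
        using path_between_rev[OF gp(1)] gp(2) sub
        by (auto simp: path_between_def graph_path_def successively_append_iff hd_rev simp del: ledges.simps labels.simps)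
      then show ?thesis by blast
    qed
  qed
  then show "distinct_labels t \<Longrightarrow> connected_graph (graph_of t)" by (auto simp: connected_graph_def)
qed

lemma tree_graph_of: "distinct_labels t \<Longrightarrow> tree_graph (graph_of t)"
  unfolding tree_graph_def finite_simple_graph_def
  using ledges_doubleton[of t] connected_graph_of[of t] acyclic_graph_of[of t] by auto

section \<open>Adding and removing leaves\<close>

primrec add_leaf :: "'a \<Rightarrow> 'a \<Rightarrow> 'a lt \<Rightarrow> 'a lt" where
  "add_leaf q l (LNode a ts) = LNode a ((if a = q then [LNode l []] else []) @ map (add_leaf q l) ts)"

lemma lab_add_leaf [simp]: "lab (add_leaf q l t) = lab t"
  by (cases t) simp

lemma labels_add_leaf: "labels (add_leaf q l t) = labels t \<union> (if q \<in> labels t then {l} else {})"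
  by (induction t) (auto split: if_splits)

lemma ledges_add_leaf: "ledges (add_leaf q l t) = ledges t \<union> (if q \<in> labels t then {{q, l}} else {})"
proof (induction t)
  case (LNode a ts)
  have "ledges (add_leaf q l (LNode a ts)) = (if a = q then {{q, l}} else {}) \<union>
      ((\<lambda>s. {a, lab s}) ` set ts \<union> (\<Union>s\<in>set ts. ledges (add_leaf q l s)))"
    by (auto simp: image_image)
  moreover have "(\<Union>s\<in>set ts. ledges (add_leaf q l s)) =
      (\<Union>s\<in>set ts. ledges s \<union> (if q \<in> labels s then {{q, l}} else {}))"
    using LNode by (intro SUP_cong) auto
  ultimately have "ledges (add_leaf q l (LNode a ts)) = (if a = q then {{q, l}} else {}) \<union>
      ((\<lambda>s. {a, lab s}) ` set ts \<union> (\<Union>s\<in>set ts. ledges s \<union> (if q \<in> labels s then {{q, l}} else {})))"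
    by simp
  also have "\<dots> = ledges (LNode a ts) \<union> (if q \<in> labels (LNode a ts) then {{q, l}} else {})"
    by (rule set_eqI) (simp, meson)
  finally show ?case .
qed

lemma distinct_add_leaf:
  "distinct_labels t \<Longrightarrow> l \<notin> labels t \<Longrightarrow> distinct_labels (add_leaf q l t)"
proof (induction t)
  case (LNode a ts)
  have "distinct_labels (LNode a (map (add_leaf q l) ts))"
    using LNode
  proof (induction ts)
    case (Cons s ts)
    have IH: "distinct_labels (LNode a (map (add_leaf q l) ts))"
      using Cons.prems by (intro Cons.IH) (auto simp: distinct_labels_Cons)
    have s: "distinct_labels (add_leaf q l s)" using Cons.prems by (auto simp: distinct_labels_Cons)
    have "labels (LNode a (map (add_leaf q l) ts)) \<subseteq>
        labels (LNode a ts) \<union> (if q \<in> labels (LNode a ts) then {l} else {})"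
      by (auto simp: labels_add_leaf split: if_splits)
    moreover have "labels s \<inter> labels (LNode a ts) = {}" "l \<notin> labels s" "l \<notin> labels (LNode a ts)"
      using Cons.prems by (auto simp: distinct_labels_Cons)
    ultimately have "labels (add_leaf q l s) \<inter> labels (LNode a (map (add_leaf q l) ts)) = {}"
      unfolding labels_add_leaf by (auto split: if_splits simp del: labels.simps)
    then show ?case using IH s by (simp add: distinct_labels_Cons del: labels.simps)
  qed simp
  moreover have "l \<notin> labels (LNode a (map (add_leaf q l) ts))" if "a = q"
  proof -
    have "q \<notin> labels s" if "s \<in> set ts" for s using distinct_labels_root[OF LNode.prems(1) that] \<open>a = q\<close> by simp
    then show ?thesis using LNode.prems(2) by (auto simp: labels_add_leaf)
  qed
  ultimately show ?case by (simp add: distinct_labels_Cons del: labels.simps) (auto simp: distinct_labels_def)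
qed

lemma tree_path_exists:
  "tree_graph T \<Longrightarrow> u \<in> gverts T \<Longrightarrow> v \<in> gverts T \<Longrightarrow> \<exists>p. path_between T u p v"
  by (simp add: tree_graph_def connected_graph_def)

lemma graph_path_subgraph:
  assumes "graph_path G p" "gverts G \<subseteq> gverts H" "gedges G \<subseteq> gedges H"
  shows "graph_path H p"
  using assms successively_mono[of "\<lambda>u v. {u, v} \<in> gedges G" p "\<lambda>u v. {u, v} \<in> gedges H"]
  unfolding graph_path_def by blast

text \<open>The last vertex of a longest path that starts at \<open>r\<close> is a leaf.\<close>

lemma tree_leaf_exists:
  assumes tree: "tree_graph T" and r: "r \<in> gverts T" and big: "gverts T \<noteq> {r}"
  obtains l q where "l \<in> gverts T" "l \<noteq> r" "q \<in> gverts T" "q \<noteq> l" "{q, l} \<in> gedges T"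
    "\<And>e. e \<in> gedges T \<Longrightarrow> l \<in> e \<Longrightarrow> e = {q, l}"
proof -
  have fin: "finite (gverts T)" and simple: "\<forall>e\<in>gedges T. \<exists>u\<in>gverts T. \<exists>v\<in>gverts T. u \<noteq> v \<and> e = {u, v}"
    using tree by (auto simp: tree_graph_def finite_simple_graph_def)
  obtain v where v: "v \<in> gverts T" "v \<noteq> r" using r big by blast
  then obtain p0 where "path_between T r p0 v" using tree_path_exists[OF tree r] by blast
  then have p0: "graph_path T p0" "hd p0 = r" "last p0 = v" by (auto simp: path_between_def)
  have p02: "length p0 \<ge> 2" using p0 v by (cases p0 rule: list.exhaust; cases "tl p0") (auto simp: graph_path_def)
  let ?P = "\<lambda>p. graph_path T p \<and> hd p = r"
  have bound: "length p \<le> card (gverts T)" if "?P p" for p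
    using that fin by (auto simp: graph_path_def) (metis card_mono distinct_card)
  have "\<exists>p. ?P p \<and> (\<forall>q. ?P q \<longrightarrow> length q \<le> length p)"
    by (rule ex_has_greatest_nat[of ?P p0 length "Suc (card (gverts T))"])
      (use p0 bound in \<open>auto simp: less_Suc_eq_le\<close>)
  then obtain p where p: "?P p" and max: "\<And>q. ?P q \<Longrightarrow> length q \<le> length p"
    by auto
  have len: "length p \<ge> 2" using max[of p0] p0 p02 by simp
  define l where "l = last p"
  define p' where "p' = butlast p"
  have pp: "p = p' @ [l]" "p' \<noteq> []"
    unfolding p'_def l_def using len by (cases p rule: rev_cases; auto)+
  define q where "q = last p'"
  have gp: "distinct p" "set p \<subseteq> gverts T" "successively (\<lambda>u v. {u, v} \<in> gedges T) p"
    using p by (auto simp: graph_path_def)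
  have ql: "{q, l} \<in> gedges T" using gp(3) pp by (simp add: q_def successively_append_iff)
  have qp: "q \<in> set p'" using pp(2) q_def by simp
  \<comment> \<open>A neighbour of \<open>l\<close> off the path would prolong it, and one before
    \<open>q\<close> on the path would close a cycle.\<close>
  have only: "e = {q, l}" if e: "e \<in> gedges T" "l \<in> e" for e
  proof -
    obtain w where w: "e = {l, w}" "w \<noteq> l" "w \<in> gverts T"
      using simple e by (metis doubleton_eq_iff insertE singletonD insert_commute)
    have "w \<in> set p"
    proof (rule ccontr)
      assume "w \<notin> set p"
      then have "?P (p @ [w])" using p w e pp
        by (auto simp: graph_path_def successively_append_iff)
      then show False using max[of "p @ [w]"] by simp
    qed
    then have "w \<in> set p'" using pp(1) w by auto
    then obtain xs ys where xy: "p' = xs @ w # ys" by (meson split_list)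
    have "ys = []"
    proof (rule ccontr)
      assume ys: "ys \<noteq> []"
      have "graph_cycle T (w # ys @ [l])"
        unfolding graph_cycle_def graph_path_def
        using gp pp(1) xy ys e w by (cases ys) (auto simp: successively_append_iff)
      then show False using tree by (auto simp: tree_graph_def)
    qed
    then show ?thesis using w xy by (simp add: q_def insert_commute)
  qed
  have "l \<in> gverts T" "q \<in> gverts T" using gp(2) pp(1) qp by auto
  moreover have "q \<noteq> l" using gp(1) pp(1) qp by auto
  moreover have "l \<noteq> r" using p gp(1) pp by (cases p') auto
  ultimately show thesis using that ql only by blast
qed

lemma tree_remove_leaf:
  assumes tree: "tree_graph T" and l: "l \<in> gverts T" and q: "q \<in> gverts T" "q \<noteq> l" "{q, l} \<in> gedges T"
    and only: "\<And>e. e \<in> gedges T \<Longrightarrow> l \<in> e \<Longrightarrow> e = {q, l}"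
  shows "tree_graph (gverts T - {l}, gedges T - {{q, l}})" (is "tree_graph ?T'")
  unfolding tree_graph_def
proof (intro conjI)
  have fin: "finite (gverts T)" and simple: "\<forall>e\<in>gedges T. \<exists>u\<in>gverts T. \<exists>v\<in>gverts T. u \<noteq> v \<and> e = {u, v}"
    using tree by (auto simp: tree_graph_def finite_simple_graph_def)
  have "\<exists>u\<in>gverts T - {l}. \<exists>v\<in>gverts T - {l}. u \<noteq> v \<and> e = {u, v}" if e: "e \<in> gedges T - {{q, l}}" for e
  proof -
    have "l \<notin> e" using only e by blast
    then show ?thesis using simple e by fastforce
  qed
  then show "finite_simple_graph ?T'" using fin by (simp add: finite_simple_graph_def)
  show "connected_graph ?T'" unfolding connected_graph_def
  proof (intro conjI ballI)
    show "gverts ?T' \<noteq> {}" using q by auto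
    fix u v assume uv: "u \<in> gverts ?T'" "v \<in> gverts ?T'"
    then obtain p where p: "path_between T u p v" using tree_path_exists[OF tree] by auto
    then have gp: "distinct p" "p \<noteq> []" "set p \<subseteq> gverts T" "successively (\<lambda>u v. {u, v} \<in> gedges T) p" "hd p = u" "last p = v"
      by (auto simp: path_between_def graph_path_def)
    \<comment> \<open>\<open>l\<close> is not an end of \<open>p\<close>, so the path would pass it
      between two different neighbours, but \<open>q\<close> is its only one.\<close>
    have "l \<notin> set p"
    proof
      assume "l \<in> set p"
      then obtain xs ys where xy: "p = xs @ l # ys" by (meson split_list)
      have ne: "xs \<noteq> []" "ys \<noteq> []" using xy gp uv by (cases xs; cases ys; auto)+
      have "{last xs, l} \<in> gedges T" "{l, hd ys} \<in> gedges T"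
        using gp(4) ne unfolding xy by (auto simp: successively_append_iff successively_Cons)
      then have "{last xs, l} = {q, l}" "{l, hd ys} = {q, l}" using only by blast+
      then have "last xs = hd ys" by (metis doubleton_eq_iff)
      then show False using gp(1) ne last_in_set[OF ne(1)] hd_in_set[OF ne(2)] unfolding xy by auto
    qed
    then have "successively (\<lambda>u v. {u, v} \<in> gedges ?T') p"
      using gp(4) by (intro successively_mono[OF gp(4)]) (auto simp: doubleton_eq_iff)
    then have "path_between ?T' u p v" using gp \<open>l \<notin> set p\<close> by (auto simp: path_between_def graph_path_def)
    then show "\<exists>p. path_between ?T' u p v" ..
  qed
  show "\<nexists>p. graph_cycle ?T' p"
  proof
    assume "\<exists>p. graph_cycle ?T' p"
    then obtain p where "graph_cycle ?T' p" ..
    then have "graph_cycle T p" using graph_path_subgraph[of ?T' p T] by (auto simp: graph_cycle_def)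
    then show False using tree by (auto simp: tree_graph_def)
  qed
qed

text \<open>Induction on the number of vertices: a leaf other than \<open>r\<close> is removed and
  attached again by \<open>add_leaf\<close>. Since \<open>r\<close> survives, any vertex can be made
  the root, which later allows a choice of maximal conductance.\<close>

lemma tree_graph_labelled:
  assumes "tree_graph T" "r \<in> gverts T"
  shows "\<exists>t. distinct_labels t \<and> lab t = r \<and> graph_of t = T"
  using assms
proof (induction "card (gverts T)" arbitrary: T rule: less_induct)
  case less
  have simple: "finite_simple_graph T" using less.prems by (simp add: tree_graph_def)
  then have fin: "finite (gverts T)" by (simp add: finite_simple_graph_def)
  show ?case
  proof (cases "gverts T = {r}")
    case True
    then have "gedges T = {}" using simple unfolding finite_simple_graph_def
      by (metis all_not_in_conv singletonD)
    then have "graph_of (LNode r []) = T" using True by (simp add: graph_of_def prod_eq_iff)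
    then show ?thesis by (intro exI[of _ "LNode r []"]) simp
  next
    case False
    obtain l q where lq: "l \<in> gverts T" "l \<noteq> r" "q \<in> gverts T" "q \<noteq> l" "{q, l} \<in> gedges T"
      "\<And>e. e \<in> gedges T \<Longrightarrow> l \<in> e \<Longrightarrow> e = {q, l}"
      using tree_leaf_exists[OF less.prems False] by blast
    let ?T' = "(gverts T - {l}, gedges T - {{q, l}})"
    have "tree_graph ?T'" by (rule tree_remove_leaf[OF less.prems(1) lq(1,3-5)]) (rule lq(6))
    moreover have "card (gverts ?T') < card (gverts T)" using card_Diff1_less[OF fin lq(1)] by simp
    ultimately obtain t where t: "distinct_labels t" "lab t = r" "graph_of t = ?T'"
      using less.hyps[of ?T'] less.prems(2) lq(2) by auto
    have "labels t = gverts T - {l}" "ledges t = gedges T - {{q, l}}"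
      using t(3) by (auto simp: graph_of_def)
    then have "graph_of (add_leaf q l t) = T"
      using lq(1-5) by (auto simp: graph_of_def labels_add_leaf ledges_add_leaf prod_eq_iff)
    moreover have "distinct_labels (add_leaf q l t)"
      using distinct_add_leaf[OF t(1), of l q] \<open>labels t = _\<close> by simp
    ultimately show ?thesis using t by (intro exI[of _ "add_leaf q l t"]) simp
  qed
qed

section \<open>Codes of labelled trees\<close>

text \<open>The subtraction is truncated: a vertex with more than \<open>d\<close> kids receives no
  padding, and its code is then not \<open>full\<close>.\<close>

primrec code :: "nat \<Rightarrow> 'a lt \<Rightarrow> pt" where
  "code d (LNode a ts) = Node (mset (map (code d) ts) + replicate_mset (d - length ts) Emp)"

definition root_code :: "nat \<Rightarrow> 'a lt \<Rightarrow> pt" where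
  "root_code d t = Node (mset (map (code d) (kids t)) + replicate_mset (Suc d - length (kids t)) Emp)"

primrec arity_le :: "nat \<Rightarrow> 'a lt \<Rightarrow> bool" where
  "arity_le d (LNode a ts) \<longleftrightarrow> length ts \<le> d \<and> (\<forall>b\<in>set (map (arity_le d) ts). b)"

definition root_arity_le :: "nat \<Rightarrow> 'a lt \<Rightarrow> bool" where
  "root_arity_le d t \<longleftrightarrow> length (kids t) \<le> Suc d \<and> (\<forall>s\<in>set (kids t). arity_le d s)"

lemma code_not_Emp [simp]: "code d t \<noteq> Emp" "Emp \<noteq> code d t"
  by (cases t; simp)+

lemma full_code: "arity_le d t \<Longrightarrow> full d (code d t)"
  by (induction t) auto

lemma full_root_code: "root_arity_le d t \<Longrightarrow> full_root d (root_code d t)"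
  using full_code by (auto simp: full_root_def root_arity_le_def root_code_def)

lemma order_code: "order (code d t) = length (preorder t)"
proof (induction t)
  case (LNode a ts)
  then have "(\<Sum>s\<in>#mset ts. order (code d s)) = (\<Sum>s\<in>#mset ts. length (preorder s))"
    by (intro arg_cong[of _ _ sum_mset] image_mset_cong) auto
  then show ?case
    by (simp add: length_concat o_def image_mset.compositionality flip: sum_mset_sum_list)
qed

lemma card_labels: "distinct_labels t \<Longrightarrow> card (labels t) = length (preorder t)"
  unfolding distinct_labels_def set_preorder[symmetric] by (rule distinct_card)

lemma order_root_code: "distinct_labels t \<Longrightarrow> order (root_code d t) = card (labels t)"
proof -
  assume d: "distinct_labels t"
  obtain a ts where t: "t = LNode a ts" by (cases t)
  have "order (root_code d t) = order (code d t)" by (simp add: root_code_def t)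
  then show ?thesis using order_code card_labels[OF d] by metis
qed

lemma preorder_map_lt: "preorder (map_lt f t) = map f (preorder t)"
  by (induction t) (auto simp: map_concat o_def intro!: arg_cong[of _ _ concat])

lemma labels_map_lt: "labels (map_lt f t) = f ` labels t"
  by (metis preorder_map_lt set_map set_preorder)

lemma lab_map_lt: "lab (map_lt f t) = f (lab t)"
  by (cases t) simp

lemma kids_map_lt: "kids (map_lt f t) = map (map_lt f) (kids t)"
  by (cases t) simp

lemma ledges_map_lt: "ledges (map_lt f t) = (\<lambda>e. f ` e) ` ledges t"
  by (induction t) (auto simp: lab_map_lt image_Un image_UN image_image)

lemma code_map_lt: "code d (map_lt f t) = code d t"
proof (induction t)
  case (LNode a ts)
  then have "image_mset (\<lambda>s. code d (map_lt f s)) (mset ts) = image_mset (code d) (mset ts)"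
    by (intro image_mset_cong) auto
  then show ?case by (simp add: image_mset.compositionality o_def)
qed

lemma root_code_map_lt: "root_code d (map_lt f t) = root_code d t"
proof -
  have "map (code d) (map (map_lt f) (kids t)) = map (code d) (kids t)" by (simp add: code_map_lt)
  then show ?thesis by (simp only: root_code_def kids_map_lt length_map)
qed

lemma distinct_labels_map_lt: "inj_on f (labels t) \<Longrightarrow> distinct_labels t \<Longrightarrow> distinct_labels (map_lt f t)"
  by (simp add: distinct_labels_def preorder_map_lt distinct_map set_preorder)

subsection \<open>Realising codes\<close>

text \<open>The set \<open>A\<close> of forbidden labels grows with each branch built, which keeps
  the branches disjoint. Only nonempty branches are realised; \<open>code\<close> restores the
  others as padding.\<close>

lemma realise_branches:
  assumes "\<And>s A. s \<in># X \<Longrightarrow> s \<noteq> Emp \<Longrightarrow> finite A \<Longrightarrow>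
      \<exists>t :: nat lt. distinct_labels t \<and> arity_le d t \<and> code d t = s \<and> labels t \<inter> A = {}"
    and "finite A"
  shows "\<exists>ts :: nat lt list. mset (map (code d) ts) = filter_mset (\<lambda>s. s \<noteq> Emp) X \<and>
      distinct (concat (map preorder ts)) \<and> (\<forall>t\<in>set ts. arity_le d t \<and> labels t \<inter> A = {})"
  using assms
proof (induction X arbitrary: A)
  case (add s X)
  show ?case
  proof (cases "s = Emp")
    case True
    then show ?thesis using add.IH[of A] add.prems by simp
  next
    case False
    obtain t :: "nat lt" where t: "distinct_labels t" "arity_le d t" "code d t = s" "labels t \<inter> A = {}"
      using add.prems(1)[of s A] add.prems(2) False by auto
    obtain ts :: "nat lt list" where ts: "mset (map (code d) ts) = filter_mset (\<lambda>s. s \<noteq> Emp) X"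
      "distinct (concat (map preorder ts))" "\<forall>t'\<in>set ts. arity_le d t' \<and> labels t' \<inter> (A \<union> labels t) = {}"
      using add.IH[of "A \<union> labels t"] add.prems by auto
    have "distinct (concat (map preorder (t # ts)))"
      using t(1) ts(2,3) by (auto simp: distinct_labels_def set_preorder)
    then show ?thesis using t ts False by (intro exI[of _ "t # ts"]) auto
  qed
qed (auto intro: exI[of _ "[]"])

lemma Emp_padding: "filter_mset (\<lambda>s. s \<noteq> Emp) X + replicate_mset (size X - size (filter_mset (\<lambda>s. s \<noteq> Emp) X)) Emp = X"
proof -
  have X: "X = filter_mset (\<lambda>s. s \<noteq> Emp) X + filter_mset (\<lambda>s. s = Emp) X"
    using multiset_partition[of X "\<lambda>s. s \<noteq> Emp"] by simp
  have E: "filter_mset (\<lambda>s. s = Emp) X = replicate_mset (size (filter_mset (\<lambda>s. s = Emp) X)) Emp"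
    by (rule mset_eq_replicate) simp
  have "size X - size (filter_mset (\<lambda>s. s \<noteq> Emp) X) = size (filter_mset (\<lambda>s. s = Emp) X)"
    using arg_cong[OF X, of size] unfolding size_union by linarith
  then show ?thesis using X E by metis
qed

lemma realise_branch:
  "full d c \<Longrightarrow> c \<noteq> Emp \<Longrightarrow> finite A \<Longrightarrow>
    \<exists>t :: nat lt. distinct_labels t \<and> arity_le d t \<and> code d t = c \<and> labels t \<inter> A = {}"
proof (induction c arbitrary: A)
  case (Node X)
  obtain a :: nat where a: "a \<notin> A" using ex_new_if_finite[OF infinite_UNIV_nat Node.prems(3)] by blast
  have "\<exists>ts :: nat lt list. mset (map (code d) ts) = filter_mset (\<lambda>s. s \<noteq> Emp) X \<and>
      distinct (concat (map preorder ts)) \<and> (\<forall>t\<in>set ts. arity_le d t \<and> labels t \<inter> insert a A = {})"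
    using Node.IH Node.prems by (intro realise_branches) auto
  then obtain ts :: "nat lt list" where ts: "mset (map (code d) ts) = filter_mset (\<lambda>s. s \<noteq> Emp) X"
      "distinct (concat (map preorder ts))" "\<forall>t\<in>set ts. arity_le d t \<and> labels t \<inter> insert a A = {}"
    by blast
  have len: "length ts = size (filter_mset (\<lambda>s. s \<noteq> Emp) X)"
    using arg_cong[OF ts(1), of size] by simp
  have "size X = d" using Node.prems by simp
  then have "code d (LNode a ts) = Node X"
    using ts(1) len Emp_padding[of X] by (simp only: code.simps)
  moreover have "distinct_labels (LNode a ts)"
    using ts(2,3) by (auto simp: distinct_labels_def set_preorder)
  moreover have "arity_le d (LNode a ts)"
    using ts(3) len \<open>size X = d\<close> size_filter_mset_lesseq[of "\<lambda>s. s \<noteq> Emp" X] by simp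
  moreover have "labels (LNode a ts) \<inter> A = {}" using ts(3) a by auto
  ultimately show ?case by blast
qed simp

lemma realise_root:
  assumes "full_root d c"
  shows "\<exists>t :: nat lt. distinct_labels t \<and> root_arity_le d t \<and> root_code d t = c"
proof -
  obtain X where X: "c = Node X" "size X = Suc d" "\<forall>s\<in>#X. full d s"
    using assms by (auto simp: full_root_def)
  have "\<exists>ts :: nat lt list. mset (map (code d) ts) = filter_mset (\<lambda>s. s \<noteq> Emp) X \<and>
      distinct (concat (map preorder ts)) \<and> (\<forall>t\<in>set ts. arity_le d t \<and> labels t \<inter> {0} = {})"
    using realise_branch X by (intro realise_branches) auto
  then obtain ts :: "nat lt list" where ts: "mset (map (code d) ts) = filter_mset (\<lambda>s. s \<noteq> Emp) X"
      "distinct (concat (map preorder ts))" "\<forall>t\<in>set ts. arity_le d t \<and> labels t \<inter> {0} = {}"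
    by blast
  have len: "length ts = size (filter_mset (\<lambda>s. s \<noteq> Emp) X)"
    using arg_cong[OF ts(1), of size] by simp
  have "root_code d (LNode 0 ts) = c"
    using ts(1) len Emp_padding[of X] X by (simp only: root_code_def lt.sel)
  moreover have "distinct_labels (LNode 0 ts)"
    using ts(2,3) by (auto simp: distinct_labels_def set_preorder)
  moreover have "root_arity_le d (LNode 0 ts)"
    using ts(3) len X size_filter_mset_lesseq[of "\<lambda>s. s \<noteq> Emp" X] by (simp add: root_arity_le_def)
  ultimately show ?thesis by blast
qed

subsection \<open>Codes determine trees up to isomorphism\<close>

definition rooted_iso :: "'a lt \<Rightarrow> 'b lt \<Rightarrow> bool" where
  "rooted_iso t t' \<longleftrightarrow> (\<exists>f. bij_betw f (labels t) (labels t') \<and> f (lab t) = lab t' \<and>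
     (\<lambda>e. f ` e) ` ledges t = ledges t')"

lemma rooted_iso_imp_isomorphic: "rooted_iso t t' \<Longrightarrow> graph_isomorphic (graph_of t) (graph_of t')"
  by (auto simp: rooted_iso_def graph_isomorphic_def)

text \<open>The isomorphisms of the kids have disjoint domains and disjoint ranges and can be glued
  one kid at a time. Since they map roots to roots, the edges at \<open>a\<close> are preserved as
  well.\<close>

lemma rooted_iso_LNode:
  assumes "list_all2 rooted_iso ts ts'" "distinct_labels (LNode a ts)" "distinct_labels (LNode a' ts')"
  shows "rooted_iso (LNode a ts) (LNode a' ts')"
  using assms
proof (induction rule: list_all2_induct)
  case Nil
  show ?case unfolding rooted_iso_def by (intro exI[of _ "\<lambda>_. a'"]) (simp add: bij_betw_def)
next
  case (Cons s ts s' ts')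
  let ?t = "LNode a ts" let ?t' = "LNode a' ts'"
  have ds: "labels s \<inter> labels ?t = {}" "labels s' \<inter> labels ?t' = {}"
    using Cons.prems by (auto simp: distinct_labels_Cons)
  obtain f where f: "bij_betw f (labels ?t) (labels ?t')" "f a = a'" "(\<lambda>e. f ` e) ` ledges ?t = ledges ?t'"
    using Cons.IH Cons.prems by (auto simp: distinct_labels_Cons rooted_iso_def)
  obtain g where g: "bij_betw g (labels s) (labels s')" "g (lab s) = lab s'" "(\<lambda>e. g ` e) ` ledges s = ledges s'"
    using Cons.hyps(1) by (auto simp: rooted_iso_def)
  define h where "h v = (if v \<in> labels s then g v else f v)" for v
  have hs: "h v = g v" if "v \<in> labels s" for v using that by (simp add: h_def)
  have ht: "h v = f v" if "v \<in> labels ?t" for v using that ds by (auto simp: h_def simp del: labels.simps)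
  have "bij_betw h (labels s \<union> labels ?t) (labels s' \<union> labels ?t')"
    using bij_betw_combine[OF _ _ ds(2)] f(1) g(1) hs ht bij_betw_cong[of "labels s" h g] bij_betw_cong[of "labels ?t" h f]
    by metis
  moreover have "labels (LNode a (s # ts)) = labels s \<union> labels ?t" "labels (LNode a' (s' # ts')) = labels s' \<union> labels ?t'"
    by auto
  moreover have ha: "h a = a'" using ht[of a] f(2) by simp
  moreover have "(\<lambda>e. h ` e) ` ledges s = ledges s'"
    unfolding g(3)[symmetric] using hs ledges_subset[of _ s] by (intro image_cong refl) blast
  moreover have "(\<lambda>e. h ` e) ` ledges ?t = ledges ?t'"
    unfolding f(3)[symmetric] using ht ledges_subset[of _ ?t] by (intro image_cong refl) blast
  moreover have "h ` {a, lab s} = {a', lab s'}" using ha hs[of "lab s"] g(2) by simp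
  moreover have "ledges (LNode a (s # ts)) = insert {a, lab s} (ledges s \<union> ledges ?t)"
      "ledges (LNode a' (s' # ts')) = insert {a', lab s'} (ledges s' \<union> ledges ?t')" by auto
  ultimately show ?case unfolding rooted_iso_def
    by (intro exI[of _ h]) (simp del: labels.simps ledges.simps add: image_Un)
qed

text \<open>Kids have equal codes only as multisets; a permutation of one list brings kids with
  equal codes to equal positions.\<close>

lemma map_permute:
  "mset (map f xs) = mset (map g ys) \<Longrightarrow> \<exists>zs. mset zs = mset ys \<and> map f xs = map g zs"
proof (induction xs arbitrary: ys)
  case (Cons x xs)
  have "f x \<in># mset (map g ys)" unfolding Cons.prems[symmetric] by simp
  then obtain y where y: "y \<in> set ys" "g y = f x" by auto
  then obtain us vs where ys: "ys = us @ y # vs" by (meson split_list)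
  then have "mset (map f xs) = mset (map g (us @ vs))" using Cons.prems y by simp
  then obtain zs where "mset zs = mset (us @ vs)" "map f xs = map g zs" using Cons.IH by blast
  then show ?case using y ys by (intro exI[of _ "y # zs"]) simp
qed auto

lemma mset_concat_map: "mset (concat (map f xs)) = (\<Sum>x\<in>#mset xs. mset (f x))"
  by (induction xs) auto

lemma permuted_kids:
  assumes "mset zs = mset ys"
  shows "labels (LNode a zs) = labels (LNode a ys)" "ledges (LNode a zs) = ledges (LNode a ys)"
    "distinct_labels (LNode a zs) \<longleftrightarrow> distinct_labels (LNode a ys)"
proof -
  have set: "set zs = set ys" using assms by (metis set_mset_mset)
  then show "labels (LNode a zs) = labels (LNode a ys)" "ledges (LNode a zs) = ledges (LNode a ys)" by auto
  have "mset (preorder (LNode a zs)) = mset (preorder (LNode a ys))"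
    using assms by (simp add: mset_concat_map)
  then show "distinct_labels (LNode a zs) \<longleftrightarrow> distinct_labels (LNode a ys)"
    unfolding distinct_labels_def by (rule mset_eq_imp_distinct_iff)
qed

lemma rooted_iso_if_kids:
  fixes ts :: "'a lt list" and ts' :: "'b lt list"
  assumes iso: "\<And>s (s' :: 'b lt). s \<in> set ts \<Longrightarrow> distinct_labels s \<Longrightarrow> distinct_labels s' \<Longrightarrow> code d s = code d s' \<Longrightarrow> rooted_iso s s'"
    and d: "distinct_labels (LNode a ts)" "distinct_labels (LNode a' ts')"
    and eq: "mset (map (code d) ts) = mset (map (code d) ts')"
  shows "rooted_iso (LNode a ts) (LNode a' ts')"
proof -
  obtain zs where zs: "mset zs = mset ts'" "map (code d) ts = map (code d) zs"
    using map_permute[OF eq] by blast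
  note perm = permuted_kids[OF zs(1), of a']
  have dz: "distinct_labels (LNode a' zs)" using perm(3) d(2) by blast
  have len: "length ts = length zs" using zs(2) by (metis length_map)
  have "rooted_iso (ts ! i) (zs ! i)" if i: "i < length ts" for i
  proof (rule iso)
    show "ts ! i \<in> set ts" using i by simp
    show "distinct_labels (ts ! i)" using distinct_labels_kid[OF d(1)] i by simp
    show "distinct_labels (zs ! i)" using distinct_labels_kid[OF dz] i len by simp
    show "code d (ts ! i) = code d (zs ! i)" using zs(2) i len by (metis nth_map)
  qed
  then have "list_all2 rooted_iso ts zs" using len by (simp add: list_all2_conv_all_nth)
  from rooted_iso_LNode[OF this d(1) dz] show ?thesis
    unfolding rooted_iso_def perm(1,2) lt.sel .
qed

lemma filter_codes: "filter_mset (\<lambda>s. s \<noteq> Emp) (mset (map (code d) ts)) = mset (map (code d) ts)"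
  by (induction ts) auto

lemma filter_replicate_Emp: "filter_mset (\<lambda>s. s \<noteq> Emp) (replicate_mset m Emp) = {#}"
  by (induction m) auto

text \<open>No code is \<open>Emp\<close>, so discarding \<open>Emp\<close> removes exactly the
  padding on both sides.\<close>

lemma padded_eq:
  assumes "mset (map (code d) ts) + replicate_mset m Emp = mset (map (code d) ts') + replicate_mset m' Emp"
  shows "mset (map (code d) ts) = mset (map (code d) ts')"
  using arg_cong[OF assms, of "filter_mset (\<lambda>s. s \<noteq> Emp)"]
  by (simp only: filter_union_mset filter_codes filter_replicate_Emp add_0_right)

lemma code_eq_imp_iso:
  "distinct_labels t \<Longrightarrow> distinct_labels t' \<Longrightarrow> code d t = code d t' \<Longrightarrow> rooted_iso t t'"
proof (induction t arbitrary: t')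
  case (LNode a ts)
  obtain a' ts' where t': "t' = LNode a' ts'" by (cases t')
  have "mset (map (code d) ts) = mset (map (code d) ts')"
    by (rule padded_eq) (use LNode.prems(3) t' in simp)
  then show ?case using rooted_iso_if_kids[of ts d a a' ts'] LNode t' by blast
qed

lemma root_code_eq_imp_iso:
  assumes "distinct_labels t" "distinct_labels t'" "root_code d t = root_code d t'"
  shows "graph_isomorphic (graph_of t) (graph_of t')"
proof -
  obtain a ts where t: "t = LNode a ts" by (cases t)
  obtain a' ts' where t': "t' = LNode a' ts'" by (cases t')
  have "mset (map (code d) ts) = mset (map (code d) ts')"
    by (rule padded_eq) (use assms(3) t t' in \<open>simp add: root_code_def\<close>)
  then have "rooted_iso t t'" using rooted_iso_if_kids[of ts d a a' ts'] code_eq_imp_iso assms t t' by blast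
  then show ?thesis by (rule rooted_iso_imp_isomorphic)
qed

section \<open>Matchings of subdivisions\<close>

text \<open>Only edges matter for matchings, so a vertex is deleted by dropping the edges at it, and
  isolated vertices need no bookkeeping.\<close>

definition edge_gf :: "real \<Rightarrow> 'a set set \<Rightarrow> real" where
  "edge_gf x E = (\<Sum>F | F \<subseteq> E \<and> pairwise disjnt F. x ^ card F)"

lemma matching_gf_edge_gf:
  assumes "finite (gedges G)"
  shows "matching_gf G x = edge_gf x (gedges G)"
proof -
  let ?E = "gedges G"
  let ?M = "{F. F \<subseteq> ?E \<and> pairwise disjnt F}"
  have fin: "finite ?M" using assms by (auto intro: finite_subset[of _ "Pow ?E"])
  have le: "card F \<in> {..card ?E}" if "F \<in> ?M" for F using that assms card_mono by auto
  have "edge_gf x ?E = (\<Sum>k\<le>card ?E. \<Sum>F | F \<in> ?M \<and> card F = k. x ^ card F)"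
    unfolding edge_gf_def by (rule sum.group[symmetric]) (use fin le in auto)
  also have "\<dots> = (\<Sum>k\<le>card ?E. real (card (matchings G k)) * x ^ k)"
  proof (rule sum.cong[OF refl])
    fix k
    have "{F. F \<in> ?M \<and> card F = k} = matchings G k" by (auto simp: matchings_def)
    then show "(\<Sum>F | F \<in> ?M \<and> card F = k. x ^ card F) = real (card (matchings G k)) * x ^ k"
      by (metis (mono_tags, lifting) mem_Collect_eq sum.cong sum_constant)
  qed
  finally show ?thesis by (simp add: matching_gf_def)
qed

lemma edge_gf_empty [simp]: "edge_gf x {} = 1"
proof -
  have "{F :: 'a set set. F \<subseteq> {} \<and> pairwise disjnt F} = {{}}" by auto
  then show ?thesis unfolding edge_gf_def by simp
qed

text \<open>A matching of two parts without a common vertex is a pair of matchings. The empty set is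
  kept out of \<open>A\<close> because \<open>disj\<close> would allow it to belong to both
  parts.\<close>

lemma edge_gf_Un:
  assumes fin: "finite A" "finite B" and disj: "\<Union>A \<inter> \<Union>B = {}" and ne: "{} \<notin> A"
  shows "edge_gf x (A \<union> B) = edge_gf x A * edge_gf x B"
proof -
  let ?M = "\<lambda>E. {F. F \<subseteq> E \<and> pairwise disjnt F}"
  have AB: "A \<inter> B = {}"
  proof (rule ccontr)
    assume "A \<inter> B \<noteq> {}"
    then obtain e where "e \<in> A" "e \<in> B" by blast
    moreover from this have "e = {}" using disj by blast
    ultimately show False using ne by simp
  qed
  have cross: "disjnt e f" if "e \<in> A" "f \<in> B" for e f using that disj by (auto simp: disjnt_def)
  have bij: "bij_betw (\<lambda>(F1, F2). F1 \<union> F2) (?M A \<times> ?M B) (?M (A \<union> B))"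
  proof (rule bij_betw_byWitness[where f' = "\<lambda>F. (F \<inter> A, F \<inter> B)"])
    show "\<forall>p\<in>?M A \<times> ?M B. ((case p of (F1, F2) \<Rightarrow> F1 \<union> F2) \<inter> A, (case p of (F1, F2) \<Rightarrow> F1 \<union> F2) \<inter> B) = p"
      using AB by auto
    show "\<forall>F\<in>?M (A \<union> B). (case (F \<inter> A, F \<inter> B) of (F1, F2) \<Rightarrow> F1 \<union> F2) = F" by auto
    show "(\<lambda>(F1, F2). F1 \<union> F2) ` (?M A \<times> ?M B) \<subseteq> ?M (A \<union> B)"
    proof (clarsimp, intro conjI)
      fix F1 F2 assume F: "F1 \<subseteq> A" "pairwise disjnt F1" "F2 \<subseteq> B" "pairwise disjnt F2"
      show "F1 \<subseteq> A \<union> B" "F2 \<subseteq> A \<union> B" using F by auto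
      show "pairwise disjnt (F1 \<union> F2)" unfolding pairwise_def
      proof (intro ballI impI)
        fix e f assume ef: "e \<in> F1 \<union> F2" "f \<in> F1 \<union> F2" "e \<noteq> f"
        consider "e \<in> F1" "f \<in> F1" | "e \<in> F2" "f \<in> F2" | "e \<in> F1" "f \<in> F2" | "e \<in> F2" "f \<in> F1"
          using ef by blast
        then show "disjnt e f"
        proof cases
          case 3 then show ?thesis using cross F by blast
        next
          case 4 then show ?thesis using cross[of f e] F disjnt_sym by blast
        qed (use F ef in \<open>auto simp: pairwise_def\<close>)
      qed
    qed
    show "(\<lambda>F. (F \<inter> A, F \<inter> B)) ` ?M (A \<union> B) \<subseteq> ?M A \<times> ?M B" by (auto simp: pairwise_def)
  qed
  have "edge_gf x (A \<union> B) = (\<Sum>(F1, F2)\<in>?M A \<times> ?M B. x ^ card (F1 \<union> F2))"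
    unfolding edge_gf_def sum.reindex_bij_betw[OF bij, symmetric] by (simp add: case_prod_unfold)
  also have "\<dots> = (\<Sum>(F1, F2)\<in>?M A \<times> ?M B. x ^ card F1 * x ^ card F2)"
  proof (intro sum.cong refl, clarify)
    fix F1 F2 assume F: "F1 \<subseteq> A" "F2 \<subseteq> B"
    then have "finite F1" "finite F2" "F1 \<inter> F2 = {}" using fin AB finite_subset by blast+
    then show "x ^ card (F1 \<union> F2) = x ^ card F1 * x ^ card F2" by (simp add: card_Un_disjoint power_add)
  qed
  also have "\<dots> = edge_gf x A * edge_gf x B"
    by (simp add: edge_gf_def sum_product sum.cartesian_product)
  finally show ?thesis .
qed

lemma edge_gf_insert:
  assumes fin: "finite E" and e: "e \<notin> E"
  shows "edge_gf x (insert e E) = edge_gf x E + x * edge_gf x {f \<in> E. disjnt e f}"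
proof -
  let ?M = "\<lambda>E. {F. F \<subseteq> E \<and> pairwise disjnt F}"
  let ?D = "{f \<in> E. disjnt e f}"
  have fin': "finite (?M E)" "finite (?M ?D)" using fin by (auto intro: finite_subset[of _ "Pow E"])
  have split: "?M (insert e E) = ?M E \<union> insert e ` ?M ?D"
  proof (intro equalityI subsetI)
    fix F assume F: "F \<in> ?M (insert e E)"
    show "F \<in> ?M E \<union> insert e ` ?M ?D"
    proof (cases "e \<in> F")
      case True
      have "f \<in> ?D" if "f \<in> F - {e}" for f
        using that F True unfolding pairwise_def by auto
      then have "F - {e} \<in> ?M ?D" using F by (auto simp: pairwise_def)
      moreover have "F = insert e (F - {e})" using True by blast
      ultimately show ?thesis by blast
    qed (use F in auto)
  next
    fix F assume "F \<in> ?M E \<union> insert e ` ?M ?D"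
    then show "F \<in> ?M (insert e E)"
      by (auto simp: pairwise_insert disjnt_sym) (auto simp: subset_iff disjnt_sym)
  qed
  have "?M E \<inter> insert e ` ?M ?D = {}" using e by auto
  then have "edge_gf x (insert e E) = edge_gf x E + (\<Sum>F\<in>insert e ` ?M ?D. x ^ card F)"
    unfolding edge_gf_def split using fin' by (simp add: sum.union_disjoint)
  also have "(\<Sum>F\<in>insert e ` ?M ?D. x ^ card F) = (\<Sum>F\<in>?M ?D. x ^ card (insert e F))"
    by (rule sum.reindex_cong[of "insert e"]) (use e in \<open>auto simp: inj_on_def insert_ident subset_iff\<close>)
  also have "\<dots> = (\<Sum>F\<in>?M ?D. x * x ^ card F)"
  proof (intro sum.cong refl)
    fix F assume "F \<in> ?M ?D"
    then have "finite F" "e \<notin> F" using e finite_subset[of F E] fin by auto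
    then show "x ^ card (insert e F) = x * x ^ card F" by simp
  qed
  finally show ?thesis by (simp add: edge_gf_def sum_distrib_left)
qed

section \<open>Edges of subdivided trees\<close>

definition sub_edges :: "'a set set \<Rightarrow> ('a + 'a set) set set" where
  "sub_edges E = {{Inl v, Inr e} | v e. e \<in> E \<and> v \<in> e}"

lemma gedges_subdivision: "gedges (subdivision_graph G) = sub_edges (gedges G)"
  by (simp add: subdivision_graph_def sub_edges_def)

lemma sub_edges_Un: "sub_edges (A \<union> B) = sub_edges A \<union> sub_edges B"
  by (auto simp: sub_edges_def)

lemma sub_edges_doubleton: "sub_edges {{u, v}} = {{Inl u, Inr {u, v}}, {Inl v, Inr {u, v}}}"
  by (auto simp: sub_edges_def)

lemma sub_edges_empty [simp]: "sub_edges {} = {}"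
  by (simp add: sub_edges_def)

lemma Union_sub_edges: "\<Union>(sub_edges E) \<subseteq> Inl ` \<Union>E \<union> Inr ` E"
  by (auto simp: sub_edges_def)

lemma sub_edges_nonempty: "{} \<notin> sub_edges E"
  by (auto simp: sub_edges_def)

lemma finite_sub_edges:
  assumes "finite E" "\<And>e. e \<in> E \<Longrightarrow> finite e"
  shows "finite (sub_edges E)"
proof -
  have "sub_edges E = (\<lambda>(e, v). {Inl v, Inr e}) ` (SIGMA e:E. e)" by (auto simp: sub_edges_def)
  then show ?thesis using assms by simp
qed

lemma finite_sub_ledges: "finite (sub_edges (ledges t))"
  using finite_sub_edges finite_ledges ledges_subset finite_labels finite_subset by metis

context network begin

text \<open>The version with the root deleted is needed as well, because matching the root of a
  branch with the new vertex above it deletes that root. The kids are attached one at a time. The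
  padding number \<open>k\<close> is arbitrary: \<open>Emp\<close> adds 0 to \<open>csum\<close> and
  the factor 1 to \<open>wprod\<close>.\<close>

lemma edge_gf_ledges:
  "distinct_labels t \<Longrightarrow>
    edge_gf x (sub_edges (ledges t)) = gf (code k t) \<and>
    edge_gf x {f \<in> sub_edges (ledges t). Inl (lab t) \<notin> f} = wprod (mset (map (code k) (kids t)))"
proof (induction t)
  case (LNode a ts)
  have "distinct_labels (LNode a ts) \<Longrightarrow>
     edge_gf x (sub_edges (ledges (LNode a ts))) =
       (1 + csum (mset (map (code k) ts))) * wprod (mset (map (code k) ts)) \<and>
     edge_gf x {f \<in> sub_edges (ledges (LNode a ts)). Inl a \<notin> f} = wprod (mset (map (code k) ts))"
    using LNode.IH
  proof (induction ts)
    case (Cons s ts)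
    let ?t = "LNode a ts"
    have d: "distinct_labels s" "distinct_labels ?t" "labels s \<inter> labels ?t = {}"
      using Cons.prems(1) by (auto simp: distinct_labels_Cons)
    define W where "W = wprod (mset (map (code k) ts))"
    define A where "A = sub_edges (ledges ?t)"
    define A' where "A' = {f \<in> A. Inl a \<notin> f}"
    define B where "B = sub_edges (ledges s)"
    let ?e = "{a, lab s}"
    let ?p = "{Inl (lab s), Inr ?e}" let ?r = "{Inl a, Inr ?e}"
    let ?P = "insert ?p B"
    have IH: "edge_gf x A = (1 + csum (mset (map (code k) ts))) * W" "edge_gf x A' = W"
      using Cons.IH[OF d(2)] Cons.prems(2) unfolding A_def A'_def W_def by auto
    have val_s: "edge_gf x B = gf (code k s)"
      "edge_gf x {f \<in> B. Inl (lab s) \<notin> f} = wprod (mset (map (code k) (kids s)))"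
      using Cons.prems(2)[of s] d(1) unfolding B_def by auto
    have a: "a \<notin> labels s" and ls: "lab s \<notin> labels ?t"
      using d(3) lab_in_labels[of s] lab_in_labels[of ?t] unfolding lt.sel by blast+
    have UA: "\<Union>A \<subseteq> Inl ` labels ?t \<union> Inr ` ledges ?t" "\<Union>B \<subseteq> Inl ` labels s \<union> Inr ` ledges s"
      unfolding A_def B_def using Union_sub_edges[of "ledges ?t"] Union_sub_edges[of "ledges s"]
        ledges_subset[of _ ?t] ledges_subset[of _ s] by blast+
    have e: "?e \<notin> ledges ?t" "?e \<notin> ledges s" "ledges ?t \<inter> ledges s = {}"
    proof -
      show "?e \<notin> ledges ?t" using ledges_subset[of ?e ?t] ls by blast
      show "?e \<notin> ledges s" using ledges_subset[of ?e s] a by blast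
      show "ledges ?t \<inter> ledges s = {}"
      proof (rule ccontr)
        assume "ledges ?t \<inter> ledges s \<noteq> {}"
        then obtain f where f: "f \<in> ledges ?t" "f \<in> ledges s" by blast
        have "f = {}" using ledges_subset[OF f(1)] ledges_subset[OF f(2)] d(3) by blast
        then show False using ledges_nonempty[OF f(2)] by simp
      qed
    qed
    have disj: "\<Union>A \<inter> \<Union>?P = {}"
    proof -
      have "\<Union>?P \<subseteq> Inl ` labels s \<union> Inr ` insert ?e (ledges s)" using UA(2) lab_in_labels[of s] by auto
      moreover have "(Inl ` labels ?t \<union> Inr ` ledges ?t) \<inter> (Inl ` labels s \<union> Inr ` insert ?e (ledges s)) = {}"
        using e d(3) by (auto simp del: labels.simps ledges.simps)
      ultimately show ?thesis using Int_mono[OF UA(1)] by (metis subset_empty)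
    qed
    have fin: "finite A" "finite B" unfolding A_def B_def by (rule finite_sub_ledges)+
    have ne: "{} \<notin> A" unfolding A_def by (rule sub_edges_nonempty)
    have "ledges (LNode a (s # ts)) = ledges ?t \<union> ledges s \<union> {?e}" by auto
    then have total: "sub_edges (ledges (LNode a (s # ts))) = insert ?r (A \<union> ?P)"
      unfolding A_def B_def sub_edges_Un by (simp only: sub_edges_Un sub_edges_doubleton) blast
    have Inr_e: "Inr ?e \<notin> \<Union>A" "Inr ?e \<notin> \<Union>B" using UA e by auto
    have Inl_a: "Inl a \<notin> \<Union>B" using UA a by auto
    have P: "edge_gf x ?P = weight (code k s)"
    proof -
      obtain b us where s: "s = LNode b us" by (cases s)
      have "?p \<notin> B" using Inr_e by auto
      moreover have "{f \<in> B. disjnt ?p f} = {f \<in> B. Inl (lab s) \<notin> f}" using Inr_e by (auto simp: disjnt_def)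
      ultimately have "edge_gf x ?P = gf (code k s) + x * wprod (mset (map (code k) (kids s)))"
        using edge_gf_insert[OF fin(2), of ?p x] val_s by simp
      then show ?thesis unfolding s by (simp add: weight_Node gf_Node algebra_simps del: gf.simps(2) weight.simps(2) val.simps(2))
    qed
    \<comment> \<open>If the upper half \<open>?r\<close> is used, the lower half is blocked and the
      branch counts with \<open>gf\<close> instead of \<open>weight\<close>. This ratio times
      \<open>x\<close> is the contribution of the branch to the conductance of the root.\<close>
    have par: "x * gf (code k s) = par (val (code k s)) * weight (code k s)"
    proof -
      obtain Y where Y: "code k s = Node Y" by (cases s) simp
      have "par (1 + csum Y) * (1 + csum Y + x) = x * (1 + csum Y)"
        using csum_nonneg[of Y] x_pos by (simp add: par_def)
      then show ?thesis unfolding Y weight_Node gf_Node val_Node by (simp only: mult.assoc[symmetric])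
    qed
    have r: "?r \<notin> A \<union> ?P" using Inr_e Inl_a a lab_in_labels[of s] by (auto simp: doubleton_eq_iff)
    have "{f \<in> A \<union> ?P. disjnt ?r f} = A' \<union> B"
      using Inr_e Inl_a by (auto simp: disjnt_def A'_def)
    moreover have "edge_gf x (A' \<union> B) = edge_gf x A' * edge_gf x B"
      by (rule edge_gf_Un) (use fin disj ne in \<open>auto simp: A'_def\<close>)
    moreover have "edge_gf x (A \<union> ?P) = edge_gf x A * edge_gf x ?P"
      by (rule edge_gf_Un) (use fin disj ne in auto)
    ultimately have "edge_gf x (sub_edges (ledges (LNode a (s # ts)))) =
        edge_gf x A * weight (code k s) + x * (W * gf (code k s))"
      unfolding total using edge_gf_insert[of "A \<union> ?P" ?r x] fin r P IH val_s by simp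
    also have "x * (W * gf (code k s)) = W * (par (val (code k s)) * weight (code k s))"
      using par by (simp add: mult_ac)
    finally have 1: "edge_gf x (sub_edges (ledges (LNode a (s # ts)))) =
       (1 + csum (mset (map (code k) (s # ts)))) * wprod (mset (map (code k) (s # ts)))"
      unfolding IH by (simp add: algebra_simps W_def)
    have "lab s \<noteq> a" using a lab_in_labels[of s] by metis
    then have "{f \<in> sub_edges (ledges (LNode a (s # ts))). Inl a \<notin> f} = A' \<union> ?P"
      unfolding total using Inl_a by (auto simp: A'_def)
    moreover have "edge_gf x (A' \<union> ?P) = edge_gf x A' * edge_gf x ?P"
      by (rule edge_gf_Un) (use fin disj ne in \<open>auto simp: A'_def\<close>)
    ultimately have "edge_gf x {f \<in> sub_edges (ledges (LNode a (s # ts))). Inl a \<notin> f} =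
      wprod (mset (map (code k) (s # ts)))"
      using P IH(2) by (simp add: W_def)
    with 1 show ?case by blast
  qed simp
  then show ?case using LNode.prems by (simp add: gf_Node del: gf.simps(2))
qed

lemma gf_root_code: "gf (root_code k t) = gf (code k t)"
  by (cases t) (simp add: root_code_def gf_Node del: gf.simps(2))

lemma matching_gf_subdivision:
  assumes "distinct_labels t"
  shows "matching_gf (subdivision_graph (graph_of t)) x = gf (root_code k t)"
proof -
  have "finite (gedges (subdivision_graph (graph_of t)))"
    by (simp add: gedges_subdivision finite_sub_ledges)
  from matching_gf_edge_gf[OF this, of x] show ?thesis using edge_gf_ledges[OF assms, of k]
    by (simp add: gedges_subdivision gf_root_code)
qed

end

section \<open>Greedy trees\<close>

lemma subtree_LNode:
  "subtree (LNode a ts) k u \<longleftrightarrow>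
     (k = 0 \<and> u = LNode a ts) \<or> (\<exists>l. k = Suc l \<and> (\<exists>s\<in>set ts. subtree s l u))"
  by (subst subtree.simps) auto

lemma all_subtrees_LNode:
  "(\<forall>k u. subtree (LNode a ts) k u \<longrightarrow> P k u) \<longleftrightarrow>
     P 0 (LNode a ts) \<and> (\<forall>s\<in>set ts. \<forall>k u. subtree s k u \<longrightarrow> P (Suc k) u)"
  unfolding subtree_LNode by blast

lemma subtree_0 [simp]: "subtree t 0 u \<longleftrightarrow> u = t"
  by (cases t) (auto simp: subtree_LNode)

lemma ball_labels_iff: "(\<forall>v\<in>labels t. P v) \<longleftrightarrow> (\<forall>k u. subtree t k u \<longrightarrow> P (lab u))"
proof
  assume L: "\<forall>v\<in>labels t. P v"
  show "\<forall>k u. subtree t k u \<longrightarrow> P (lab u)"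
  proof (intro allI impI)
    fix k u assume "subtree t k u"
    then have "lab u \<in> labels t" using subtree_labels[of t k u] lab_in_labels[of u] by blast
    then show "P (lab u)" using L by blast
  qed
next
  assume R: "\<forall>k u. subtree t k u \<longrightarrow> P (lab u)"
  show "\<forall>v\<in>labels t. P v"
  proof
    fix v assume "v \<in> labels t"
    from subtree_of_label[OF this] obtain k u where "subtree t k u" "lab u = v" by blast
    then show "P v" using R by blast
  qed
qed

text \<open>The index is shifted because \<open>ctree d 0\<close> is the empty branch: in
  \<open>ctree d (Suc h)\<close> the leaves have depth \<open>h\<close> and the padding depth
  \<open>Suc h\<close>.\<close>

lemma code_eq_ctree_iff:
  assumes d: "d > 0"
  shows "code d t = ctree d (Suc h) \<longleftrightarrow>
    (\<forall>k u. subtree t k u \<longrightarrow> (kids u = [] \<or> length (kids u) = d) \<and> (kids u = [] \<longrightarrow> k = h))"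
proof (induction t arbitrary: h)
  case (LNode a ts)
  \<comment> \<open>Leaves exist in every branch, so the right-hand side fails for
    \<open>h = 0\<close> as soon as the root has a kid.\<close>
  have leaf: "\<exists>k u. subtree t k u \<and> kids u = []" for t :: "'a lt"
  proof (induction t)
    case (LNode a ts)
    then show ?case by (cases ts) (auto simp: subtree_LNode, blast)
  qed
  have R: "(\<forall>k u. subtree (LNode a ts) k u \<longrightarrow> (kids u = [] \<or> length (kids u) = d) \<and> (kids u = [] \<longrightarrow> k = h)) \<longleftrightarrow>
      (ts = [] \<or> length ts = d) \<and> (ts = [] \<longrightarrow> h = 0) \<and>
      (\<forall>s\<in>set ts. \<forall>l u. subtree s l u \<longrightarrow> (kids u = [] \<or> length (kids u) = d) \<and> (kids u = [] \<longrightarrow> Suc l = h))"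
    unfolding all_subtrees_LNode lt.sel by auto
  show ?case
  proof (cases "ts = []")
    case True
    have "replicate_mset d Emp = replicate_mset d (ctree d h) \<longleftrightarrow> h = 0"
      using d by (cases h) (auto simp: replicate_mset_eq_iff)
    then show ?thesis unfolding R using True by auto
  next
    case False
    then obtain s0 where s0: "s0 \<in> set ts" by (cases ts) auto
    show ?thesis
    proof (cases h)
      case 0
      have "code d (LNode a ts) \<noteq> ctree d (Suc h)"
      proof
        assume "code d (LNode a ts) = ctree d (Suc h)"
        then have "mset (map (code d) ts) + replicate_mset (d - length ts) Emp = replicate_mset d Emp" using 0 by simp
        moreover have "code d s0 \<in># mset (map (code d) ts) + replicate_mset (d - length ts) Emp" using s0 by simp
        ultimately show False by (metis code_not_Emp(1) in_replicate_mset)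
      qed
      moreover have "\<not> (\<forall>l u. subtree s0 l u \<longrightarrow> (kids u = [] \<longrightarrow> Suc l = h))" using leaf[of s0] 0 by auto
      ultimately show ?thesis unfolding R using s0 by blast
    next
      case (Suc h')
      have "code d (LNode a ts) = ctree d (Suc h) \<longleftrightarrow> length ts = d \<and> (\<forall>s\<in>set ts. code d s = ctree d h)"
      proof
        assume "code d (LNode a ts) = ctree d (Suc h)"
        then have eq: "mset (map (code d) ts) + replicate_mset (d - length ts) Emp = replicate_mset d (ctree d h)" by simp
        have "Emp \<notin># replicate_mset d (ctree d h)" using Suc by simp
        then have "d \<le> length ts" unfolding eq[symmetric] by auto
        moreover have "length ts + (d - length ts) = d" using arg_cong[OF eq, of size] by simp
        ultimately have len: "length ts = d" by simp
        moreover have "code d s = ctree d h" if "s \<in> set ts" for s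
        proof -
          have "code d s \<in># replicate_mset d (ctree d h)" using that unfolding eq[symmetric] by simp
          then show ?thesis by (metis in_replicate_mset)
        qed
        ultimately show "length ts = d \<and> (\<forall>s\<in>set ts. code d s = ctree d h)" by blast
      next
        assume *: "length ts = d \<and> (\<forall>s\<in>set ts. code d s = ctree d h)"
        have "mset (map (code d) ts) = replicate_mset (size (mset (map (code d) ts))) (ctree d h)"
          by (rule mset_eq_replicate) (use * in auto)
        with * show "code d (LNode a ts) = ctree d (Suc h)" by (simp del: mset_map)
      qed
      also have "\<dots> \<longleftrightarrow> length ts = d \<and> (\<forall>s\<in>set ts. \<forall>l u. subtree s l u \<longrightarrow>
          (kids u = [] \<or> length (kids u) = d) \<and> (kids u = [] \<longrightarrow> l = h'))"
        using LNode.IH[of _ h'] unfolding Suc by (simp del: ctree.simps)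
      finally show ?thesis unfolding R using False Suc by simp
    qed
  qed
qed

lemma complete_dary_tree_iff:
  assumes d: "d > 0" and t: "distinct_labels t"
  shows "complete_dary_tree d (Suc h) (graph_of t) (lab t) \<longleftrightarrow> code d t = ctree d (Suc h)"
proof -
  have kids: "children (graph_of t) (lab t) (lab u) = {} \<longleftrightarrow> kids u = []" if "subtree t k u" for k u
    using children_subtree[OF t that] by simp
  show ?thesis
    unfolding code_eq_ctree_iff[OF d] complete_dary_tree_def rooted_dary_tree_def rooted_tree_def
      gverts_graph_of ball_labels_iff
    using kids card_children_subtree[OF t] graph_dist_subtree[OF t] tree_graph_of[OF t] by auto
qed

lemma complete_dary_tree_ex:
  assumes d: "d > 0" and t: "distinct_labels t"
  shows "(\<exists>h. complete_dary_tree d h (graph_of t) (lab t)) \<longleftrightarrow> (\<exists>h. code d t = ctree d h)"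
proof
  assume "\<exists>h. complete_dary_tree d h (graph_of t) (lab t)"
  then obtain h where h: "complete_dary_tree d h (graph_of t) (lab t)" by blast
  then obtain k where "h = Suc k" by (cases h) (auto simp: complete_dary_tree_def)
  with h show "\<exists>h. code d t = ctree d h" using complete_dary_tree_iff[OF d t] by blast
next
  assume "\<exists>h. code d t = ctree d h"
  then obtain h where h: "code d t = ctree d h" by blast
  then obtain k where "h = Suc k" by (cases h) auto
  with h show "\<exists>h. complete_dary_tree d h (graph_of t) (lab t)" using complete_dary_tree_iff[OF d t] by blast
qed

text \<open>\<open>P\<close> may depend on the depth, because the root and the other vertices may
  have different numbers of kids.\<close>

lemma subtree_depths_LNode:
  "{Suc k | k u. subtree (LNode a ts) k u \<and> P k u} =
     Suc ` ((\<Union>s\<in>set ts. {Suc k | k u. subtree s k u \<and> P (Suc k) u}) \<union> (if P 0 (LNode a ts) then {0} else {}))"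
  (is "?L = ?R")
proof (intro equalityI subsetI)
  fix m assume "m \<in> ?L"
  then obtain k u where k: "m = Suc k" "subtree (LNode a ts) k u" "P k u" by blast
  show "m \<in> ?R"
  proof (cases k)
    case 0
    then show ?thesis using k by simp
  next
    case (Suc l)
    then obtain s where "s \<in> set ts" "subtree s l u" using k(2) by (auto simp: subtree_LNode)
    then have "k \<in> (\<Union>s\<in>set ts. {Suc k | k u. subtree s k u \<and> P (Suc k) u})" using k(3) Suc by blast
    then show ?thesis using k(1) by blast
  qed
next
  fix m assume "m \<in> ?R"
  then obtain k where k: "m = Suc k"
    "k \<in> (\<Union>s\<in>set ts. {Suc k | k u. subtree s k u \<and> P (Suc k) u}) \<or> (k = 0 \<and> P 0 (LNode a ts))"
    by (auto split: if_splits)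
  from k(2) show "m \<in> ?L"
  proof
    assume "k \<in> (\<Union>s\<in>set ts. {Suc k | k u. subtree s k u \<and> P (Suc k) u})"
    then obtain s l u where "s \<in> set ts" "k = Suc l" "subtree s l u" "P (Suc l) u" by blast
    then have "subtree (LNode a ts) k u" "P k u" using subtree_kid by auto
    then show ?thesis using k(1) by blast
  next
    assume "k = 0 \<and> P 0 (LNode a ts)"
    then show ?thesis using k(1) subtree_self by blast
  qed
qed

lemma edep_code:
  "edep (code d t) = {Suc k | k u. subtree t k u \<and> length (kids u) < d}"
proof (induction t)
  case (LNode a ts)
  have "edep (code d (LNode a ts)) = Suc ` ((\<Union>s\<in>set ts. edep (code d s)) \<union> (if length ts < d then {0} else {}))"
    by auto
  also have "\<dots> = {Suc k | k u. subtree (LNode a ts) k u \<and> length (kids u) < d}"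
    unfolding subtree_depths_LNode lt.sel using LNode by simp
  finally show ?case .
qed

text \<open>The root is padded to \<open>d + 1\<close> kids and any other vertex to \<open>d\<close>
  kids besides its parent, so in both cases a missing kid means degree below
  \<open>d + 1\<close>.\<close>

lemma edep_root_code:
  assumes t: "distinct_labels t"
  shows "edep (root_code d t) = {Suc k | k u. subtree t k u \<and> vertex_degree (graph_of t) (lab u) < d + 1}"
proof -
  obtain a ts where at: "t = LNode a ts" by (cases t)
  have "edep (root_code d t) = Suc ` ((\<Union>s\<in>set ts. edep (code d s)) \<union> (if length ts < Suc d then {0} else {}))"
    unfolding at root_code_def by auto
  also have "\<dots> = {Suc k | k u. subtree t k u \<and> length (kids u) + (if k = 0 then 0 else 1) < d + 1}"
    unfolding at subtree_depths_LNode edep_code lt.sel by simp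
  also have "\<dots> = {Suc k | k u. subtree t k u \<and> vertex_degree (graph_of t) (lab u) < d + 1}"
    using vertex_degree_subtree[OF _ t] by (intro Collect_cong) metis
  finally show ?thesis .
qed

lemma one_incomplete_Node_padded:
  "one_incomplete d (Node (mset cs + replicate_mset m Emp)) \<longleftrightarrow>
    length (filter (\<lambda>c. \<forall>h. c \<noteq> ctree d h) cs) \<le> 1 \<and> (\<forall>c\<in>set cs. one_incomplete d c)"
proof -
  have "\<exists>h. Emp = ctree d h" by (rule exI[of _ 0]) simp
  then have "filter_mset (\<lambda>c. \<forall>h. c \<noteq> ctree d h) (replicate_mset m Emp) = {#}"
    unfolding filter_mset_eq_mempty_iff by auto
  then have "filter_mset (\<lambda>c. \<forall>h. c \<noteq> ctree d h) (mset cs + replicate_mset m Emp) =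
      mset (filter (\<lambda>c. \<forall>h. c \<noteq> ctree d h) cs)"
    unfolding filter_union_mset mset_filter by (simp only: add_0_right)
  then show ?thesis by (auto simp del: mset_filter)
qed

lemma one_incomplete_code:
  "one_incomplete d (code d t) \<longleftrightarrow>
    (\<forall>k u. subtree t k u \<longrightarrow> length (filter (\<lambda>s. \<forall>h. code d s \<noteq> ctree d h) (kids u)) \<le> 1)"
proof (induction t)
  case (LNode a ts)
  show ?case unfolding code.simps one_incomplete_Node_padded all_subtrees_LNode lt.sel
    using LNode by (simp add: filter_map o_def)
qed

lemma one_incomplete_root_code:
  "one_incomplete d (root_code d t) \<longleftrightarrow>
    (\<forall>k u. subtree t k u \<longrightarrow> length (filter (\<lambda>s. \<forall>h. code d s \<noteq> ctree d h) (kids u)) \<le> 1)"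
proof (cases t)
  case (LNode a ts)
  show ?thesis unfolding root_code_def LNode one_incomplete_Node_padded all_subtrees_LNode lt.sel
    by (simp add: filter_map o_def one_incomplete_code)
qed

lemma subtree_trans: "subtree t k u \<Longrightarrow> subtree u l s \<Longrightarrow> subtree t (k + l) s"
  by (induction rule: subtree.induct) (auto simp: subtree_LNode)

lemma card_incomplete_children:
  assumes d: "d > 0" and t: "distinct_labels t" and u: "subtree t k u"
  shows "card {v \<in> children (graph_of t) (lab t) (lab u).
        \<not> (\<exists>h. complete_dary_tree d h (subtree_at (graph_of t) (lab t) v) v)} =
    length (filter (\<lambda>s. \<forall>h. code d s \<noteq> ctree d h) (kids u))"
proof -
  obtain b us where b: "u = LNode b us" by (cases u)
  have du: "distinct (kids u)" "inj_on lab (set (kids u))"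
    using subtree_distinct[OF u t] distinct_kids[of b us] inj_on_lab[of b us] unfolding b by simp_all
  have sub: "\<exists>l. subtree t l s" if "s \<in> set (kids u)" for s
  proof -
    have "subtree u (Suc 0) s" using that by (cases u) (auto simp: subtree_LNode)
    from subtree_trans[OF u this] show ?thesis by blast
  qed
  have 1: "{v \<in> lab ` set (kids u). \<not> (\<exists>h. complete_dary_tree d h (subtree_at (graph_of t) (lab t) v) v)} =
      lab ` {s \<in> set (kids u). \<forall>h. code d s \<noteq> ctree d h}"
  proof -
    have "(\<exists>h. complete_dary_tree d h (subtree_at (graph_of t) (lab t) (lab s)) (lab s)) \<longleftrightarrow> (\<exists>h. code d s = ctree d h)"
      if s: "s \<in> set (kids u)" for s
    proof -
      obtain l where l: "subtree t l s" using sub[OF s] by blast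
      show ?thesis unfolding subtree_at_subtree[OF t l]
        using complete_dary_tree_ex[OF d subtree_distinct[OF l t]] .
    qed
    then show ?thesis by auto
  qed
  have 2: "card (lab ` {s \<in> set (kids u). \<forall>h. code d s \<noteq> ctree d h}) = card {s \<in> set (kids u). \<forall>h. code d s \<noteq> ctree d h}"
    by (rule card_image) (rule inj_on_subset[OF du(2)], auto)
  have 3: "{s \<in> set (kids u). \<forall>h. code d s \<noteq> ctree d h} = set (filter (\<lambda>s. \<forall>h. code d s \<noteq> ctree d h) (kids u))"
    by auto
  have 4: "card (set (filter (\<lambda>s. \<forall>h. code d s \<noteq> ctree d h) (kids u))) = length (filter (\<lambda>s. \<forall>h. code d s \<noteq> ctree d h) (kids u))"
    by (rule distinct_card) (use du in simp)
  show ?thesis unfolding children_subtree[OF t u] 1 2 unfolding 3 by (rule 4)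
qed

section \<open>Degree bound and depth condition in terms of codes\<close>

lemma arity_le_iff: "arity_le d t \<longleftrightarrow> (\<forall>k u. subtree t k u \<longrightarrow> length (kids u) \<le> d)"
proof (induction t)
  case (LNode a ts)
  then show ?case unfolding all_subtrees_LNode lt.sel by auto
qed

lemma root_arity_le_iff:
  assumes t: "distinct_labels t"
  shows "root_arity_le d t \<longleftrightarrow> (\<forall>v\<in>labels t. vertex_degree (graph_of t) v \<le> Suc d)"
proof -
  have "root_arity_le d t \<longleftrightarrow> (\<forall>k u. subtree t k u \<longrightarrow> length (kids u) + (if k = 0 then 0 else 1) \<le> Suc d)"
    by (cases t) (auto simp: root_arity_le_def arity_le_iff all_subtrees_LNode)
  then show ?thesis unfolding ball_labels_iff using vertex_degree_subtree[OF _ t] by metis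
qed

lemma two_consecutive_iff:
  "(\<exists>h. D \<subseteq> {h, Suc h}) \<longleftrightarrow> (\<forall>a\<in>D. \<forall>b\<in>D. a \<le> b + (1::nat))"
proof
  assume R: "\<forall>a\<in>D. \<forall>b\<in>D. a \<le> b + 1"
  show "\<exists>h. D \<subseteq> {h, Suc h}"
  proof (cases "D = {}")
    case False
    then obtain m where m: "m \<in> D" "\<And>a. a \<in> D \<Longrightarrow> m \<le> a"
      using Inf_nat_def1[of D] cInf_lower[of _ D] by auto
    have "D \<subseteq> {m, Suc m}"
    proof
      fix a assume "a \<in> D"
      then have "m \<le> a" "a \<le> m + 1" using m R by auto
      then show "a \<in> {m, Suc m}" by auto
    qed
    then show ?thesis by blast
  qed simp
next
  assume "\<exists>h. D \<subseteq> {h, Suc h}"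
  then obtain h where "D \<subseteq> {h, Suc h}" ..
  then have "h \<le> a" "a \<le> h + 1" if "a \<in> D" for a using that by auto
  then show "\<forall>a\<in>D. \<forall>b\<in>D. a \<le> b + 1" by (meson add_le_mono1 order_trans)
qed

lemma max_degree_graph_of:
  "max_degree (graph_of t) = k \<longleftrightarrow>
    (\<forall>v\<in>labels t. vertex_degree (graph_of t) v \<le> k) \<and> (\<exists>v\<in>labels t. vertex_degree (graph_of t) v = k)"
  unfolding max_degree_def gverts_graph_of by (subst Max_eq_iff) auto

lemma depth_condition_iff:
  assumes t: "distinct_labels t"
  shows "(\<exists>h. edep (root_code d t) \<subseteq> {h, Suc h}) \<longleftrightarrow>
    (\<forall>u\<in>labels t. \<forall>v\<in>labels t. vertex_degree (graph_of t) u < d + 1 \<and> vertex_degree (graph_of t) v < d + 1 \<longrightarrow>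
        graph_dist (graph_of t) (lab t) u \<le> graph_dist (graph_of t) (lab t) v + 1)"
proof -
  let ?P = "\<lambda>u. vertex_degree (graph_of t) (lab u) < d + 1"
  have "(\<exists>h. edep (root_code d t) \<subseteq> {h, Suc h}) \<longleftrightarrow>
      (\<forall>k u. subtree t k u \<longrightarrow> (\<forall>l v. subtree t l v \<longrightarrow> ?P u \<and> ?P v \<longrightarrow> k \<le> l + 1))"
    unfolding two_consecutive_iff edep_root_code[OF t] by auto
  also have "\<dots> \<longleftrightarrow> (\<forall>k u. subtree t k u \<longrightarrow> (\<forall>l v. subtree t l v \<longrightarrow> ?P u \<and> ?P v \<longrightarrow>
      graph_dist (graph_of t) (lab t) (lab u) \<le> graph_dist (graph_of t) (lab t) (lab v) + 1))"
    using graph_dist_subtree[OF t] by simp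
  finally show ?thesis unfolding ball_labels_iff .
qed

lemma root_degree: "distinct_labels t \<Longrightarrow> vertex_degree (graph_of t) (lab t) = length (kids t)"
  using vertex_degree_subtree[OF subtree_self, of t] by simp

text \<open>\<open>root_arity_le\<close> bounds all degrees by \<open>d + 1\<close>, and a root
  without empty branches attains the bound; together they give \<open>max_degree\<close>.\<close>

lemma greedy_tree_graph_of:
  assumes d: "d > 0" and t: "distinct_labels t"
  shows "greedy_tree d n (graph_of t) (lab t) \<longleftrightarrow>
    root_arity_le d t \<and> greedy_code d (root_code d t) \<and> card (labels t) = n"
    (is "?L \<longleftrightarrow> ?R")
proof -
  have inc: "(\<forall>v\<in>labels t. card {u \<in> children (graph_of t) (lab t) v.
        \<not> (\<exists>h. complete_dary_tree d h (subtree_at (graph_of t) (lab t) u) u)} \<le> 1) \<longleftrightarrow>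
      one_incomplete d (root_code d t)"
    unfolding ball_labels_iff one_incomplete_root_code using card_incomplete_children[OF d t] by simp
  have root: "(\<exists>X. root_code d t = Node X \<and> Emp \<notin># X) \<longleftrightarrow> Suc d \<le> length (kids t)"
    unfolding root_code_def by (auto simp: image_iff)
  show ?thesis
  proof
    assume L: ?L
    have ar: "root_arity_le d t"
      using L unfolding root_arity_le_iff[OF t] greedy_tree_def max_degree_graph_of by simp
    have "Suc d \<le> length (kids t)" using L root_degree[OF t] by (simp add: greedy_tree_def)
    then show ?R using L ar full_root_code[OF ar] inc root depth_condition_iff[OF t, of d]
      unfolding greedy_code_def greedy_tree_def gverts_graph_of by blast
  next
    assume R: ?R
    have deg: "vertex_degree (graph_of t) (lab t) = d + 1"
      using R root root_degree[OF t] unfolding greedy_code_def root_arity_le_def by simp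
    have "max_degree (graph_of t) = d + 1"
      unfolding max_degree_graph_of using R deg lab_in_labels unfolding root_arity_le_iff[OF t] by auto
    moreover have D: "\<forall>u\<in>labels t. \<forall>v\<in>labels t. vertex_degree (graph_of t) u < d + 1 \<and> vertex_degree (graph_of t) v < d + 1 \<longrightarrow>
        graph_dist (graph_of t) (lab t) u \<le> graph_dist (graph_of t) (lab t) v + 1"
      using R depth_condition_iff[OF t, of d] unfolding greedy_code_def by blast
    moreover have "\<forall>u\<in>labels t. \<forall>v\<in>labels t. vertex_degree (graph_of t) u = 1 \<and> vertex_degree (graph_of t) v = 1 \<longrightarrow>
        graph_dist (graph_of t) (lab t) u \<le> graph_dist (graph_of t) (lab t) v + 1"
      using D d by simp
    ultimately show ?L using R inc deg tree_graph_of[OF t] lab_in_labels[of t]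
      unfolding greedy_code_def greedy_tree_def gverts_graph_of rooted_tree_def by blast
  qed
qed

text \<open>The counterpart of \<open>opt_reroot\<close> on labelled trees: the root moves to the
  kid with code \<open>Node Z\<close>, the old root becomes a kid with code \<open>Node W\<close>,
  and the graph is unchanged.\<close>

lemma reroot:
  assumes t: "distinct_labels t" and X: "root_code d t = Node (add_mset (Node Z) W)" "length (kids t) \<le> Suc d"
  obtains t' where "distinct_labels t'" "graph_of t' = graph_of t" "root_code d t' = Node (add_mset (Node W) Z)"
proof -
  obtain a ts where at: "t = LNode a ts" by (cases t)
  have eq: "mset (map (code d) ts) + replicate_mset (Suc d - length ts) Emp = add_mset (Node Z) W"
    using X(1) by (simp add: root_code_def at)
  have "Node Z \<in># mset (map (code d) ts) + replicate_mset (Suc d - length ts) Emp" unfolding eq by simp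
  then obtain s where s: "s \<in> set ts" "code d s = Node Z" by (auto split: if_splits)
  obtain us vs where ts: "ts = us @ s # vs" using s by (meson split_list)
  obtain b bs where sb: "s = LNode b bs" by (cases s)
  let ?t' = "LNode b (LNode a (us @ vs) # bs)"
  have perm: "mset ts = mset (s # us @ vs)" by (simp add: ts)
  note p = permuted_kids[OF perm, of a]
  have d0: "distinct_labels (LNode a (LNode b bs # us @ vs))" using t p(3) unfolding at sb by blast
  have "distinct_labels ?t'" using d0 unfolding distinct_labels_Cons by auto
  moreover have "graph_of ?t' = graph_of t"
    unfolding graph_of_def at p(1,2) unfolding sb by (auto simp: insert_commute)
  moreover have "root_code d ?t' = Node (add_mset (Node W) Z)"
  proof -
    have "W = mset (map (code d) (us @ vs)) + replicate_mset (d - length (us @ vs)) Emp"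
      using eq s(2) unfolding ts by simp
    then have "code d (LNode a (us @ vs)) = Node W" by simp
    moreover have "Z = mset (map (code d) bs) + replicate_mset (d - length bs) Emp" using s(2) sb by simp
    ultimately show ?thesis by (simp add: root_code_def del: code.simps)
  qed
  ultimately show thesis using that by blast
qed

section \<open>Minimal trees are greedy, and the greedy tree is minimal\<close>

context network begin

lemma minimal_tree_greedy:
  assumes tree: "tree_graph T" "card (gverts T) = n" "\<forall>v\<in>gverts T. vertex_degree T v \<le> Suc d" and n: "d + 2 \<le> n"
    and min: "\<And>c. full_root d c \<Longrightarrow> order c = n \<Longrightarrow> matching_gf (subdivision_graph T) x \<le> gf c"
  obtains t where "distinct_labels t" "graph_of t = T" "root_arity_le d t" "greedy_code d (root_code d t)"
proof -
  \<comment> \<open>The codes of the same graph for all choices of the root: maximising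
    \<open>val\<close> over them selects a vertex of maximal conductance.\<close>
  let ?R = "{root_code d t | t. distinct_labels t \<and> graph_of t = T}"
  have code: "root_arity_le d t \<and> full_root d (root_code d t) \<and> order (root_code d t) = n"
    if "distinct_labels t" "graph_of t = T" for t
  proof -
    have "labels t = gverts T" using that by (auto simp: graph_of_def)
    then have "root_arity_le d t" using tree(3) that root_arity_le_iff[of t d] by simp
    then show ?thesis using full_root_code order_root_code[OF that(1), of d] tree(2) \<open>labels t = gverts T\<close> by simp
  qed
  then have "?R \<subseteq> {c. full_root d c \<and> order c = n}" by blast
  then have fin: "finite ?R" using finite_full_root_order finite_subset by blast
  have "gverts T \<noteq> {}" using tree(1) by (simp add: tree_graph_def connected_graph_def)
  then obtain r where "r \<in> gverts T" by blast
  then have ne: "?R \<noteq> {}" using tree_graph_labelled[OF tree(1)] by blast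
  have "Max (val ` ?R) \<in> val ` ?R" using fin ne by (intro Max_in) auto
  then obtain t where t: "distinct_labels t" "graph_of t = T" "val (root_code d t) = Max (val ` ?R)" by auto
  have max: "val (root_code d t') \<le> val (root_code d t)" if "distinct_labels t'" "graph_of t' = T" for t'
    unfolding t(3) using fin that by (intro Max_ge) auto
  note ct = code[OF t(1,2)]
  have gf: "gf (root_code d t) = matching_gf (subdivision_graph T) x"
    using matching_gf_subdivision[OF t(1), of d] t(2) by simp
  have opt: "opt (root_code d t)" unfolding opt_def using ct min gf by simp
  obtain X where X: "root_code d t = Node X" by (simp add: root_code_def)
  have "greedy_code d (Node X)"
  proof (rule opt_greedy_code)
    show "opt (Node X)" using opt X by simp
    show "d + 2 \<le> order (Node X)" using ct n X by simp
    fix Z W assume ZW: "X = add_mset (Node Z) W"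
    have len: "length (kids t) \<le> Suc d" using ct by (simp add: root_arity_le_def)
    obtain t' where t': "distinct_labels t'" "graph_of t' = graph_of t" "root_code d t' = Node (add_mset (Node W) Z)"
      using reroot[OF t(1) _ len] X ZW by metis
    \<comment> \<open>Maximality compares the root with a neighbour by their total conductances;
      \<open>val_reroot_le\<close> turns this into a comparison of the two sides of the
      edge.\<close>
    have "val (root_code d t') \<le> val (root_code d t)" using max[OF t'(1)] t'(2) t(2) by simp
    then show "val (Node Z) \<le> val (Node W)" using val_reroot_le unfolding t'(3) X ZW by blast
  qed
  then show thesis using that[OF t(1,2)] ct X by simp
qed

text \<open>A minimal code \<open>m\<close> need not be rooted where its graph is greedy, so it is
  realised as a graph and rerooted there. The new code is \<open>g\<close> by uniqueness, and it has
  the same \<open>gf\<close> as \<open>m\<close> because the graph is the same.\<close>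

lemma greedy_code_minimal:
  assumes g: "greedy_code d g" "order g = n" and n: "d + 2 \<le> n" and c: "full_root d c" "order c = n"
  shows "gf g \<le> gf c"
proof -
  let ?S = "{c. full_root d c \<and> order c = n}"
  have "Min (gf ` ?S) \<in> gf ` ?S" using finite_full_root_order c by (intro Min_in) auto
  then obtain m where m: "full_root d m" "order m = n" "gf m = Min (gf ` ?S)" by auto
  have min: "gf m \<le> gf c" if "full_root d c" "order c = n" for c
    unfolding m(3) using finite_full_root_order that by (intro Min_le) auto
  obtain t :: "nat lt" where t: "distinct_labels t" "root_arity_le d t" "root_code d t = m"
    using realise_root[OF m(1)] by blast
  let ?T = "graph_of t"
  have card: "card (gverts ?T) = n" using order_root_code[OF t(1), of d] t(3) m(2) by simp
  have deg: "\<forall>v\<in>gverts ?T. vertex_degree ?T v \<le> Suc d" using t(2) root_arity_le_iff[OF t(1)] by simp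
  have M: "matching_gf (subdivision_graph ?T) x = gf m" using matching_gf_subdivision[OF t(1), of d] t(3) by simp
  obtain t' where t': "distinct_labels t'" "graph_of t' = ?T" "root_arity_le d t'" "greedy_code d (root_code d t')"
    using minimal_tree_greedy[OF tree_graph_of[OF t(1)] card deg n] min M by auto
  have "labels t' = gverts ?T" using t'(2) by (auto simp: graph_of_def)
  then have "order (root_code d t') = n" using order_root_code[OF t'(1), of d] card by simp
  then have "root_code d t' = g" using greedy_code_unique[OF d_pos t'(4) g(1)] g(2) by simp
  then have "gf g = gf m" using matching_gf_subdivision[OF t'(1), of d] t'(2) M by simp
  then show ?thesis using min c by simp
qed

end

section \<open>Isomorphic trees and their subdivisions\<close>

lemma isomorphic_matching_gf_subdivision:
  assumes T: "tree_graph T" and iso: "graph_isomorphic T T'" and x: "x > 0"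
  shows "matching_gf (subdivision_graph T) x = matching_gf (subdivision_graph T') x"
proof -
  \<comment> \<open>The generating function of a graph is the same for every padding number, so 1
    will do.\<close>
  interpret network x 1 using x by unfold_locales auto
  obtain f where f: "bij_betw f (gverts T) (gverts T')" "(\<lambda>e. f ` e) ` gedges T = gedges T'"
    using iso by (auto simp: graph_isomorphic_def)
  have "gverts T \<noteq> {}" using T by (simp add: tree_graph_def connected_graph_def)
  then obtain r where "r \<in> gverts T" by blast
  then obtain t where t: "distinct_labels t" "graph_of t = T" using tree_graph_labelled[OF T] by blast
  have lt: "labels t = gverts T" "ledges t = gedges T" using t(2) by (auto simp: graph_of_def)
  have "distinct_labels (map_lt f t)"
    using distinct_labels_map_lt[OF _ t(1), of f] f(1) lt by (simp add: bij_betw_def)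
  moreover have "graph_of (map_lt f t) = T'"
    using f lt by (simp add: graph_of_def labels_map_lt ledges_map_lt bij_betw_def prod_eq_iff)
  ultimately show ?thesis
    using matching_gf_subdivision[of "map_lt f t" 1] matching_gf_subdivision[OF t(1), of 1] t(2)
    by (simp add: root_code_map_lt)
qed

lemma isomorphic_subdivision:
  assumes simple: "finite_simple_graph T" and iso: "graph_isomorphic T T'"
  shows "graph_isomorphic (subdivision_graph T) (subdivision_graph T')"
proof -
  obtain f where f: "bij_betw f (gverts T) (gverts T')" "(\<lambda>e. f ` e) ` gedges T = gedges T'"
    using iso by (auto simp: graph_isomorphic_def)
  let ?F = "map_sum f (\<lambda>e. f ` e)"
  have sub: "gedges T \<subseteq> Pow (gverts T)" using simple by (force simp: finite_simple_graph_def)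
  have injf: "inj_on f (gverts T)" using f by (simp add: bij_betw_def)
  have inje: "inj_on (\<lambda>e. f ` e) (gedges T)"
    using inj_on_image_Pow[OF injf] sub by (rule inj_on_subset)
  have "inj_on ?F (Inl ` gverts T \<union> Inr ` gedges T)"
  proof (rule inj_onI)
    fix p q assume "p \<in> Inl ` gverts T \<union> Inr ` gedges T" "q \<in> Inl ` gverts T \<union> Inr ` gedges T" "?F p = ?F q"
    then show "p = q"
      by (cases p; cases q) (auto dest: inj_onD[OF injf] inj_onD[OF inje])
  qed
  moreover have "?F ` (Inl ` gverts T \<union> Inr ` gedges T) = Inl ` gverts T' \<union> Inr ` gedges T'"
    unfolding f(2)[symmetric] bij_betw_imp_surj_on[OF f(1), symmetric]
    by (simp add: image_Un image_image)
  moreover have "(\<lambda>e. ?F ` e) ` sub_edges (gedges T) = sub_edges (gedges T')"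
  proof -
    have sub: "sub_edges E = (\<Union>e\<in>E. (\<lambda>v. {Inl v, Inr e}) ` e)" for E :: "'c set set"
      by (auto simp: sub_edges_def)
    show ?thesis unfolding f(2)[symmetric] sub by (simp add: image_UN image_image)
  qed
  ultimately show ?thesis unfolding graph_isomorphic_def
    by (intro exI[of _ ?F]) (simp add: bij_betw_def subdivision_graph_def sub_edges_def)
qed

text \<open>Rooted at a vertex of maximum degree, the tree has \<open>d + 1\<close> nonempty
  branches. The bound later excludes empty branches at the root of a minimal tree.\<close>

lemma tree_class_order:
  assumes T: "T \<in> tree_class n (d + 1)"
  shows "d + 2 \<le> n"
proof -
  have tree: "tree_graph T" "card (gverts T) = n" "max_degree T = d + 1" using T by (auto simp: tree_class_def)
  then have "finite (gverts T)" "gverts T \<noteq> {}"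
    by (auto simp: tree_graph_def connected_graph_def finite_simple_graph_def)
  then have "max_degree T \<in> vertex_degree T ` gverts T" unfolding max_degree_def by (intro Max_in) auto
  then obtain r where r: "r \<in> gverts T" "vertex_degree T r = d + 1" using tree(3) by auto
  obtain t where t: "distinct_labels t" "lab t = r" "graph_of t = T" using tree_graph_labelled[OF tree(1) r(1)] by blast
  obtain a ts where at: "t = LNode a ts" by (cases t)
  have "length ts = d + 1" using root_degree[OF t(1)] r(2) t(2,3) at by simp
  moreover have "length us \<le> length (concat (map preorder us))" for us :: "'a lt list"
  proof (induction us)
    case (Cons s us)
    have "preorder s \<noteq> []" by simp
    then have "1 \<le> length (preorder s)" by (simp add: Suc_leI del: preorder_not_Nil)
    with Cons show ?case by simp
  qed simp
  ultimately have "d + 1 \<le> length (concat (map preorder ts))" by metis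
  moreover have "n = length (preorder t)" using card_labels[OF t(1)] tree(2) t(3) by (auto simp: graph_of_def)
  ultimately show ?thesis by (simp add: at)
qed

theorem theorem3p7:
  fixes d n :: nat
  assumes "d \<ge> 1"
  shows "((tree_class n (d + 1) :: nat ugraph set) \<noteq> {} \<longrightarrow>
            (\<exists>(Tstar :: nat ugraph) v0. greedy_tree d n Tstar v0)) \<and>
         (\<forall>(Tstar :: nat ugraph) v0. greedy_tree d n Tstar v0 \<longrightarrow>
            optimal_subdivision n (d + 1) (subdivision_graph Tstar) \<and>
            (\<forall>G :: (nat + nat set) ugraph. optimal_subdivision n (d + 1) G \<longrightarrow>
               graph_isomorphic G (subdivision_graph Tstar)) \<and>
            (\<forall>T \<in> (tree_class n (d + 1) :: nat ugraph set). \<forall>x > 0.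
               matching_gf (subdivision_graph Tstar) x \<le> matching_gf (subdivision_graph T) x \<and>
               (matching_gf (subdivision_graph Tstar) x = matching_gf (subdivision_graph T) x
                  \<longleftrightarrow> graph_isomorphic T Tstar)))"
proof (intro conjI impI allI)
  have d: "d > 0" using assms by simp
  have codes: "tree_graph T \<and> card (gverts T) = n \<and> (\<forall>v\<in>gverts T. vertex_degree T v \<le> Suc d) \<and> d + 2 \<le> n \<and>
      (\<exists>t. distinct_labels t \<and> graph_of t = T \<and> full_root d (root_code d t) \<and> order (root_code d t) = n)"
    if T: "T \<in> tree_class n (d + 1)" for T :: "nat ugraph"
  proof -
    have tree: "tree_graph T" "card (gverts T) = n" "max_degree T = d + 1" using T by (auto simp: tree_class_def)
    then obtain r where "r \<in> gverts T" by (auto simp: tree_graph_def connected_graph_def)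
    then obtain t where t: "distinct_labels t" "graph_of t = T" using tree_graph_labelled[OF tree(1)] by blast
    then have lt: "labels t = gverts T" by (auto simp: graph_of_def)
    have deg: "\<forall>v\<in>gverts T. vertex_degree T v \<le> Suc d" using tree(3) max_degree_graph_of[of t "d + 1"] lt t(2) by simp
    then have "full_root d (root_code d t)" using full_root_code root_arity_le_iff[OF t(1), of d] lt t(2) by simp
    then show ?thesis using tree t deg order_root_code[OF t(1), of d] lt tree_class_order[OF T] by auto
  qed
  {
    assume "(tree_class n (d + 1) :: nat ugraph set) \<noteq> {}"
    then obtain T :: "nat ugraph" where T: "T \<in> tree_class n (d + 1)" by blast
    \<comment> \<open>A minimiser at any one \<open>x\<close> is greedy, so existence can be
      obtained at \<open>x = 1\<close>.\<close>
    interpret network 1 d using d by unfold_locales auto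
    let ?S = "{c. full_root d c \<and> order c = n}"
    have "?S \<noteq> {}" using codes[OF T] by blast
    then have "Min (gf ` ?S) \<in> gf ` ?S" using finite_full_root_order by (intro Min_in) auto
    then obtain m where m: "full_root d m" "order m = n" "gf m = Min (gf ` ?S)" by auto
    obtain t :: "nat lt" where t: "distinct_labels t" "root_arity_le d t" "root_code d t = m"
      using realise_root[OF m(1)] by blast
    have card: "card (gverts (graph_of t)) = n" using order_root_code[OF t(1), of d] t(3) m(2) by simp
    have deg: "\<forall>v\<in>gverts (graph_of t). vertex_degree (graph_of t) v \<le> Suc d"
      using t(2) root_arity_le_iff[OF t(1)] by simp
    have "matching_gf (subdivision_graph (graph_of t)) 1 \<le> gf c" if "full_root d c" "order c = n" for c
      unfolding matching_gf_subdivision[OF t(1), of d] t(3) m(3)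
      using finite_full_root_order that by (intro Min_le) auto
    then obtain t' where t': "distinct_labels t'" "graph_of t' = graph_of t" "root_arity_le d t'" "greedy_code d (root_code d t')"
      using minimal_tree_greedy[OF tree_graph_of[OF t(1)] card deg] codes[OF T] by metis
    have "card (labels t') = n" using t'(2) card by (auto simp: graph_of_def)
    then show "\<exists>(Tstar :: nat ugraph) v0. greedy_tree d n Tstar v0"
      using greedy_tree_graph_of[OF d t'(1), of n] t' by blast
  }
  fix Tstar :: "nat ugraph" and v0
  assume greedy: "greedy_tree d n Tstar v0"
  then have star: "tree_graph Tstar" "v0 \<in> gverts Tstar" "Tstar \<in> tree_class n (d + 1)"
    by (auto simp: greedy_tree_def rooted_tree_def tree_class_def)
  obtain ts where ts: "distinct_labels ts" "lab ts = v0" "graph_of ts = Tstar"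
    using tree_graph_labelled[OF star(1,2)] by blast
  define g where "g = root_code d ts"
  have g: "greedy_code d g" "order g = n" "d + 2 \<le> n"
    using greedy_tree_graph_of[OF d ts(1), of n] greedy ts order_root_code[OF ts(1), of d]
      tree_class_order[OF star(3)] by (auto simp: g_def)
  have main: "matching_gf (subdivision_graph Tstar) x \<le> matching_gf (subdivision_graph T) x"
    "matching_gf (subdivision_graph Tstar) x = matching_gf (subdivision_graph T) x \<longleftrightarrow> graph_isomorphic T Tstar"
    if T: "T \<in> tree_class n (d + 1)" and x: "x > 0" for T :: "nat ugraph" and x
  proof -
    interpret network x d using x d by unfold_locales auto
    obtain t where t: "distinct_labels t" "graph_of t = T" "full_root d (root_code d t)" "order (root_code d t) = n"
      using codes[OF T] by blast
    have star_gf: "matching_gf (subdivision_graph Tstar) x = gf g"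
      using matching_gf_subdivision[OF ts(1), of d] ts(3) by (simp add: g_def)
    have T_gf: "matching_gf (subdivision_graph T) x = gf (root_code d t)"
      using matching_gf_subdivision[OF t(1), of d] t(2) by simp
    show "matching_gf (subdivision_graph Tstar) x \<le> matching_gf (subdivision_graph T) x"
      unfolding star_gf T_gf using greedy_code_minimal[OF g t(3,4)] .
    show "matching_gf (subdivision_graph Tstar) x = matching_gf (subdivision_graph T) x \<longleftrightarrow> graph_isomorphic T Tstar"
    proof
      assume eq: "matching_gf (subdivision_graph Tstar) x = matching_gf (subdivision_graph T) x"
      \<comment> \<open>Equality at this single \<open>x\<close> makes \<open>T\<close> a minimiser
        at \<open>x\<close>, hence greedy for a suitable root and of the same code as the greedy
        tree.\<close>
      have min: "matching_gf (subdivision_graph T) x \<le> gf c" if "full_root d c" "order c = n" for c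
        using greedy_code_minimal[OF g that] eq star_gf by simp
      have cT: "tree_graph T" "card (gverts T) = n" "\<forall>v\<in>gverts T. vertex_degree T v \<le> Suc d"
        using codes[OF T] by auto
      obtain t' where t': "distinct_labels t'" "graph_of t' = T" "root_arity_le d t'" "greedy_code d (root_code d t')"
        using minimal_tree_greedy[OF cT g(3) min] by blast
      have "labels t' = gverts T" using t'(2) by (auto simp: graph_of_def)
      then have "order (root_code d t') = n" using order_root_code[OF t'(1), of d] cT by simp
      then have "root_code d t' = g" using greedy_code_unique[OF d t'(4) g(1)] g(2) by simp
      then show "graph_isomorphic T Tstar"
        using root_code_eq_imp_iso[OF t'(1) ts(1), of d] t'(2) ts(3) by (simp add: g_def)
    next
      assume "graph_isomorphic T Tstar"
      then show "matching_gf (subdivision_graph Tstar) x = matching_gf (subdivision_graph T) x"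
        using isomorphic_matching_gf_subdivision[of T Tstar x] codes[OF T] x by simp
    qed
  qed
  show "optimal_subdivision n (d + 1) (subdivision_graph Tstar)"
    using star(3) main(1) unfolding optimal_subdivision_def subdivision_class_def by blast
  show "graph_isomorphic G (subdivision_graph Tstar)" if opt: "optimal_subdivision n (d + 1) G" for G :: "(nat + nat set) ugraph"
  proof -
    obtain T :: "nat ugraph" where T: "T \<in> tree_class n (d + 1)" "G = subdivision_graph T"
      using opt by (auto simp: optimal_subdivision_def subdivision_class_def)
    \<comment> \<open>Together with minimality of the greedy tree this gives equality at
      \<open>x = 1\<close>, which suffices for isomorphism.\<close>
    have "matching_gf (subdivision_graph T) 1 \<le> matching_gf (subdivision_graph Tstar) 1"
      using opt star(3) T(2) by (auto simp: optimal_subdivision_def)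
    then have "graph_isomorphic T Tstar" using main[OF T(1), of 1] by simp
    moreover have "finite_simple_graph T" using codes[OF T(1)] by (simp add: tree_graph_def)
    ultimately show ?thesis using isomorphic_subdivision T(2) by blast
  qed
  show "\<forall>T \<in> (tree_class n (d + 1) :: nat ugraph set). \<forall>x > 0.
               matching_gf (subdivision_graph Tstar) x \<le> matching_gf (subdivision_graph T) x \<and>
               (matching_gf (subdivision_graph Tstar) x = matching_gf (subdivision_graph T) x
                  \<longleftrightarrow> graph_isomorphic T Tstar)"
    using main by blast
qed

end
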